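(* If $L\subseteq\{0,1\}^*$ is a language decided by a $\mathrm{polylog}(n)$-time $m$-qubit quantum Turing machine (allowing for two-sided error), then $L$ is also decided by a $\mathrm{polylog}(n)$-time deterministic Turing machine with a $\mathrm{poly}(2^m)\cdot\mathrm{quasipoly}(n)$-time preprocessing step, a one-time cost for all inputs of length $n$.
   Context: Turing machines are random access machines (they can query any chosen input coordinate; the quantum machine queries input coordinates in the sense of the quantum query model), so sublinear running times are meaningful; $n$ denotes the input length. Two-sided error means that on every input the quantum machine answers correctly with probability at least $2/3$. $\mathrm{polylog}(n)=(\log n)^{O(1)}$ and $\mathrm{quasipoly}(n)=2^{\mathrm{polylog}(n)}$. A preprocessing step is a deterministic computation that depends only on the input length $n$ (not on the input itself), is performed once for each $n$, and whose output is available (with random access) to the deterministic machine when it is run on any input of length $n$. *)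

theory Defs
  imports Complex_Main "HOL-Library.Landau_Symbols"
begin

section \<open>Growth rates\<close>

definition polylog :: "(nat \<Rightarrow> nat) \<Rightarrow> bool" where
  "polylog f \<longleftrightarrow> (\<exists>c::nat. (\<lambda>n. real (f n)) \<in> O(\<lambda>n. log 2 (real n) ^ c))"

definition quasipoly :: "(nat \<Rightarrow> nat) \<Rightarrow> bool" where
  "quasipoly f \<longleftrightarrow> (\<exists>g. polylog g \<and> (\<forall>n. f n \<le> 2 ^ g n))"

definition polybounded :: "(nat \<Rightarrow> nat) \<Rightarrow> bool" where
  "polybounded f \<longleftrightarrow> (\<exists>c. \<forall>k. f k \<le> c * k ^ c + c)"


section \<open>Deterministic random access machines\<close>

text \<open>
  The deterministic machines are Cook--Reckhow random access machines.  Arithmetic is restricted to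
  addition and truncated subtraction, so the bit length of the largest register grows by at most
  a constant per step and the number of steps is polynomially related to Turing machine time.
  Besides its memory, a machine can probe two read-only bit strings at computed positions: the
  input and the output of the preprocessing.  Out-of-range probes return 0.
\<close>

datatype instr =
    Const nat nat
  | Add nat nat nat
  | Sub nat nat nat
  | Load nat nat
  | Store nat nat
  | Jump nat
  | JumpZero nat nat
  | ReadInput nat nat
  | ReadPre nat nat
  | Emit nat

record ram_state =
  pc :: nat
  mem :: "nat \<Rightarrow> nat"
  outp :: "bool list"

definition bit_at :: "bool list \<Rightarrow> nat \<Rightarrow> bool" where
  "bit_at x i \<longleftrightarrow> i < length x \<and> x ! i"

fun exec :: "bool list \<Rightarrow> bool list \<Rightarrow> instr \<Rightarrow> ram_state \<Rightarrow> ram_state" where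
  "exec x a (Const i c) s = s\<lparr>pc := Suc (pc s), mem := (mem s)(i := c)\<rparr>"
| "exec x a (Add i j k) s = s\<lparr>pc := Suc (pc s), mem := (mem s)(i := mem s j + mem s k)\<rparr>"
| "exec x a (Sub i j k) s = s\<lparr>pc := Suc (pc s), mem := (mem s)(i := mem s j - mem s k)\<rparr>"
| "exec x a (Load i j) s = s\<lparr>pc := Suc (pc s), mem := (mem s)(i := mem s (mem s j))\<rparr>"
| "exec x a (Store i j) s = s\<lparr>pc := Suc (pc s), mem := (mem s)(mem s i := mem s j)\<rparr>"
| "exec x a (Jump l) s = s\<lparr>pc := l\<rparr>"
| "exec x a (JumpZero i l) s = s\<lparr>pc := (if mem s i = 0 then l else Suc (pc s))\<rparr>"
| "exec x a (ReadInput i j) s =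
     s\<lparr>pc := Suc (pc s), mem := (mem s)(i := of_bool (bit_at x (mem s j)))\<rparr>"
| "exec x a (ReadPre i j) s =
     s\<lparr>pc := Suc (pc s), mem := (mem s)(i := of_bool (bit_at a (mem s j)))\<rparr>"
| "exec x a (Emit i) s = s\<lparr>pc := Suc (pc s), outp := outp s @ [mem s i \<noteq> 0]\<rparr>"

definition halted :: "instr list \<Rightarrow> ram_state \<Rightarrow> bool" where
  "halted P s \<longleftrightarrow> length P \<le> pc s"

definition ram_step :: "instr list \<Rightarrow> bool list \<Rightarrow> bool list \<Rightarrow> ram_state \<Rightarrow> ram_state" where
  "ram_step P x a s = (if halted P s then s else exec x a (P ! pc s) s)"

text \<open>
  As a halted machine no longer changes its state, being halted after \<open>t\<close> steps means having halted
  within \<open>t\<close> steps.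
\<close>

definition ram_run ::
    "instr list \<Rightarrow> bool list \<Rightarrow> bool list \<Rightarrow> nat \<Rightarrow> nat \<Rightarrow> ram_state" where
  "ram_run P x a n t = (ram_step P x a ^^ t) \<lparr>pc = 0, mem = (\<lambda>_. 0)(0 := n), outp = []\<rparr>"

definition preprocesses :: "instr list \<Rightarrow> nat \<Rightarrow> nat \<Rightarrow> bool list \<Rightarrow> bool" where
  "preprocesses P n t a \<longleftrightarrow> halted P (ram_run P [] [] n t) \<and> outp (ram_run P [] [] n t) = a"

text \<open>
  Starting the deciding machine with the input length in register 0 costs no generality, because
  the preprocessed string could supply it.
\<close>

definition ram_decides ::
    "instr list \<Rightarrow> bool list \<Rightarrow> bool list \<Rightarrow> nat \<Rightarrow> bool \<Rightarrow> bool" where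
  "ram_decides D x a t b \<longleftrightarrow>
     halted D (ram_run D x a (length x) t) \<and> (mem (ram_run D x a (length x) t) 0 \<noteq> 0) = b"

definition decided_with_preprocessing ::
    "bool list set \<Rightarrow> (nat \<Rightarrow> nat) \<Rightarrow> (nat \<Rightarrow> nat) \<Rightarrow> bool" where
  "decided_with_preprocessing L S T \<longleftrightarrow>
     (\<exists>P D. \<forall>n. \<exists>a. preprocesses P n (S n) a \<and>
        (\<forall>x. length x = n \<longrightarrow> ram_decides D x a (T n) (x \<in> L)))"


section \<open>Efficiently computable amplitudes\<close>

text \<open>
  As usual for quantum Turing machines, the transition amplitudes must be computable to within
  \<open>2^(-k)\<close> in time polynomial in \<open>k\<close>; arbitrary complex amplitudes could encode uncomputable
  information.  The signed approximation is the difference of registers 0 and 1, scaled by \<open>2^k\<close>.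
\<close>

definition eff_real :: "real \<Rightarrow> bool" where
  "eff_real r \<longleftrightarrow> (\<exists>P T. polybounded T \<and>
     (\<forall>k. let s = ram_run P [] [] k (T k) in
        halted P s \<and> \<bar>r - (real (mem s 0) - real (mem s 1)) / 2 ^ k\<bar> \<le> 1 / 2 ^ k))"

definition eff_complex :: "complex \<Rightarrow> bool" where
  "eff_complex z \<longleftrightarrow> eff_real (Re z) \<and> eff_real (Im z)"


section \<open>Quantum Turing machines with query access to the input\<close>

text \<open>
  Bernstein--Vazirani oracle quantum Turing machines: a work tape and a query tape, both two-way
  infinite, a finite control, and a complex transition amplitude for every local transition.  The
  oracle is the input string.
\<close>

datatype move = Lft | Stay | Rgt

fun shift :: "move \<Rightarrow> int \<Rightarrow> int" where
  "shift Lft h = h - 1"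
| "shift Stay h = h"
| "shift Rgt h = h + 1"

record ('q, 's) qtm =
  blank :: 's
  zero :: 's
  one :: 's
  start :: 'q
  acc :: 'q
  rej :: 'q
  prequery :: 'q
  postquery :: 'q
  delta :: "'q \<times> 's \<times> 's \<Rightarrow> 'q \<times> 's \<times> 's \<times> move \<times> move \<Rightarrow> complex"
    \<comment> \<open>(state, scanned work and query symbols) to (state, written symbols, head moves)\<close>

record ('q, 's) conf =
  state :: 'q
  work :: "int \<Rightarrow> 's"
  whead :: int
  query :: "int \<Rightarrow> 's"
  qhead :: int

type_synonym ('q, 's) superpos = "('q, 's) conf \<Rightarrow> complex"

definition confs :: "('q, 's) qtm \<Rightarrow> ('q, 's) conf set" where
  "confs M = {c. finite {j. work c j \<noteq> blank M} \<and> finite {j. query c j \<noteq> blank M}}"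

fun local_step ::
    "'q \<times> 's \<times> 's \<times> move \<times> move \<Rightarrow> ('q, 's) conf \<Rightarrow> ('q, 's) conf" where
  "local_step (q, u, v, d, e) c =
     \<lparr>state = q,
      work = (work c)(whead c := u), whead = shift d (whead c),
      query = (query c)(qhead c := v), qhead = shift e (qhead c)\<rparr>"

text \<open>
  The query tape addresses an input coordinate: cells \<open>0, 1, 2, \<dots>\<close> hold its binary digits, least
  significant first, every symbol other than \<open>one\<close> counting as digit 0.
\<close>

definition address :: "('q, 's) qtm \<Rightarrow> ('q, 's) conf \<Rightarrow> nat" where
  "address M c = (\<Sum>j | query c (int j) = one M. 2 ^ j)"

definition flip_bit :: "('q, 's) qtm \<Rightarrow> 's \<Rightarrow> 's" where
  "flip_bit M s = (if s = zero M then one M else if s = one M then zero M else s)"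

text \<open>
  The query \<open>|i, b\<rangle> \<mapsto> |i, b \<oplus> x\<^sub>i\<rangle>\<close>, where \<open>i\<close> is the address and \<open>b\<close> the bit scanned on the
  work tape.
\<close>

definition query_step ::
    "('q, 's) qtm \<Rightarrow> bool list \<Rightarrow> ('q, 's) conf \<Rightarrow> ('q, 's) conf" where
  "query_step M x c = c\<lparr>state := postquery M,
     work := (work c)(whead c :=
       (if bit_at x (address M c) then flip_bit M (work c (whead c)) else work c (whead c)))\<rparr>"

definition amplitude ::
    "('q, 's) qtm \<Rightarrow> bool list \<Rightarrow> ('q, 's) conf \<Rightarrow> ('q, 's) conf \<Rightarrow> complex" where
  "amplitude M x c c' =
     (if state c = prequery M then of_bool (c' = query_step M x c)
      else \<Sum>y | local_step y c = c'. delta M (state c, work c (whead c), query c (qhead c)) y)"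

definition supp :: "('q, 's) superpos \<Rightarrow> ('q, 's) conf set" where
  "supp \<phi> = {c. \<phi> c \<noteq> 0}"

definition evolve ::
    "('q, 's) qtm \<Rightarrow> bool list \<Rightarrow> ('q, 's) superpos \<Rightarrow> ('q, 's) superpos" where
  "evolve M x \<phi> = (\<lambda>c'. \<Sum>c\<in>supp \<phi>. \<phi> c * amplitude M x c c')"

text \<open>
  Norm preservation on finite superpositions is Bernstein and Vazirani's well-formedness condition;
  it is required for every oracle, that is, for every input string.
\<close>

definition well_formed :: "('q, 's) qtm \<Rightarrow> bool" where
  "well_formed M \<longleftrightarrow>
     distinct [blank M, zero M, one M] \<and>
     distinct [acc M, rej M, prequery M] \<and>
     (\<forall>y z. eff_complex (delta M y z)) \<and>
     (\<forall>x \<phi>. finite (supp \<phi>) \<and> supp \<phi> \<subseteq> confs M \<longrightarrow>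
        (\<Sum>c\<in>supp (evolve M x \<phi>). (cmod (evolve M x \<phi> c))\<^sup>2) = (\<Sum>c\<in>supp \<phi>. (cmod (\<phi> c))\<^sup>2))"

text \<open>
  The machine is started on the input length \<open>n\<close>, written in binary (least significant digit
  first) from cell 0 of the work tape; the input itself is accessible only through queries.
\<close>

definition init_conf :: "('q, 's) qtm \<Rightarrow> nat \<Rightarrow> ('q, 's) conf" where
  "init_conf M n =
     \<lparr>state = start M,
      work = (\<lambda>j. if 0 \<le> j \<and> 2 ^ nat j \<le> n
                  then (if odd (n div 2 ^ nat j) then one M else zero M) else blank M),
      whead = 0,
      query = (\<lambda>_. blank M), qhead = 0\<rparr>"

definition qrun :: "('q, 's) qtm \<Rightarrow> bool list \<Rightarrow> nat \<Rightarrow> ('q, 's) superpos" where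
  "qrun M x t = (evolve M x ^^ t) (\<lambda>c. of_bool (c = init_conf M (length x)))"

definition final_conf :: "('q, 's) qtm \<Rightarrow> ('q, 's) conf \<Rightarrow> bool" where
  "final_conf M c \<longleftrightarrow> state c = acc M \<or> state c = rej M"

text \<open>
  Halting in the sense of Bernstein and Vazirani: at time \<open>t\<close> the superposition contains only
  final configurations, at earlier times none.
\<close>

definition halts_at :: "('q, 's) qtm \<Rightarrow> bool list \<Rightarrow> nat \<Rightarrow> bool" where
  "halts_at M x t \<longleftrightarrow>
     (\<forall>c\<in>supp (qrun M x t). final_conf M c) \<and>
     (\<forall>t'<t. \<forall>c\<in>supp (qrun M x t'). \<not> final_conf M c)"

definition prob_state :: "('q, 's) qtm \<Rightarrow> bool list \<Rightarrow> nat \<Rightarrow> 'q \<Rightarrow> real" where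
  "prob_state M x t q = (\<Sum>c | c \<in> supp (qrun M x t) \<and> state c = q. (cmod (qrun M x t c))\<^sup>2)"

text \<open>
  The computation up to time \<open>t\<close> fits in \<open>m\<close> qubits: all branches are confined to tape regions
  \<open>W\<close>, \<open>Q\<close> whose contents span a space of dimension at most \<open>2^m\<close>.
\<close>

definition uses_qubits ::
    "('q, 's::finite) qtm \<Rightarrow> bool list \<Rightarrow> nat \<Rightarrow> nat \<Rightarrow> bool" where
  "uses_qubits M x t m \<longleftrightarrow>
     (\<exists>W Q. finite W \<and> finite Q \<and>
        card (UNIV :: 's set) ^ (card W + card Q) \<le> 2 ^ m \<and>
        (\<forall>t'\<le>t. \<forall>c\<in>supp (qrun M x t').
           whead c \<in> W \<and> {j. work c j \<noteq> blank M} \<subseteq> W \<and>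
           qhead c \<in> Q \<and> {j. query c j \<noteq> blank M} \<subseteq> Q))"

definition qtm_decides ::
    "('q::finite, 's::finite) qtm \<Rightarrow> bool list set \<Rightarrow> (nat \<Rightarrow> nat) \<Rightarrow> (nat \<Rightarrow> nat) \<Rightarrow> bool" where
  "qtm_decides M L T m \<longleftrightarrow> well_formed M \<and>
     (\<forall>x. \<exists>t\<le>T (length x). halts_at M x t \<and> uses_qubits M x t (m (length x)) \<and>
        (x \<in> L \<longrightarrow> prob_state M x t (acc M) \<ge> 2/3) \<and>
        (x \<notin> L \<longrightarrow> prob_state M x t (rej M) \<ge> 2/3))"

end

theory Submission
  imports Defs "HOL-Library.Disjoint_Sets" "HOL-Analysis.L2_Norm" "HOL-Analysis.Convex"
begin

text \<open>
  As the running time \<open>T\<close> is polylogarithmic, \<open>2 ^ T\<close> is already quasipolynomial, so the number of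
  qubits plays no role.  By the hybrid argument, inputs \<open>x\<close> and \<open>y\<close> with different answers differ in
  coordinates on which the machine, run on \<open>x\<close>, places total query weight at least of order
  \<open>1 / T\<close>.  Hence disjoint minimal sets of coordinates that flip the answer are few and small, every
  input has a certificate of polylogarithmic size, and \<open>L\<close> has decision trees of polylogarithmic depth.
  Certificates can be recognised by evaluating the answer on inputs with few ones only.  The
  preprocessing therefore computes the acceptance probabilities of all these inputs as sums over
  pairs of computation paths with approximate amplitudes, and writes down the decision tree that
  the deciding machine then descends.  All numbers are simulated by pseudo-polynomial programs
  under a quasipolynomial cap.
\<close>

section \<open>Verified code fragments\<close>

text \<open>One pair of programs must serve all \<open>n\<close>, while \<open>T\<close> is known
  only by its growth. Bounds are therefore stated in the number w = \<open>bits n\<close> of binary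
  digits: \<open>T\<close> is replaced by a computable majorant, and final configurations are
  frozen, so that halting times may depend on the input. Inputs with few ones suffice because a
  counterexample to an alleged certificate has a small certificate of its own: setting all
  coordinates outside both to 0 leaves it a counterexample. The paths are only quasipolynomially
  many, so summing over them replaces a state vector; the gap between 1/3 and 2/3 absorbs the
  rounding of amplitudes. There are two cost measures. The preprocessing may take time polynomial in
  the values it handles, which makes unary loops for multiplication, division and search affordable.
  The deciding machine has only time polynomial in w, although its table addresses have polynomially
  many bits in w; such numbers are typed as \<open>big\<close> and are only added, subtracted and
  used as probe positions.\<close>

definition code_at :: "instr list \<Rightarrow> nat \<Rightarrow> instr list \<Rightarrow> bool" where
  "code_at P b is \<longleftrightarrow> (\<exists>u v. P = u @ is @ v \<and> length u = b)"

text \<open>Jump targets are absolute, so a fragment is a function of its start address. Quantifying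
  over every host program and every address makes the statement stable under composition.\<close>

definition runs :: "bool list \<Rightarrow> bool list \<Rightarrow> (nat \<Rightarrow> instr list) \<Rightarrow> nat \<Rightarrow>
    (nat \<Rightarrow> nat) \<times> bool list \<Rightarrow> (nat \<Rightarrow> nat) \<times> bool list \<Rightarrow> bool" where
  "runs x a g t s s' \<longleftrightarrow> (\<forall>P b. code_at P b (g b) \<longrightarrow>
     (ram_step P x a ^^ t) \<lparr>pc = b, mem = fst s, outp = snd s\<rparr> =
       \<lparr>pc = b + length (g b), mem = fst s', outp = snd s'\<rparr>)"

definition seqc :: "(nat \<Rightarrow> instr list) \<Rightarrow> (nat \<Rightarrow> instr list) \<Rightarrow> nat \<Rightarrow> instr list" (infixr ";;" 60) where
  "(g ;; h) b = g b @ h (b + length (g b))"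

definition ifc :: "nat \<Rightarrow> (nat \<Rightarrow> instr list) \<Rightarrow> (nat \<Rightarrow> instr list) \<Rightarrow> nat \<Rightarrow> instr list" where
  "ifc i g h b = (let G = g (Suc b); l = b + length G + 2; H = h l
     in JumpZero i l # G @ [Jump (l + length H)] @ H)"

definition whilec :: "(nat \<Rightarrow> instr list) \<Rightarrow> nat \<Rightarrow> (nat \<Rightarrow> instr list) \<Rightarrow> nat \<Rightarrow> instr list" where
  "whilec p i g b = (let Q = p b; l = b + length Q; G = g (Suc l)
     in Q @ [JumpZero i (l + length G + 2)] @ G @ [Jump b])"

lemma code_at_append:
  "code_at P b (is @ js) \<Longrightarrow> code_at P b is" "code_at P b (is @ js) \<Longrightarrow> code_at P (b + length is) js"
  unfolding code_at_def by (metis append.assoc, metis append.assoc length_append)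

lemma code_at_Cons:
  assumes "code_at P b (i # is)"
  shows "b < length P" "P ! b = i" "code_at P (Suc b) is"
proof -
  from assms obtain u v where *: "P = u @ (i # is) @ v" "length u = b" unfolding code_at_def by blast
  then show "b < length P" "P ! b = i" by auto
  have "P = (u @ [i]) @ is @ v" "length (u @ [i]) = Suc b" using * by auto
  then show "code_at P (Suc b) is" unfolding code_at_def by blast
qed

lemma code_at_self: "code_at is 0 is"
  unfolding code_at_def by (intro exI[of _ "[]"]) auto

lemma funpow_trans: "(f ^^ s) a = b \<Longrightarrow> (f ^^ t) b = c \<Longrightarrow> (f ^^ (s + t)) a = c"
  by (metis add.commute comp_apply funpow_add)

lemma ram_step_at:
  assumes "code_at P b (i # is)"
  shows "ram_step P x a \<lparr>pc = b, mem = \<mu>, outp = out\<rparr> = exec x a i \<lparr>pc = b, mem = \<mu>, outp = out\<rparr>"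
  using code_at_Cons[OF assms] by (simp add: ram_step_def halted_def)

lemma runs_nil: "runs x a (\<lambda>_. []) 0 s s"
  by (simp add: runs_def)

lemma runs_instr:
  assumes "\<And>b. exec x a i \<lparr>pc = b, mem = \<mu>, outp = out\<rparr> = \<lparr>pc = Suc b, mem = \<mu>', outp = out'\<rparr>"
  shows "runs x a (\<lambda>_. [i]) 1 (\<mu>, out) (\<mu>', out')"
  unfolding runs_def using assms by (auto simp: ram_step_at)

lemma runs_seq:
  assumes "runs x a g t s s'" "runs x a h u s' s''"
  shows "runs x a (g ;; h) (t + u) s s''"
  unfolding runs_def
proof (intro allI impI)
  fix P b assume "code_at P b ((g ;; h) b)"
  then have 1: "code_at P b (g b)" and 2: "code_at P (b + length (g b)) (h (b + length (g b)))"
    unfolding seqc_def by (auto dest: code_at_append)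
  from assms(1)[unfolded runs_def, rule_format, OF 1] assms(2)[unfolded runs_def, rule_format, OF 2]
  show "(ram_step P x a ^^ (t + u)) \<lparr>pc = b, mem = fst s, outp = snd s\<rparr> =
    \<lparr>pc = b + length ((g ;; h) b), mem = fst s'', outp = snd s''\<rparr>"
    by (auto simp: seqc_def add.assoc intro: funpow_trans)
qed

lemma runs_if:
  assumes "if fst s i \<noteq> 0 then runs x a g t s s' else runs x a h t s s'"
  shows "\<exists>u\<le>t + 2. runs x a (ifc i g h) u s s'"
proof -
  have "runs x a (ifc i g h) (if fst s i \<noteq> 0 then 1 + (t + 1) else 1 + t) s s'"
    unfolding runs_def
  proof (intro allI impI)
    fix P b
    define G l where "G = g (Suc b)" and "l = b + length G + 2"
    define H where "H = h l"
    assume "code_at P b (ifc i g h b)"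
    then have c: "code_at P b (JumpZero i l # G @ [Jump (l + length H)] @ H)"
      by (simp add: ifc_def G_def l_def H_def Let_def)
    note c1 = code_at_Cons(3)[OF c]
    note cG = code_at_append(1)[OF c1]
    note c2 = code_at_append(2)[OF c1]
    have c2': "code_at P (Suc b + length G) (Jump (l + length H) # H)" using c2 by simp
    have cH: "code_at P l H" using code_at_Cons(3)[OF c2'] by (simp add: l_def)
    have s1: "(ram_step P x a ^^ 1) \<lparr>pc = b, mem = fst s, outp = snd s\<rparr> =
        \<lparr>pc = (if fst s i = 0 then l else Suc b), mem = fst s, outp = snd s\<rparr>"
      by (simp add: ram_step_at[OF c])
    have len: "b + length (ifc i g h b) = l + length H"
      by (simp add: ifc_def G_def l_def H_def Let_def)
    show "(ram_step P x a ^^ (if fst s i \<noteq> 0 then 1 + (t + 1) else 1 + t))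
        \<lparr>pc = b, mem = fst s, outp = snd s\<rparr> =
        \<lparr>pc = b + length (ifc i g h b), mem = fst s', outp = snd s'\<rparr>"
    proof (cases "fst s i = 0")
      case True
      then have "runs x a h t s s'" using assms by simp
      from this[unfolded runs_def, rule_format, of P l] cH
      have "(ram_step P x a ^^ t) \<lparr>pc = l, mem = fst s, outp = snd s\<rparr> =
        \<lparr>pc = l + length H, mem = fst s', outp = snd s'\<rparr>" by (simp add: H_def)
      with funpow_trans[of 1 "ram_step P x a" _ _ t, OF s1] True show ?thesis unfolding len by simp
    next
      case False
      then have "runs x a g t s s'" using assms by simp
      from this[unfolded runs_def, rule_format, of P "Suc b"] cG
      have 1: "(ram_step P x a ^^ t) \<lparr>pc = Suc b, mem = fst s, outp = snd s\<rparr> =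
        \<lparr>pc = Suc b + length G, mem = fst s', outp = snd s'\<rparr>" by (simp add: G_def)
      have 2: "(ram_step P x a ^^ 1) \<lparr>pc = Suc b + length G, mem = fst s', outp = snd s'\<rparr> =
        \<lparr>pc = l + length H, mem = fst s', outp = snd s'\<rparr>" 
        using ram_step_at[OF c2'] by simp
      have s1': "(ram_step P x a ^^ 1) \<lparr>pc = b, mem = fst s, outp = snd s\<rparr> =
        \<lparr>pc = Suc b, mem = fst s, outp = snd s\<rparr>" using s1 False by simp
      show ?thesis unfolding len using False funpow_trans[OF s1' funpow_trans[OF 1 2]] by simp
    qed
  qed
  then show ?thesis by (intro exI[of _ "if fst s i \<noteq> 0 then 1 + (t + 1) else 1 + t"]) auto
qed

text \<open>The test is itself code and may change scratch registers, hence two states per round: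
  \<open>s k\<close> before and \<open>s' k\<close> after the test.\<close>

lemma runs_while:
  assumes p: "\<And>k. k \<le> m \<Longrightarrow> runs x a p (tp k) (s k) (s' k)"
    and t: "\<And>k. k < m \<Longrightarrow> fst (s' k) i \<noteq> 0" and f: "fst (s' m) i = 0"
    and g: "\<And>k. k < m \<Longrightarrow> runs x a g (tg k) (s' k) (s (Suc k))"
  shows "runs x a (whilec p i g) ((\<Sum>k<m. tp k + tg k + 2) + tp m + 1) (s 0) (s' m)"
  unfolding runs_def
proof (intro allI impI)
  fix P b
  define Q l where "Q = p b" and "l = b + length Q"
  define G where "G = g (Suc l)"
  assume "code_at P b (whilec p i g b)"
  then have c: "code_at P b (Q @ [JumpZero i (l + length G + 2)] @ G @ [Jump b])"
    by (simp add: whilec_def Q_def l_def G_def Let_def)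
  note cQ = code_at_append(1)[OF c]
  have cJ: "code_at P l (JumpZero i (l + length G + 2) # G @ [Jump b])"
    using code_at_append(2)[OF c] by (simp add: l_def)
  note c1 = code_at_Cons(3)[OF cJ]
  note cG = code_at_append(1)[OF c1]
  note cE = code_at_append(2)[OF c1]
  have len: "b + length (whilec p i g b) = l + length G + 2"
    by (simp add: whilec_def Q_def l_def G_def Let_def)
  have Q: "(ram_step P x a ^^ tp k) \<lparr>pc = b, mem = fst (s k), outp = snd (s k)\<rparr> =
        \<lparr>pc = l, mem = fst (s' k), outp = snd (s' k)\<rparr>" if "k \<le> m" for k
    using p[OF that, unfolded runs_def, rule_format, of P b] cQ by (simp add: Q_def l_def)
  have J: "(ram_step P x a ^^ 1) \<lparr>pc = l, mem = \<mu>, outp = out\<rparr> =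
     \<lparr>pc = (if \<mu> i = 0 then l + length G + 2 else Suc l), mem = \<mu>, outp = out\<rparr>" for \<mu> out
    using ram_step_at[OF cJ] by simp
  have it: "(ram_step P x a ^^ (tp k + tg k + 2)) \<lparr>pc = b, mem = fst (s k), outp = snd (s k)\<rparr> =
     \<lparr>pc = b, mem = fst (s (Suc k)), outp = snd (s (Suc k))\<rparr>" if k: "k < m" for k
  proof -
    have 1: "(ram_step P x a ^^ 1) \<lparr>pc = l, mem = fst (s' k), outp = snd (s' k)\<rparr> =
      \<lparr>pc = Suc l, mem = fst (s' k), outp = snd (s' k)\<rparr>" using J t[OF k] by simp
    have 2: "(ram_step P x a ^^ tg k) \<lparr>pc = Suc l, mem = fst (s' k), outp = snd (s' k)\<rparr> =
      \<lparr>pc = Suc l + length G, mem = fst (s (Suc k)), outp = snd (s (Suc k))\<rparr>"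
      using g[OF k, unfolded runs_def, rule_format, of P "Suc l"] cG by (simp add: G_def)
    have 3: "(ram_step P x a ^^ 1) \<lparr>pc = Suc l + length G, mem = fst (s (Suc k)), outp = snd (s (Suc k))\<rparr> =
      \<lparr>pc = b, mem = fst (s (Suc k)), outp = snd (s (Suc k))\<rparr>"
      using ram_step_at[OF cE] by simp
    show ?thesis using funpow_trans[OF Q[OF less_imp_le[OF k]] funpow_trans[OF 1 funpow_trans[OF 2 3]]]
      by (simp add: algebra_simps)
  qed
  have all: "(ram_step P x a ^^ (\<Sum>k<j. tp k + tg k + 2)) \<lparr>pc = b, mem = fst (s 0), outp = snd (s 0)\<rparr> =
     \<lparr>pc = b, mem = fst (s j), outp = snd (s j)\<rparr>" if "j \<le> m" for j
    using that
  proof (induction j)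
    case (Suc j)
    then have "(ram_step P x a ^^ (\<Sum>k<j. tp k + tg k + 2)) \<lparr>pc = b, mem = fst (s 0), outp = snd (s 0)\<rparr> =
     \<lparr>pc = b, mem = fst (s j), outp = snd (s j)\<rparr>" by simp
    from funpow_trans[OF this it] Suc.prems show ?case by simp
  qed simp
  have "(ram_step P x a ^^ 1) \<lparr>pc = l, mem = fst (s' m), outp = snd (s' m)\<rparr> =
     \<lparr>pc = l + length G + 2, mem = fst (s' m), outp = snd (s' m)\<rparr>" using J f by simp
  from funpow_trans[OF all[of m] funpow_trans[OF Q[of m] this]]
  show "(ram_step P x a ^^ ((\<Sum>k<m. tp k + tg k + 2) + tp m + 1)) \<lparr>pc = b, mem = fst (s 0), outp = snd (s 0)\<rparr> =
     \<lparr>pc = b + length (whilec p i g b), mem = fst (s' m), outp = snd (s' m)\<rparr>"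
    unfolding len by (simp only: add.assoc le_refl)
qed

text \<open>Ascending copying is correct for overlapping blocks as soon as the destination precedes the source.\<close>

definition copyc :: "nat \<Rightarrow> nat \<Rightarrow> nat \<Rightarrow> nat \<Rightarrow> instr list" where
  "copyc dst src l b = concat (map (\<lambda>i. [Const (dst + i) 0, Add (dst + i) (dst + i) (src + i)]) [0..<l])"

lemma runs_copy:
  assumes "dst < src \<or> src + l \<le> dst"
  shows "runs x a (copyc dst src l) (2 * l) (\<mu>, out)
    ((\<lambda>j. if dst \<le> j \<and> j < dst + l then \<mu> (src + (j - dst)) else \<mu> j), out)"
  using assms
proof (induction l)
  case 0
  have "(\<lambda>j. if dst \<le> j \<and> j < dst + 0 then \<mu> (src + (j - dst)) else \<mu> j) = \<mu>" by auto
  then show ?case by (simp add: runs_def copyc_def)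
next
  case (Suc l)
  have eq: "copyc dst src (Suc l) = (copyc dst src l ;; (\<lambda>_. [Const (dst + l) 0]) ;; (\<lambda>_. [Add (dst + l) (dst + l) (src + l)]))"
    by (rule ext) (simp add: copyc_def seqc_def)
  let ?\<mu> = "\<lambda>j. if dst \<le> j \<and> j < dst + l then \<mu> (src + (j - dst)) else \<mu> j"
  let ?\<mu>' = "\<lambda>j. if dst \<le> j \<and> j < dst + Suc l then \<mu> (src + (j - dst)) else \<mu> j"
  have 1: "runs x a (\<lambda>_. [Const (dst + l) 0]) 1 (?\<mu>, out) (?\<mu>(dst + l := 0), out)"
    by (rule runs_instr) simp
  have n: "dst + l \<noteq> src + l" "\<not> (dst \<le> src + l \<and> src + l < dst + l)" using Suc.prems by auto
  have 2: "runs x a (\<lambda>_. [Add (dst + l) (dst + l) (src + l)]) 1 (?\<mu>(dst + l := 0), out) (?\<mu>', out)"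
    by (rule runs_instr) (use n in \<open>auto simp: fun_eq_iff\<close>)
  have "dst < src \<or> src + l \<le> dst" using Suc.prems by auto
  from runs_seq[OF Suc.IH[OF this] runs_seq[OF 1 2]] show ?case unfolding eq by simp
qed

section \<open>Functions computed by code fragments\<close>

text \<open>The number of registers depends on the type only, so that memory layouts are fixed when
  the code is written. \<open>sz\<close> measures the value of a number and not its digits, which
  makes polynomial bounds in \<open>sz\<close> pseudo-polynomial.\<close>

class regs =
  fixes enc :: "'a \<Rightarrow> nat list" and sz :: "'a \<Rightarrow> nat"
  assumes length_enc: "length (enc x) = length (enc y)"
    and enc_nonempty: "enc x \<noteq> []"

instantiation nat :: regs
begin
definition "enc (n::nat) = [n]"
definition "sz (n::nat) = n"
instance by standard (auto simp: enc_nat_def)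
end

instantiation bool :: regs
begin
definition "enc (b::bool) = [of_bool b]"
definition "sz (b::bool) = 1"
instance by standard (auto simp: enc_bool_def)
end

instantiation prod :: (regs, regs) regs
begin
definition "enc p = enc (fst p) @ enc (snd p)"
definition "sz p = sz (fst p) + sz (snd p)"
instance by standard (simp_all add: enc_prod_def enc_nonempty length_enc[of "fst _" undefined] length_enc[of "snd _" undefined])
end

text \<open>A number whose magnitude does not count towards the size of an argument.\<close>

datatype big = Big (unbig: nat)

instantiation big :: regs
begin
definition "enc b = [unbig b]"
definition "sz (b::big) = 0"
instance by standard (auto simp: enc_big_def)
end

lemmas enc_simps = enc_nat_def enc_bool_def enc_prod_def enc_big_def
lemmas sz_simps [simp] = sz_nat_def sz_bool_def sz_prod_def sz_big_def

definition width :: "'a::regs itself \<Rightarrow> nat" where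
  "width _ = length (enc (undefined :: 'a))"

lemma length_enc_width [simp]: "length (enc (x :: 'a::regs)) = width TYPE('a)"
  unfolding width_def by (rule length_enc)

lemma width_pos: "0 < width TYPE('a::regs)"
  using enc_nonempty[of "undefined :: 'a"] unfolding width_def by (simp del: length_enc_width)

lemma width_simps [simp]: "width TYPE(nat) = 1" "width TYPE(bool) = 1" "width TYPE(big) = 1"
  "width TYPE('a::regs \<times> 'b::regs) = width TYPE('a) + width TYPE('b)"
  unfolding width_def by (simp_all add: enc_simps length_enc[of "fst _" undefined] length_enc[of "snd _" undefined]
      del: length_enc_width)

definition holds :: "(nat \<Rightarrow> nat) \<Rightarrow> nat \<Rightarrow> 'a::regs \<Rightarrow> bool" where
  "holds \<mu> r c \<longleftrightarrow> (\<forall>i<width TYPE('a). \<mu> (r + i) = enc c ! i)"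

lemma holds_prod: "holds \<mu> r (p :: 'a::regs \<times> 'b::regs) \<longleftrightarrow> holds \<mu> r (fst p) \<and> holds \<mu> (r + width TYPE('a)) (snd p)"
proof
  assume h: "holds \<mu> r p"
  then have "holds \<mu> r (fst p)"
    unfolding holds_def by (auto simp: enc_prod_def nth_append)
  moreover have "\<mu> (r + width TYPE('a) + i) = enc (snd p) ! i" if "i < width TYPE('b)" for i
    using h[unfolded holds_def, rule_format, of "width TYPE('a) + i"] that
    by (simp add: enc_prod_def nth_append add.assoc)
  ultimately show "holds \<mu> r (fst p) \<and> holds \<mu> (r + width TYPE('a)) (snd p)"
    by (simp add: holds_def)
next
  assume h: "holds \<mu> r (fst p) \<and> holds \<mu> (r + width TYPE('a)) (snd p)"
  have "\<mu> (r + i) = enc p ! i" if "i < width TYPE('a) + width TYPE('b)" for i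
  proof (cases "i < width TYPE('a)")
    case True
    then show ?thesis using h by (auto simp: enc_prod_def nth_append holds_def)
  next
    case False
    then have 1: "i - width TYPE('a) < width TYPE('b)" and 2: "r + width TYPE('a) + (i - width TYPE('a)) = r + i"
      using that by auto
    have "\<mu> (r + width TYPE('a) + (i - width TYPE('a))) = enc (snd p) ! (i - width TYPE('a))"
      using h 1 unfolding holds_def by blast
    then show ?thesis unfolding 2 using False by (simp add: enc_prod_def nth_append)
  qed
  then show "holds \<mu> r p" unfolding holds_def by simp
qed

lemma holds_single [simp]:
  "holds \<mu> r (n::nat) \<longleftrightarrow> \<mu> r = n" "holds \<mu> r (b::bool) \<longleftrightarrow> \<mu> r = of_bool b"
  "holds \<mu> r (y::big) \<longleftrightarrow> \<mu> r = unbig y"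
  by (auto simp: holds_def enc_simps)

lemma holds_frame:
  assumes "holds \<mu> r (c::'a::regs)" "\<And>j. r \<le> j \<Longrightarrow> j < r + width TYPE('a) \<Longrightarrow> \<mu>' j = \<mu> j"
  shows "holds \<mu>' r c"
  using assms unfolding holds_def by auto

lemma holds_copy:
  fixes c :: "'a::regs"
  assumes "holds \<mu> src c" "l = width TYPE('a)"
  shows "holds (\<lambda>j. if dst \<le> j \<and> j < dst + l then \<mu> (src + (j - dst)) else \<mu> j) dst c"
  using assms unfolding holds_def by auto

type_synonym env = "bool list \<times> bool list"

text \<open>
  \<open>M\<close> bounds the registers that the fragment for base register \<open>r\<close> may change; the environment
  \<open>(x, a)\<close> consists of the input and the preprocessed string.
\<close>

definition implements :: "(nat \<Rightarrow> nat \<Rightarrow> instr list) \<Rightarrow> nat \<Rightarrow> (env \<Rightarrow> 'c::regs \<Rightarrow> 'd::regs) \<Rightarrow>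
    (env \<Rightarrow> 'c \<Rightarrow> bool list) \<Rightarrow> (env \<Rightarrow> 'c \<Rightarrow> nat) \<Rightarrow> bool" where
  "implements G M f h T \<longleftrightarrow> (\<forall>r x a \<mu> out c. holds \<mu> r c \<longrightarrow>
     (\<exists>t \<mu>'. t \<le> T (x, a) c \<and> runs x a (G r) t (\<mu>, out) (\<mu>', out @ h (x, a) c) \<and> holds \<mu>' r (f (x, a) c) \<and>
        (\<forall>j. j < r \<or> r + M \<le> j \<longrightarrow> \<mu>' j = \<mu> j)))"

definition emits :: "(env \<Rightarrow> 'c::regs \<Rightarrow> 'd::regs) \<Rightarrow> (env \<Rightarrow> 'c \<Rightarrow> bool list) \<Rightarrow> (env \<Rightarrow> 'c \<Rightarrow> nat) \<Rightarrow> bool" where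
  "emits f h T \<longleftrightarrow> (\<exists>G M. implements G M f h T)"

abbreviation computes :: "(env \<Rightarrow> 'c::regs \<Rightarrow> 'd::regs) \<Rightarrow> (env \<Rightarrow> 'c \<Rightarrow> nat) \<Rightarrow> bool" where
  "computes f T \<equiv> emits f (\<lambda>_ _. []) T"

lemma emitsI:
  fixes f :: "env \<Rightarrow> 'c::regs \<Rightarrow> 'd::regs"
  assumes "\<And>r x a \<mu> out c. holds \<mu> r c \<Longrightarrow>
     \<exists>t \<mu>'. t \<le> T (x, a) c \<and> runs x a (G r) t (\<mu>, out) (\<mu>', out @ h (x, a) c) \<and> holds \<mu>' r (f (x, a) c) \<and>
        (\<forall>j. j < r \<or> r + M \<le> j \<longrightarrow> \<mu>' j = \<mu> j)"
  shows "emits f h T"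
  unfolding emits_def implements_def by (rule exI[of _ G], rule exI[of _ M], intro allI impI, rule assms)

lemma emitsE:
  assumes "emits f h T"
  obtains G M where "implements G M f h T"
  using assms unfolding emits_def by blast

lemma implementsD:
  assumes "implements G M f h T" "holds \<mu> r c"
  shows "\<exists>t \<mu>'. t \<le> T (x, a) c \<and> runs x a (G r) t (\<mu>, out) (\<mu>', out @ h (x, a) c) \<and> holds \<mu>' r (f (x, a) c) \<and>
        (\<forall>j. j < r \<or> r + M \<le> j \<longrightarrow> \<mu>' j = \<mu> j)"
  using assms unfolding implements_def by simp

lemma emits_mono:
  assumes "emits f h T" "\<And>e c. T e c \<le> U e c" "\<And>e c. f' e c = f e c" "\<And>e c. h' e c = h e c"
  shows "emits f' h' U"
proof -
  have "f' = f" "h' = h" using assms(3,4) by blast+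
  moreover obtain G M where "implements G M f h T" by (rule emitsE[OF assms(1)])
  note G = implementsD[OF this]
  have "emits f h U"
    by (rule emitsI[where G = G and M = M], drule G) (use assms(2) order_trans in blast)
  ultimately show ?thesis by simp
qed

lemma emits_comp:
  assumes "emits f h T" "emits g k U" "\<And>e c. T e c + U e (f e c) \<le> V e c"
  shows "emits (\<lambda>e c. g e (f e c)) (\<lambda>e c. h e c @ k e (f e c)) V"
proof -
  obtain G M where "implements G M f h T" by (rule emitsE[OF assms(1)])
  note G = implementsD[OF this]
  obtain H N where "implements H N g k U" by (rule emitsE[OF assms(2)])
  note H = implementsD[OF this]
  show ?thesis
  proof (rule emitsI[where G = "\<lambda>r. G r ;; H r" and M = "max M N"])
    fix r x a \<mu> out and c :: 'a assume "holds \<mu> r c"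
    from G[OF this, of x a out] obtain t \<mu>' where 1: "t \<le> T (x, a) c" "runs x a (G r) t (\<mu>, out) (\<mu>', out @ h (x, a) c)"
      "holds \<mu>' r (f (x, a) c)" "\<forall>j. j < r \<or> r + M \<le> j \<longrightarrow> \<mu>' j = \<mu> j" by blast
    from H[OF 1(3), of x a "out @ h (x, a) c"] obtain t' \<mu>'' where 2: "t' \<le> U (x, a) (f (x, a) c)"
      "runs x a (H r) t' (\<mu>', out @ h (x, a) c) (\<mu>'', (out @ h (x, a) c) @ k (x, a) (f (x, a) c))"
      "holds \<mu>'' r (g (x, a) (f (x, a) c))" "\<forall>j. j < r \<or> r + N \<le> j \<longrightarrow> \<mu>'' j = \<mu>' j" by blast
    show "\<exists>t \<mu>'. t \<le> V (x, a) c \<and> runs x a (G r ;; H r) t (\<mu>, out) (\<mu>', out @ h (x, a) c @ k (x, a) (f (x, a) c)) \<and>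
       holds \<mu>' r (g (x, a) (f (x, a) c)) \<and> (\<forall>j. j < r \<or> r + max M N \<le> j \<longrightarrow> \<mu>' j = \<mu> j)"
      using runs_seq[OF 1(2) 2(2)] 1 2 assms(3)[of "(x, a)" c]
      by (intro exI[of _ "t + t'"] exI[of _ \<mu>'']) auto
  qed
qed

lemma computes_comp:
  assumes "computes f T" "computes g U" "\<And>e c. T e c + U e (f e c) \<le> V e c"
  shows "computes (\<lambda>e c. g e (f e c)) V"
  using emits_comp[OF assms] by simp

text \<open>A fragment for base \<open>r\<close> leaves the registers below \<open>r\<close> alone,
  so registers can be used as a stack: \<open>f\<close> runs on a copy of the argument above the
  original, \<open>g\<close> on a copy above the value of \<open>f\<close>, and the two adjacent
  values are moved down to \<open>r\<close>.\<close>

lemma computes_pair: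
  fixes f :: "env \<Rightarrow> 'c::regs \<Rightarrow> 'd::regs" and g :: "env \<Rightarrow> 'c \<Rightarrow> 'e::regs"
  assumes "computes f T" "computes g U"
  shows "computes (\<lambda>e c. (f e c, g e c)) (\<lambda>e c. T e c + U e c + 4 * width TYPE('c) + 2 * width TYPE('d) + 2 * width TYPE('e))"
proof -
  obtain G M where "implements G M f (\<lambda>_ _. []) T" by (rule emitsE[OF assms(1)])
  note G = implementsD[OF this]
  obtain H N where "implements H N g (\<lambda>_ _. []) U" by (rule emitsE[OF assms(2)])
  note H = implementsD[OF this]
  define k p q where "k = width TYPE('c)" and "p = width TYPE('d)" and "q = width TYPE('e)"
  have kp: "0 < k" by (simp add: k_def width_pos)
  show ?thesis
  proof (rule emitsI[where G = "\<lambda>r. copyc (r + k) r k ;; G (r + k) ;; copyc (r + k + p) r k ;;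
        H (r + k + p) ;; copyc r (r + k) (p + q)" and M = "k + p + k + q + M + N"])
    fix r x a \<mu> out and c :: 'c assume h0: "holds \<mu> r c"
    define \<mu>1 where "\<mu>1 = (\<lambda>j. if r + k \<le> j \<and> j < r + k + k then \<mu> (r + (j - (r + k))) else \<mu> j)"
    have r1: "runs x a (copyc (r + k) r k) (2 * k) (\<mu>, out) (\<mu>1, out)"
      unfolding \<mu>1_def by (rule runs_copy) simp
    have h1: "holds \<mu>1 (r + k) c" unfolding \<mu>1_def by (rule holds_copy[OF h0]) (simp add: k_def)
    have h1': "holds \<mu>1 r c" by (rule holds_frame[OF h0]) (simp add: \<mu>1_def k_def)
    from G[OF h1, of x a out] obtain t \<mu>2 where 2: "t \<le> T (x, a) c" "runs x a (G (r + k)) t (\<mu>1, out) (\<mu>2, out)"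
      "holds \<mu>2 (r + k) (f (x, a) c)" "\<And>j. j < r + k \<or> r + k + M \<le> j \<Longrightarrow> \<mu>2 j = \<mu>1 j" by auto
    have h2: "holds \<mu>2 r c" by (rule holds_frame[OF h1']) (use 2(4) in \<open>simp add: k_def\<close>)
    define \<mu>3 where "\<mu>3 = (\<lambda>j. if r + k + p \<le> j \<and> j < r + k + p + k then \<mu>2 (r + (j - (r + k + p))) else \<mu>2 j)"
    have r3: "runs x a (copyc (r + k + p) r k) (2 * k) (\<mu>2, out) (\<mu>3, out)"
      unfolding \<mu>3_def by (rule runs_copy) simp
    have h3: "holds \<mu>3 (r + k + p) c" unfolding \<mu>3_def by (rule holds_copy[OF h2]) (simp add: k_def)
    from H[OF h3, of x a out] obtain t' \<mu>4 where 4: "t' \<le> U (x, a) c" "runs x a (H (r + k + p)) t' (\<mu>3, out) (\<mu>4, out)"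
      "holds \<mu>4 (r + k + p) (g (x, a) c)" "\<And>j. j < r + k + p \<or> r + k + p + N \<le> j \<Longrightarrow> \<mu>4 j = \<mu>3 j" by auto
    have h4: "holds \<mu>4 (r + k) (f (x, a) c)"
      by (rule holds_frame[OF 2(3)]) (use 4(4) in \<open>simp add: \<mu>3_def p_def\<close>)
    have h4': "holds \<mu>4 (r + k) (f (x, a) c, g (x, a) c)"
      using h4 4(3) by (simp add: holds_prod p_def)
    define \<mu>5 where "\<mu>5 = (\<lambda>j. if r \<le> j \<and> j < r + (p + q) then \<mu>4 (r + k + (j - r)) else \<mu>4 j)"
    have r5: "runs x a (copyc r (r + k) (p + q)) (2 * (p + q)) (\<mu>4, out) (\<mu>5, out)"
      unfolding \<mu>5_def by (rule runs_copy) (use kp in simp)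
    have h5: "holds \<mu>5 r (f (x, a) c, g (x, a) c)" unfolding \<mu>5_def by (rule holds_copy[OF h4']) (simp add: p_def q_def)
    have fr: "\<mu>5 j = \<mu> j" if "j < r \<or> r + (k + p + k + q + M + N) \<le> j" for j
      using that 2(4)[of j] 4(4)[of j] by (auto simp: \<mu>5_def \<mu>3_def \<mu>1_def)
    show "\<exists>t \<mu>'. t \<le> T (x, a) c + U (x, a) c + 4 * width TYPE('c) + 2 * width TYPE('d) + 2 * width TYPE('e) \<and>
         runs x a (copyc (r + k) r k ;; G (r + k) ;; copyc (r + k + p) r k ;; H (r + k + p) ;; copyc r (r + k) (p + q)) t
           (\<mu>, out) (\<mu>', out @ []) \<and> holds \<mu>' r (f (x, a) c, g (x, a) c) \<and>
         (\<forall>j. j < r \<or> r + (k + p + k + q + M + N) \<le> j \<longrightarrow> \<mu>' j = \<mu> j)"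
      using runs_seq[OF r1 runs_seq[OF 2(2) runs_seq[OF r3 runs_seq[OF 4(2) r5]]]] h5 fr 2(1) 4(1)
      by (intro exI[of _ "2 * k + (t + (2 * k + (t' + 2 * (p + q))))"] exI[of _ \<mu>5]) (auto simp: k_def p_def q_def)
  qed
qed

text \<open>If the code of the result is a prefix of the code of the argument, the result is already
  in place. This covers first projections and changes of type such as from \<open>nat\<close> to
  \<open>big\<close>.\<close>

lemma computes_reinterpret:
  fixes f :: "env \<Rightarrow> 'c::regs \<Rightarrow> 'd::regs"
  assumes "\<And>e c. \<exists>zs. enc c = enc (f e c) @ zs"
  shows "computes f (\<lambda>_ _. 0)"
proof (rule emitsI[where G = "\<lambda>r b. []" and M = 0])
  fix r x a \<mu> out and c :: 'c assume h: "holds \<mu> r c"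
  obtain zs where zs: "enc c = enc (f (x, a) c) @ zs" using assms by blast
  then have "length (enc c) = length (enc (f (x, a) c)) + length zs" by simp
  then have "width TYPE('d) \<le> width TYPE('c)" by simp
  with h zs have "holds \<mu> r (f (x, a) c)" unfolding holds_def by (auto simp: nth_append)
  then show "\<exists>t \<mu>'. t \<le> 0 \<and> runs x a (\<lambda>b. []) t (\<mu>, out) (\<mu>', out @ []) \<and> holds \<mu>' r (f (x, a) c) \<and>
    (\<forall>j. j < r \<or> r + 0 \<le> j \<longrightarrow> \<mu>' j = \<mu> j)"
    using runs_nil by (intro exI[of _ 0] exI[of _ \<mu>]) auto
qed

lemma computes_id: "computes (\<lambda>_ c. c) (\<lambda>_ _. 0)"
  by (rule computes_reinterpret) auto

lemma computes_fst: "computes (\<lambda>_ c. fst c) (\<lambda>_ _. 0)"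
  by (rule computes_reinterpret) (auto simp: enc_simps)

lemma computes_snd: "computes (\<lambda>_ (c :: 'c::regs \<times> 'd::regs). snd c) (\<lambda>_ _. 2 * width TYPE('d))"
proof (rule emitsI[where G = "\<lambda>r. copyc r (r + width TYPE('c)) (width TYPE('d))" and M = "width TYPE('d)"])
  fix r x a \<mu> out and c :: "'c \<times> 'd" assume h: "holds \<mu> r c"
  show "\<exists>t \<mu>'. t \<le> 2 * width TYPE('d) \<and> runs x a (copyc r (r + width TYPE('c)) (width TYPE('d))) t (\<mu>, out) (\<mu>', out @ []) \<and>
    holds \<mu>' r (snd c) \<and> (\<forall>j. j < r \<or> r + width TYPE('d) \<le> j \<longrightarrow> \<mu>' j = \<mu> j)"
    using runs_copy[of r "r + width TYPE('c)" "width TYPE('d)" x a \<mu> out] width_pos[where 'a = 'c] h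
      holds_copy[of \<mu> "r + width TYPE('c)" "snd c" "width TYPE('d)" r]
    by (intro exI[of _ "2 * width TYPE('d)"] exI[of _ "\<lambda>j. if r \<le> j \<and> j < r + width TYPE('d)
        then \<mu> (r + width TYPE('c) + (j - r)) else \<mu> j"]) (auto simp: holds_prod)
qed

lemma computes_instr:
  fixes f :: "env \<Rightarrow> 'c::regs \<Rightarrow> 'd::regs"
  assumes w: "width TYPE('d) = 1"
    and ex: "\<And>r x a \<mu> b out c. holds \<mu> r c \<Longrightarrow>
      exec x a (i r) \<lparr>pc = b, mem = \<mu>, outp = out\<rparr> =
        \<lparr>pc = Suc b, mem = \<mu>(r := hd (enc (f (x, a) c))), outp = out\<rparr>"
  shows "computes f (\<lambda>_ _. 1)"
proof (rule emitsI[where G = "\<lambda>r b. [i r]" and M = 1])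
  fix r x a \<mu> out and c :: 'c assume h: "holds \<mu> r c"
  define \<mu>' where "\<mu>' = \<mu>(r := hd (enc (f (x, a) c)))"
  have "runs x a (\<lambda>_. [i r]) 1 (\<mu>, out) (\<mu>', out)"
    by (rule runs_instr) (simp add: ex[OF h] \<mu>'_def)
  moreover have "holds \<mu>' r (f (x, a) c)"
    using w enc_nonempty[of "f (x, a) c"] by (simp add: holds_def \<mu>'_def hd_conv_nth)
  ultimately show "\<exists>t \<mu>'. t \<le> 1 \<and> runs x a (\<lambda>b. [i r]) t (\<mu>, out) (\<mu>', out @ []) \<and>
    holds \<mu>' r (f (x, a) c) \<and> (\<forall>j. j < r \<or> r + 1 \<le> j \<longrightarrow> \<mu>' j = \<mu> j)"
    by (intro exI[of _ 1] exI[of _ \<mu>']) (auto simp: \<mu>'_def)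
qed

lemma computes_const:
  "width TYPE('d) = 1 \<Longrightarrow> computes (\<lambda>_ (_::'c::regs). v :: 'd::regs) (\<lambda>_ _. 1)"
  by (rule computes_instr[where i = "\<lambda>r. Const r (hd (enc v))"]) auto

lemma computes_add: "computes (\<lambda>_ p. fst p + snd p :: nat) (\<lambda>_ _. 1)"
  by (rule computes_instr[where i = "\<lambda>r. Add r r (r + 1)"]) (auto simp: holds_prod enc_simps)

lemma computes_sub: "computes (\<lambda>_ p. fst p - snd p :: nat) (\<lambda>_ _. 1)"
  by (rule computes_instr[where i = "\<lambda>r. Sub r r (r + 1)"]) (auto simp: holds_prod enc_simps)

lemma computes_big_add: "computes (\<lambda>_ p. Big (unbig (fst p) + unbig (snd p))) (\<lambda>_ _. 1)"
  by (rule computes_instr[where i = "\<lambda>r. Add r r (r + 1)"]) (auto simp: holds_prod enc_simps)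

lemma computes_big_sub: "computes (\<lambda>_ p. Big (unbig (fst p) - unbig (snd p))) (\<lambda>_ _. 1)"
  by (rule computes_instr[where i = "\<lambda>r. Sub r r (r + 1)"]) (auto simp: holds_prod enc_simps)

lemma computes_read_input: "computes (\<lambda>e i. bit_at (fst e) (unbig i)) (\<lambda>_ _. 1)"
  by (rule computes_instr[where i = "\<lambda>r. ReadInput r r"]) (auto simp: enc_simps)

lemma computes_read_pre: "computes (\<lambda>e i. bit_at (snd e) (unbig i)) (\<lambda>_ _. 1)"
  by (rule computes_instr[where i = "\<lambda>r. ReadPre r r"]) (auto simp: enc_simps)

text \<open>The test works on a copy above the argument, because the argument itself is still needed
  afterwards.\<close>

definition testc :: "(nat \<Rightarrow> nat \<Rightarrow> instr list) \<Rightarrow> nat \<Rightarrow> nat \<Rightarrow> nat \<Rightarrow> instr list" where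
  "testc Q k r = (copyc (r + k) r k ;; Q (r + k))"

lemma runs_testc:
  fixes c :: "'c::regs"
  assumes "implements Q L p (\<lambda>_ _. []) R" "k = width TYPE('c)" "holds \<mu> r c"
  shows "\<exists>t \<mu>'. t \<le> 2 * k + R (x, a) c \<and> runs x a (testc Q k r) t (\<mu>, out) (\<mu>', out) \<and>
    holds \<mu>' r c \<and> holds \<mu>' (r + k) (p (x, a) c) \<and> (\<forall>j. j < r \<or> r + (k + k + L) \<le> j \<longrightarrow> \<mu>' j = \<mu> j)"
proof -
  define \<mu>1 where "\<mu>1 = (\<lambda>j. if r + k \<le> j \<and> j < r + k + k then \<mu> (r + (j - (r + k))) else \<mu> j)"
  have r1: "runs x a (copyc (r + k) r k) (2 * k) (\<mu>, out) (\<mu>1, out)"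
    unfolding \<mu>1_def by (rule runs_copy) simp
  have h1: "holds \<mu>1 (r + k) c" unfolding \<mu>1_def by (rule holds_copy[OF assms(3,2)])
  have h1': "holds \<mu>1 r c" by (rule holds_frame[OF assms(3)]) (simp add: \<mu>1_def assms(2))
  from implementsD[OF assms(1) h1, of x a out] obtain t \<mu>2 where 2: "t \<le> R (x, a) c"
    "runs x a (Q (r + k)) t (\<mu>1, out) (\<mu>2, out)" "holds \<mu>2 (r + k) (p (x, a) c)"
    "\<And>j. j < r + k \<or> r + k + L \<le> j \<Longrightarrow> \<mu>2 j = \<mu>1 j" by auto
  have "holds \<mu>2 r c" by (rule holds_frame[OF h1']) (use 2(4) in \<open>simp add: assms(2)\<close>)
  moreover have "\<mu>2 j = \<mu> j" if "j < r \<or> r + (k + k + L) \<le> j" for j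
    using that 2(4)[of j] by (auto simp: \<mu>1_def)
  ultimately show ?thesis using runs_seq[OF r1 2(2)] 2
    by (intro exI[of _ "2 * k + t"] exI[of _ \<mu>2]) (auto simp: testc_def)
qed

lemma computes_if:
  fixes f g :: "env \<Rightarrow> 'c::regs \<Rightarrow> 'd::regs" and p :: "env \<Rightarrow> 'c \<Rightarrow> nat"
  assumes "computes p R" "computes f T" "computes g U"
  shows "computes (\<lambda>e c. if p e c \<noteq> 0 then f e c else g e c) (\<lambda>e c. R e c + max (T e c) (U e c) + 2 * width TYPE('c) + 2)"
proof -
  obtain Q L where "implements Q L p (\<lambda>_ _. []) R" by (rule emitsE[OF assms(1)])
  note Q = runs_testc[OF this refl]
  obtain G M where "implements G M f (\<lambda>_ _. []) T" by (rule emitsE[OF assms(2)])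
  note G = implementsD[OF this]
  obtain H N where "implements H N g (\<lambda>_ _. []) U" by (rule emitsE[OF assms(3)])
  note H = implementsD[OF this]
  define k where "k = width TYPE('c)"
  show ?thesis
  proof (rule emitsI[where G = "\<lambda>r. testc Q k r ;; ifc (r + k) (G r) (H r)"
        and M = "k + k + L + M + N"])
    fix r x a \<mu> out and c :: 'c assume h0: "holds \<mu> r c"
    from Q[OF h0, folded k_def, of x a out] obtain t \<mu>2 where 2: "t \<le> 2 * k + R (x, a) c" "runs x a (testc Q k r) t (\<mu>, out) (\<mu>2, out)"
      "holds \<mu>2 r c" "\<mu>2 (r + k) = p (x, a) c" "\<And>j. j < r \<or> r + (k + k + L) \<le> j \<Longrightarrow> \<mu>2 j = \<mu> j" by auto
    have "\<exists>t' \<mu>3. t' \<le> max (T (x, a) c) (U (x, a) c) \<and>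
       (if \<mu>2 (r + k) \<noteq> 0 then runs x a (G r) t' (\<mu>2, out) (\<mu>3, out) else runs x a (H r) t' (\<mu>2, out) (\<mu>3, out)) \<and>
       holds \<mu>3 r (if p (x, a) c \<noteq> 0 then f (x, a) c else g (x, a) c) \<and>
       (\<forall>j. j < r \<or> r + (M + N) \<le> j \<longrightarrow> \<mu>3 j = \<mu>2 j)"
    proof (cases "p (x, a) c = 0")
      case True
      from H[OF 2(3), of x a out] obtain t' \<mu>3 where "t' \<le> U (x, a) c" "runs x a (H r) t' (\<mu>2, out) (\<mu>3, out)"
        "holds \<mu>3 r (g (x, a) c)" "\<forall>j. j < r \<or> r + N \<le> j \<longrightarrow> \<mu>3 j = \<mu>2 j" by auto
      then show ?thesis using True 2(4) by (intro exI[of _ t'] exI[of _ \<mu>3]) auto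
    next
      case False
      from G[OF 2(3), of x a out] obtain t' \<mu>3 where "t' \<le> T (x, a) c" "runs x a (G r) t' (\<mu>2, out) (\<mu>3, out)"
        "holds \<mu>3 r (f (x, a) c)" "\<forall>j. j < r \<or> r + M \<le> j \<longrightarrow> \<mu>3 j = \<mu>2 j" by auto
      then show ?thesis using False 2(4) by (intro exI[of _ t'] exI[of _ \<mu>3]) auto
    qed
    then obtain t' \<mu>3 where 3: "t' \<le> max (T (x, a) c) (U (x, a) c)"
      "if \<mu>2 (r + k) \<noteq> 0 then runs x a (G r) t' (\<mu>2, out) (\<mu>3, out) else runs x a (H r) t' (\<mu>2, out) (\<mu>3, out)"
      "holds \<mu>3 r (if p (x, a) c \<noteq> 0 then f (x, a) c else g (x, a) c)"
      "\<And>j. j < r \<or> r + (M + N) \<le> j \<Longrightarrow> \<mu>3 j = \<mu>2 j" by blast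
    have "if fst (\<mu>2, out) (r + k) \<noteq> 0 then runs x a (G r) t' (\<mu>2, out) (\<mu>3, out) else runs x a (H r) t' (\<mu>2, out) (\<mu>3, out)"
      using 3(2) by simp
    from runs_if[OF this] obtain u where u: "u \<le> t' + 2" "runs x a (ifc (r + k) (G r) (H r)) u (\<mu>2, out) (\<mu>3, out)" by blast
    have fr: "\<mu>3 j = \<mu> j" if "j < r \<or> r + (k + k + L + M + N) \<le> j" for j
      using that 2(5)[of j] 3(4)[of j] by auto
    show "\<exists>t \<mu>'. t \<le> R (x, a) c + max (T (x, a) c) (U (x, a) c) + 2 * width TYPE('c) + 2 \<and>
       runs x a (testc Q k r ;; ifc (r + k) (G r) (H r)) t (\<mu>, out) (\<mu>', out @ []) \<and>
       holds \<mu>' r (if p (x, a) c \<noteq> 0 then f (x, a) c else g (x, a) c) \<and>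
       (\<forall>j. j < r \<or> r + (k + k + L + M + N) \<le> j \<longrightarrow> \<mu>' j = \<mu> j)"
      using runs_seq[OF 2(2) u(2)] 3(1,3) fr 2(1) u(1)
      by (intro exI[of _ "t + u"] exI[of _ \<mu>3]) (auto simp: k_def)
  qed
qed

text \<open>Value and output are expressed through iterates of the body; \<open>run\<close> and
  \<open>stop\<close> say that \<open>m\<close> is exactly the number of rounds.\<close>

lemma emits_while:
  fixes f :: "env \<Rightarrow> 'c::regs \<Rightarrow> 'c" and p :: "env \<Rightarrow> 'c \<Rightarrow> nat" and m :: "env \<Rightarrow> 'c \<Rightarrow> nat"
  assumes "computes p R" "emits f h T"
    and run: "\<And>(e::env) c i. i < m e c \<Longrightarrow> p e ((f e ^^ i) c) \<noteq> 0"
    and stop: "\<And>(e::env) c. p e ((f e ^^ m e c) c) = 0"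
    and time: "\<And>(e::env) c. (\<Sum>i<m e c. R e ((f e ^^ i) c) + T e ((f e ^^ i) c) + 2 * width TYPE('c) + 2)
         + R e ((f e ^^ m e c) c) + 2 * width TYPE('c) + 1 \<le> U e c"
  shows "emits (\<lambda>e c. (f e ^^ m e c) c) (\<lambda>e c. concat (map (\<lambda>i. h e ((f e ^^ i) c)) [0..<m e c])) U"
proof -
  obtain Q L where "implements Q L p (\<lambda>_ _. []) R" by (rule emitsE[OF assms(1)])
  note test = runs_testc[OF this refl]
  obtain G M where "implements G M f h T" by (rule emitsE[OF assms(2)])
  note G = implementsD[OF this]
  define k where "k = width TYPE('c)"
  show ?thesis
  proof (rule emitsI[where G = "\<lambda>r. whilec (testc Q k r) (r + k) (G r)"
        and M = "k + k + L + M"])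
    fix r x a \<mu> out and c :: 'c assume h0: "holds \<mu> r c"
    define e :: env where "e = (x, a)"
    define s where "s i = (f e ^^ i) c" for i
    define o' where "o' i = out @ concat (map (\<lambda>i. h e (s i)) [0..<i])" for i
    \<comment> \<open>\<open>\<Phi> \<mu>' i \<nu>\<close> records round \<open>i\<close> started in
      memory \<open>\<mu>'\<close>: \<open>fst \<nu>\<close> is the memory after the test,
      \<open>snd \<nu>\<close> the one after the body.\<close>
    define \<Phi> where "\<Phi> \<mu>' i \<nu> \<longleftrightarrow>
       holds (fst \<nu>) r (s i) \<and> fst \<nu> (r + k) = p e (s i) \<and>
       (\<exists>t \<le> 2 * k + R e (s i). runs x a (testc Q k r) t (\<mu>', o' i) (fst \<nu>, o' i)) \<and>
       (\<forall>j. j < r \<or> r + (k + k + L + M) \<le> j \<longrightarrow> fst \<nu> j = \<mu>' j) \<and>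
       (\<exists>t \<le> T e (s i). runs x a (G r) t (fst \<nu>, o' i) (snd \<nu>, o' (Suc i))) \<and>
       holds (snd \<nu>) r (s (Suc i)) \<and> (\<forall>j. j < r \<or> r + (k + k + L + M) \<le> j \<longrightarrow> snd \<nu> j = \<mu>' j)"
      for \<mu>' i \<nu>
    have ex: "\<exists>\<nu>. \<Phi> \<mu>' i \<nu>" if True: "holds \<mu>' r (s i)" for \<mu>' i
    proof -
      from test[OF True, folded k_def, of x a "o' i", folded e_def] obtain t \<mu>2 where 2: "t \<le> 2 * k + R e (s i)"
        "runs x a (testc Q k r) t (\<mu>', o' i) (\<mu>2, o' i)" "holds \<mu>2 r (s i)"
        "\<mu>2 (r + k) = p e (s i)" "\<And>j. j < r \<or> r + (k + k + L) \<le> j \<Longrightarrow> \<mu>2 j = \<mu>' j" by auto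
      from G[OF 2(3), of x a "o' i"] obtain t' \<mu>3 where 3: "t' \<le> T (x, a) (s i)"
        "runs x a (G r) t' (\<mu>2, o' i) (\<mu>3, o' i @ h (x, a) (s i))" "holds \<mu>3 r (f (x, a) (s i))"
        "\<And>j. j < r \<or> r + M \<le> j \<Longrightarrow> \<mu>3 j = \<mu>2 j" by blast
      have o: "o' i @ h (x, a) (s i) = o' (Suc i)" by (simp add: o'_def e_def)
      have f: "f (x, a) (s i) = s (Suc i)" by (simp add: s_def e_def)
      have fr: "\<mu>3 j = \<mu>' j" if "j < r \<or> r + (k + k + L + M) \<le> j" for j
        using that 2(5)[of j] 3(4)[of j] by auto
      have fr2: "\<mu>2 j = \<mu>' j" if "j < r \<or> r + (k + k + L + M) \<le> j" for j
        using that by (intro 2(5)) auto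
      have "\<Phi> \<mu>' i (\<mu>2, \<mu>3)" unfolding \<Phi>_def fst_conv snd_conv
        using 2(1-4) fr2 3(1)[folded e_def] 3(2)[unfolded o] 3(3)[unfolded f] fr by blast
      then show ?thesis by blast
    qed
    define \<nu> where "\<nu> \<mu>' i = (SOME \<nu>. \<Phi> \<mu>' i \<nu>)" for \<mu>' i
    have \<nu>: "\<Phi> \<mu>' i (\<nu> \<mu>' i)" if "holds \<mu>' r (s i)" for \<mu>' i
      unfolding \<nu>_def using ex[OF that] by (rule someI_ex)
    \<comment> \<open>The body implements a total function, so the memories can be followed through
      arbitrarily many rounds; those up to round \<open>m\<close> enter
      \<open>runs_while\<close>.\<close>
    define ms where "ms = rec_nat \<mu> (\<lambda>i \<mu>'. snd (\<nu> \<mu>' i))"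
    have ms0: "ms 0 = \<mu>" and msS: "\<And>i. ms (Suc i) = snd (\<nu> (ms i) i)" by (simp_all add: ms_def)
    have hm: "holds (ms i) r (s i) \<and> (\<forall>j. j < r \<or> r + (k + k + L + M) \<le> j \<longrightarrow> ms i j = \<mu> j)" for i
    proof (induction i)
      case 0 then show ?case using h0 by (simp add: ms0 s_def)
    next
      case (Suc i) then show ?case using \<nu>[of "ms i" i] unfolding \<Phi>_def by (simp add: msS)
    qed
    define ms' where "ms' i = fst (\<nu> (ms i) i)" for i
    have "\<exists>t \<le> 2 * k + R e (s i). runs x a (testc Q k r) t (ms i, o' i) (ms' i, o' i)" for i
      using \<nu> hm unfolding ms'_def \<Phi>_def by blast
    then obtain tp where tp: "\<And>i. tp i \<le> 2 * k + R e (s i)"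
      "\<And>i. runs x a (testc Q k r) (tp i) (ms i, o' i) (ms' i, o' i)" by metis
    have "\<exists>t \<le> T e (s i). runs x a (G r) t (ms' i, o' i) (ms (Suc i), o' (Suc i))" for i
      using \<nu> hm unfolding ms'_def msS \<Phi>_def by blast
    then obtain tg where tg: "\<And>i. tg i \<le> T e (s i)"
      "\<And>i. runs x a (G r) (tg i) (ms' i, o' i) (ms (Suc i), o' (Suc i))" by metis
    have pv: "ms' i (r + k) = p e (s i)" for i using \<nu> hm unfolding ms'_def \<Phi>_def by blast
    let ?m = "m e c"
    have R: "runs x a (whilec (testc Q k r) (r + k) (G r))
       ((\<Sum>i<?m. tp i + tg i + 2) + tp ?m + 1) (ms 0, o' 0) (ms' ?m, o' ?m)"
      by (rule runs_while[where s = "\<lambda>i. (ms i, o' i)" and s' = "\<lambda>i. (ms' i, o' i)"])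
        (use tp tg run[of _ e c] stop[of e c] in \<open>auto simp: pv s_def\<close>)
    have "(\<Sum>i<?m. tp i + tg i + 2) + tp ?m + 1 \<le>
      (\<Sum>i<?m. R e (s i) + T e (s i) + 2 * k + 2) + R e (s ?m) + 2 * k + 1"
    proof -
      have "(\<Sum>i<?m. tp i + tg i + 2) \<le> (\<Sum>i<?m. R e (s i) + T e (s i) + 2 * k + 2)"
        by (rule sum_mono) (use add_mono[OF tp(1) tg(1)] in \<open>simp add: algebra_simps\<close>)
      then show ?thesis using tp(1)[of ?m] by linarith
    qed
    also have "\<dots> \<le> U (x, a) c" using time[of e c] by (simp add: s_def k_def e_def)
    finally have tle: "(\<Sum>i<?m. tp i + tg i + 2) + tp ?m + 1 \<le> U (x, a) c" .
    have "holds (ms' ?m) r (s ?m)" "\<forall>j. j < r \<or> r + (k + k + L + M) \<le> j \<longrightarrow> ms' ?m j = \<mu> j"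
      using \<nu>[of "ms ?m" ?m] hm[of ?m] unfolding ms'_def \<Phi>_def by auto
    moreover have "o' 0 = out" "o' ?m = out @ concat (map (\<lambda>i. h e ((f e ^^ i) c)) [0..<?m])"
      by (simp_all add: o'_def s_def)
    ultimately show "\<exists>t \<mu>'. t \<le> U (x, a) c \<and> runs x a (whilec (testc Q k r) (r + k) (G r)) t
        (\<mu>, out) (\<mu>', out @ concat (map (\<lambda>i. h (x, a) ((f (x, a) ^^ i) c)) [0..<m (x, a) c])) \<and>
        holds \<mu>' r ((f (x, a) ^^ m (x, a) c) c) \<and> (\<forall>j. j < r \<or> r + (k + k + L + M) \<le> j \<longrightarrow> \<mu>' j = \<mu> j)"
      using R tle ms0 by (intro exI[of _ "(\<Sum>i<?m. tp i + tg i + 2) + tp ?m + 1"] exI[of _ "ms' ?m"])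
        (auto simp: e_def s_def)
  qed
qed

lemma emits_bit:
  fixes h :: "env \<Rightarrow> 'c::regs \<Rightarrow> bool"
  assumes "computes h T"
  shows "emits (\<lambda>_ c. c) (\<lambda>e c. [h e c]) (\<lambda>e c. T e c + 2 * width TYPE('c) + 1)"
proof -
  obtain Q L where "implements Q L h (\<lambda>_ _. []) T" by (rule emitsE[OF assms(1)])
  note Q = runs_testc[OF this refl]
  define k where "k = width TYPE('c)"
  show ?thesis
  proof (rule emitsI[where G = "\<lambda>r. testc Q k r ;; (\<lambda>_. [Emit (r + k)])" and M = "k + k + L"])
    fix r x a \<mu> out and c :: 'c assume h0: "holds \<mu> r c"
    from Q[OF h0, folded k_def, of x a out] obtain t \<mu>2 where 2: "t \<le> 2 * k + T (x, a) c" "runs x a (testc Q k r) t (\<mu>, out) (\<mu>2, out)"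
      "holds \<mu>2 r c" "\<mu>2 (r + k) = of_bool (h (x, a) c)" "\<And>j. j < r \<or> r + (k + k + L) \<le> j \<Longrightarrow> \<mu>2 j = \<mu> j" by auto
    have 3: "runs x a (\<lambda>_. [Emit (r + k)]) 1 (\<mu>2, out) (\<mu>2, out @ [h (x, a) c])"
      by (rule runs_instr) (simp add: 2(4))
    show "\<exists>t \<mu>'. t \<le> T (x, a) c + 2 * width TYPE('c) + 1 \<and>
      runs x a (testc Q k r ;; (\<lambda>_. [Emit (r + k)])) t (\<mu>, out) (\<mu>', out @ [h (x, a) c]) \<and>
      holds \<mu>' r c \<and> (\<forall>j. j < r \<or> r + (k + k + L) \<le> j \<longrightarrow> \<mu>' j = \<mu> j)"
      using runs_seq[OF 2(2) 3] 2
      by (intro exI[of _ "t + 1"] exI[of _ \<mu>2]) (auto simp: k_def)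
  qed
qed

section \<open>Pseudo-polynomial computability\<close>

text \<open>The bound is uniform in the environment: the lengths of the input and of the table do
  not count. A base of at least 2 lets powers absorb constants and sums.\<close>

definition poly_bounded :: "(env \<Rightarrow> 'c::regs \<Rightarrow> nat) \<Rightarrow> bool" where
  "poly_bounded T \<longleftrightarrow> (\<exists>k. \<forall>e c. T e c \<le> (sz c + 2) ^ k)"

lemma poly_bounded_mono: "poly_bounded U \<Longrightarrow> (\<And>e c. T e c \<le> U e c) \<Longrightarrow> poly_bounded T"
  unfolding poly_bounded_def by (meson order_trans)

lemma poly_bounded_const: "poly_bounded (\<lambda>_ (_::'c::regs). n)"
  unfolding poly_bounded_def
proof (intro exI allI)
  fix c :: 'c
  have "n \<le> 2 ^ n" by (simp add: less_imp_le)
  also have "\<dots> \<le> (sz c + 2) ^ n" by (rule power_mono) auto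
  finally show "n \<le> (sz c + 2) ^ n" .
qed

lemma poly_bounded_sz: "poly_bounded (\<lambda>_ c. sz c)"
  unfolding poly_bounded_def by (intro exI[of _ 1]) simp

lemma poly_bounded_add:
  assumes "poly_bounded T" "poly_bounded U"
  shows "poly_bounded (\<lambda>e c. T e c + U e c)"
proof -
  obtain k l where k: "\<And>e c. T e c \<le> (sz c + 2) ^ k" and l: "\<And>e c. U e c \<le> (sz c + 2) ^ l"
    using assms unfolding poly_bounded_def by blast
  have "T e c + U e c \<le> (sz c + 2) ^ Suc (max k l)" for e c
  proof -
    have "T e c \<le> (sz c + 2) ^ max k l" by (rule order_trans[OF k]) (rule power_increasing, auto)
    moreover have "U e c \<le> (sz c + 2) ^ max k l" by (rule order_trans[OF l]) (rule power_increasing, auto)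
    moreover have "2 * (sz c + 2) ^ max k l \<le> (sz c + 2) ^ Suc (max k l)" by simp
    ultimately show ?thesis by linarith
  qed
  then show ?thesis unfolding poly_bounded_def by blast
qed

lemma poly_bounded_mult:
  assumes "poly_bounded T" "poly_bounded U"
  shows "poly_bounded (\<lambda>e c. T e c * U e c)"
proof -
  obtain k l where k: "\<And>e c. T e c \<le> (sz c + 2) ^ k" and l: "\<And>e c. U e c \<le> (sz c + 2) ^ l"
    using assms unfolding poly_bounded_def by blast
  have "T e c * U e c \<le> (sz c + 2) ^ (k + l)" for e c
    using mult_mono[OF k[of e c] l[of e c]] by (simp add: power_add)
  then show ?thesis unfolding poly_bounded_def by blast
qed

lemma poly_bounded_power: "poly_bounded T \<Longrightarrow> poly_bounded (\<lambda>e c. T e c ^ n)"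
  by (induction n) (auto intro: poly_bounded_const poly_bounded_mult)

lemma poly_bounded_comp:
  assumes "poly_bounded U" "poly_bounded (\<lambda>e c. sz (f e c))"
  shows "poly_bounded (\<lambda>e c. U e (f e c))"
proof -
  obtain k where k: "\<And>e c. U e c \<le> (sz c + 2) ^ k"
    using assms(1) unfolding poly_bounded_def by blast
  have "poly_bounded (\<lambda>e c. (sz (f e c) + 2) ^ k)"
    by (intro poly_bounded_power poly_bounded_add poly_bounded_const assms(2))
  then show ?thesis by (rule poly_bounded_mono) (rule k)
qed

text \<open>Polynomially many additions can double a number polynomially often; the bound on the
  size of the value is what makes the class closed under composition.\<close>

definition PC :: "(env \<Rightarrow> 'c::regs \<Rightarrow> 'd::regs) \<Rightarrow> bool" where
  "PC f \<longleftrightarrow> (\<exists>T. computes f T \<and> poly_bounded T) \<and> poly_bounded (\<lambda>e c. sz (f e c))"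

named_theorems PC_intros

lemma PC_size: "PC f \<Longrightarrow> poly_bounded (\<lambda>e c. sz (f e c))"
  by (simp add: PC_def)

lemma PC_size_nat: "PC f \<Longrightarrow> poly_bounded (\<lambda>e c. f e c :: nat)"
  using PC_size[of f] by simp

lemma PC_comp:
  assumes "PC f" "PC g"
  shows "PC (\<lambda>e c. g e (f e c))"
proof -
  obtain T U where T: "computes f T" "poly_bounded T" and U: "computes g U" "poly_bounded U"
    using assms unfolding PC_def by blast
  have "computes (\<lambda>e c. g e (f e c)) (\<lambda>e c. T e c + U e (f e c))"
    by (rule computes_comp[OF T(1) U(1)]) simp
  moreover have "poly_bounded (\<lambda>e c. T e c + U e (f e c))"
    by (rule poly_bounded_add[OF T(2) poly_bounded_comp[OF U(2) PC_size[OF assms(1)]]])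
  moreover have "poly_bounded (\<lambda>e c. sz (g e (f e c)))"
    by (rule poly_bounded_comp[OF PC_size[OF assms(2)] PC_size[OF assms(1)]])
  ultimately show ?thesis unfolding PC_def by blast
qed

lemma PC_app: "PC (\<lambda>_. f) \<Longrightarrow> PC g \<Longrightarrow> PC (\<lambda>e c. f (g e c))"
  using PC_comp[of g "\<lambda>_. f"] .

lemma PC_pair [PC_intros]:
  assumes "PC f" "PC g"
  shows "PC (\<lambda>e c. (f e c, g e c))"
proof -
  obtain T U where T: "computes f T" "poly_bounded T" and U: "computes g U" "poly_bounded U"
    using assms unfolding PC_def by blast
  show ?thesis unfolding PC_def sz_prod_def fst_conv snd_conv
    by (intro conjI exI, rule computes_pair[OF T(1) U(1)])
      (intro poly_bounded_add poly_bounded_const T(2) U(2) PC_size[OF assms(1)] PC_size[OF assms(2)])+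
qed

lemma PC_of_computes:
  "computes f (\<lambda>_ _. n) \<Longrightarrow> poly_bounded (\<lambda>e c. sz (f e c)) \<Longrightarrow> PC f"
  unfolding PC_def using poly_bounded_const by blast

lemma PC_id [PC_intros]: "PC (\<lambda>_ c. c)"
  by (rule PC_of_computes[OF computes_id poly_bounded_sz])

lemma PC_fst [PC_intros]: "PC f \<Longrightarrow> PC (\<lambda>e c. fst (f e c))"
  by (rule PC_comp[where g = "\<lambda>_ p. fst p"], assumption)
    (rule PC_of_computes[OF computes_fst poly_bounded_mono[OF poly_bounded_sz]], simp)

lemma PC_snd [PC_intros]: "PC f \<Longrightarrow> PC (\<lambda>e c. snd (f e c))"
  by (rule PC_comp[where g = "\<lambda>_ p. snd p"], assumption)
    (rule PC_of_computes[OF computes_snd poly_bounded_mono[OF poly_bounded_sz]], simp)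

lemma PC_const_nat [PC_intros]: "PC (\<lambda>_ _. n :: nat)"
  and PC_const_bool [PC_intros]: "PC (\<lambda>_ _. b :: bool)"
  and PC_const_big [PC_intros]: "PC (\<lambda>_ _. y :: big)"
  by (rule PC_of_computes[OF computes_const poly_bounded_const]; simp)+

lemma PC_add [PC_intros]: "PC f \<Longrightarrow> PC g \<Longrightarrow> PC (\<lambda>e c. f e c + g e c :: nat)"
  using PC_comp[OF PC_pair PC_of_computes[OF computes_add], of f g]
  by (simp add: poly_bounded_mono[OF poly_bounded_sz])

lemma PC_sub [PC_intros]: "PC f \<Longrightarrow> PC g \<Longrightarrow> PC (\<lambda>e c. f e c - g e c :: nat)"
  using PC_comp[OF PC_pair PC_of_computes[OF computes_sub], of f g]
  by (simp add: poly_bounded_mono[OF poly_bounded_sz])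

lemma PC_big_add [PC_intros]: "PC f \<Longrightarrow> PC g \<Longrightarrow> PC (\<lambda>e c. Big (unbig (f e c) + unbig (g e c)))"
  using PC_comp[OF PC_pair PC_of_computes[OF computes_big_add], of f g]
  by (simp add: poly_bounded_const)

lemma PC_big_sub [PC_intros]: "PC f \<Longrightarrow> PC g \<Longrightarrow> PC (\<lambda>e c. Big (unbig (f e c) - unbig (g e c)))"
  using PC_comp[OF PC_pair PC_of_computes[OF computes_big_sub], of f g]
  by (simp add: poly_bounded_const)

lemma PC_Big [PC_intros]: "PC f \<Longrightarrow> PC (\<lambda>e c. Big (f e c))"
proof (rule PC_comp[where g = "\<lambda>_. Big"])
  show "PC (\<lambda>_. Big)"
    by (rule PC_of_computes[OF computes_reinterpret]) (auto simp: enc_simps poly_bounded_const)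
qed

lemma PC_read_input [PC_intros]: "PC f \<Longrightarrow> PC (\<lambda>e c. bit_at (fst e) (unbig (f e c)))"
  using PC_comp[OF _ PC_of_computes[OF computes_read_input], of f] by (simp add: poly_bounded_const)

lemma PC_read_pre [PC_intros]: "PC f \<Longrightarrow> PC (\<lambda>e c. bit_at (snd e) (unbig (f e c)))"
  using PC_comp[OF _ PC_of_computes[OF computes_read_pre], of f] by (simp add: poly_bounded_const)

lemma PC_of_bool [PC_intros]: "PC f \<Longrightarrow> PC (\<lambda>e c. of_bool (f e c) :: nat)"
proof (rule PC_comp[where g = "\<lambda>_. of_bool"])
  show "PC (\<lambda>_. of_bool :: bool \<Rightarrow> nat)"
    by (rule PC_of_computes[OF computes_reinterpret], simp add: enc_simps)
      (rule poly_bounded_mono[OF poly_bounded_const[of 1]], simp)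
qed

lemma PC_big_of_bool [PC_intros]: "PC f \<Longrightarrow> PC (\<lambda>e c. Big (of_bool (f e c)))"
  by (intro PC_intros)

lemma PC_if_nonzero:
  assumes "PC p" "PC f" "PC g"
  shows "PC (\<lambda>e c. if p e c \<noteq> (0::nat) then f e c else g e c)"
proof -
  obtain R T U where R: "computes p R" "poly_bounded R" and T: "computes f T" "poly_bounded T"
    and U: "computes g U" "poly_bounded U"
    using assms unfolding PC_def by blast
  have m: "poly_bounded (\<lambda>e c. max (T e c) (U e c))"
    by (rule poly_bounded_mono[OF poly_bounded_add[OF T(2) U(2)]]) simp
  have s: "poly_bounded (\<lambda>e c. sz (if p e c \<noteq> 0 then f e c else g e c))"
    by (rule poly_bounded_mono[OF poly_bounded_add[OF PC_size[OF assms(2)] PC_size[OF assms(3)]]]) simp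
  show ?thesis unfolding PC_def
    by (intro conjI exI, rule computes_if[OF R(1) T(1) U(1)])
      (intro poly_bounded_add poly_bounded_const m R(2), rule s)
qed

lemma if_bool_simps: "(if b then True else False) = b" "(if b then False else True) = (\<not> b)"
  "(if b then c else False) = (b \<and> c)"
  by auto

lemma PC_nonzero: "PC f \<Longrightarrow> PC (\<lambda>e c. f e c \<noteq> (0::nat))"
  using PC_if_nonzero[OF _ PC_const_bool PC_const_bool, of f True False] by (simp only: if_bool_simps simp_thms)

lemma PC_if [PC_intros]:
  assumes "PC p" "PC f" "PC g"
  shows "PC (\<lambda>e c. if p e c then f e c else g e c)"
  using PC_if_nonzero[OF PC_of_bool[OF assms(1)] assms(2,3)] by simp

lemma PC_not [PC_intros]: "PC p \<Longrightarrow> PC (\<lambda>e c. \<not> p e c)"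
  using PC_if[OF _ PC_const_bool PC_const_bool, of p False True] by (simp only: if_bool_simps simp_thms)

lemma PC_conj [PC_intros]: "PC p \<Longrightarrow> PC q \<Longrightarrow> PC (\<lambda>e c. p e c \<and> q e c)"
  using PC_if[OF _ _ PC_const_bool, of p q False] by (simp only: if_bool_simps simp_thms)

lemma PC_disj [PC_intros]: "PC p \<Longrightarrow> PC q \<Longrightarrow> PC (\<lambda>e c. p e c \<or> q e c)"
  using PC_not[OF PC_conj[OF PC_not[of p] PC_not[of q]]] by simp

lemma PC_imp [PC_intros]: "PC p \<Longrightarrow> PC q \<Longrightarrow> PC (\<lambda>e c. p e c \<longrightarrow> q e c)"
  using PC_disj[OF PC_not[of p], of q] by simp

lemma PC_le [PC_intros]: "PC f \<Longrightarrow> PC g \<Longrightarrow> PC (\<lambda>e c. f e c \<le> (g e c :: nat))"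
  using PC_not[OF PC_nonzero[OF PC_sub[of f g]]] by simp

lemma PC_less [PC_intros]: "PC f \<Longrightarrow> PC g \<Longrightarrow> PC (\<lambda>e c. f e c < (g e c :: nat))"
  using PC_not[OF PC_le[of g f]] by (simp add: not_le)

lemma PC_eq [PC_intros]: "PC f \<Longrightarrow> PC g \<Longrightarrow> PC (\<lambda>e c. f e c = (g e c :: nat))"
  using PC_conj[OF PC_le[of f g] PC_le[of g f]] by (simp add: order_eq_iff)

text \<open>Iterating a pseudo-polynomial function can make values explode, hence the common bound
  \<open>B\<close> for all stages that are reached. Given it, every round takes time polynomial in
  \<open>B\<close>, the argument and the count.\<close>

lemma PC_rec:
  fixes f :: "env \<Rightarrow> 'c::regs \<times> nat \<times> 's::regs \<Rightarrow> 's" and g :: "env \<Rightarrow> 'c \<Rightarrow> nat"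
  assumes f: "PC f" and g: "PC g" and s0: "PC s0" and B: "poly_bounded B"
    and bound: "\<And>e c i. i \<le> g e c \<Longrightarrow> sz (rec_nat (s0 e c) (\<lambda>i s. f e (c, i, s)) i) \<le> B e c"
  shows "PC (\<lambda>e c. rec_nat (s0 e c) (\<lambda>i s. f e (c, i, s)) (g e c))"
proof -
  \<comment> \<open>The loop state consists of the argument, the rounds left, the rounds done and
    the current value.\<close>
  define st where "st e p = (fst p, fst (snd p) - 1, fst (snd (snd p)) + 1, f e (fst p, snd (snd p)))"
    for e and p :: "'c \<times> nat \<times> nat \<times> 's"
  have "PC (\<lambda>e p. f e (fst p, snd (snd p)))"
    by (rule PC_comp[OF _ f]) (intro PC_intros)
  then have "PC st" unfolding st_def[abs_def] by (intro PC_intros)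
  then obtain T where T: "computes st T" "poly_bounded T" unfolding PC_def by blast
  have "PC (\<lambda>_ (p :: 'c \<times> nat \<times> nat \<times> 's). fst (snd p))" by (intro PC_intros)
  then obtain R where R: "computes (\<lambda>_ (p :: 'c \<times> nat \<times> nat \<times> 's). fst (snd p)) R" "poly_bounded R"
    unfolding PC_def by blast
  have cnt: "fst (snd ((st e ^^ i) p)) = fst (snd p) - i" for e i p
    by (induction i) (simp_all add: st_def)
  define U where "U e p = (\<Sum>i<fst (snd p). R e ((st e ^^ i) p) + T e ((st e ^^ i) p) + 2 * width TYPE('c \<times> nat \<times> nat \<times> 's) + 2)
         + R e ((st e ^^ fst (snd p)) p) + 2 * width TYPE('c \<times> nat \<times> nat \<times> 's) + 1" for e p
  have W: "computes (\<lambda>e p. (st e ^^ fst (snd p)) p) U"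
    by (rule emits_mono[OF emits_while[where m = "\<lambda>_ p. fst (snd p)" and p = "\<lambda>_ p. fst (snd p)" and U = U and R = R and T = T, OF R(1) T(1)]])
      (auto simp: cnt U_def)
  define ini where "ini e c = (c, g e c, 0::nat, s0 e c)" for e c
  have "PC ini" unfolding ini_def[abs_def] by (intro PC_intros g s0)
  then obtain T0 where T0: "computes ini T0" "poly_bounded T0" unfolding PC_def by blast
  let ?r = "\<lambda>e c. rec_nat (s0 e c) (\<lambda>i s. f e (c, i, s))"
  have run: "(st e ^^ i) (ini e c) = (c, g e c - i, i, ?r e c i)" for e c i
    by (induction i) (auto simp: st_def ini_def)
  obtain kR where kR: "\<And>e c. R e c \<le> (sz c + 2) ^ kR" using R(2) unfolding poly_bounded_def by blast
  obtain kT where kT: "\<And>e c. T e c \<le> (sz c + 2) ^ kT" using T(2) unfolding poly_bounded_def by blast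
  define S where "S e c = sz c + g e c + g e c + B e c" for e c
  have S: "poly_bounded S" unfolding S_def[abs_def]
    by (intro poly_bounded_add poly_bounded_sz PC_size_nat g B)
  have szle: "sz ((st e ^^ i) (ini e c)) \<le> S e c" if "i \<le> g e c" for e c i
    using bound[OF that] that by (simp add: run S_def)
  define V where "V e c = T0 e c + (g e c * ((S e c + 2) ^ kR + (S e c + 2) ^ kT + 2 * width TYPE('c \<times> nat \<times> nat \<times> 's) + 2)
     + (S e c + 2) ^ kR + 2 * width TYPE('c \<times> nat \<times> nat \<times> 's) + 1)" for e c
  have V: "poly_bounded V" unfolding V_def[abs_def]
    by (intro poly_bounded_add poly_bounded_const poly_bounded_mult poly_bounded_power S T0(2) PC_size_nat g)
  have UV: "T0 e c + U e (ini e c) \<le> V e c" for e c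
  proof -
    have R': "R e ((st e ^^ i) (ini e c)) \<le> (S e c + 2) ^ kR" if "i \<le> g e c" for i
      by (rule order_trans[OF kR]) (rule power_mono, use szle[OF that] in auto)
    have T': "T e ((st e ^^ i) (ini e c)) \<le> (S e c + 2) ^ kT" if "i \<le> g e c" for i
      by (rule order_trans[OF kT]) (rule power_mono, use szle[OF that] in auto)
    have m: "fst (snd (ini e c)) = g e c" by (simp add: ini_def)
    have "(\<Sum>i<g e c. R e ((st e ^^ i) (ini e c)) + T e ((st e ^^ i) (ini e c)) + 2 * width TYPE('c \<times> nat \<times> nat \<times> 's) + 2)
      \<le> (\<Sum>i<g e c. (S e c + 2) ^ kR + (S e c + 2) ^ kT + 2 * width TYPE('c \<times> nat \<times> nat \<times> 's) + 2)"
      by (rule sum_mono) (use R' T' in \<open>auto intro!: add_mono\<close>)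
    then show ?thesis using R'[of "g e c"] unfolding U_def V_def m by simp
  qed
  have "computes (\<lambda>e c. (st e ^^ fst (snd (ini e c))) (ini e c)) V"
    by (rule computes_comp[OF T0(1) W UV])
  moreover have "poly_bounded (\<lambda>e c. sz ((st e ^^ fst (snd (ini e c))) (ini e c)))"
    by (rule poly_bounded_mono[OF S]) (use szle in \<open>simp add: ini_def\<close>)
  ultimately have "PC (\<lambda>e c. (st e ^^ fst (snd (ini e c))) (ini e c))"
    unfolding PC_def using V by blast
  then have "PC (\<lambda>e c. snd (snd (snd ((st e ^^ fst (snd (ini e c))) (ini e c)))))"
    by (intro PC_snd)
  then show ?thesis by (simp add: run) (simp add: ini_def)
qed

lemma PC_rec':
  assumes "PC (\<lambda>e p. h e (fst p) (fst (snd p)) (snd (snd p)))" "PC g" "PC s0" "poly_bounded B"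
    and "\<And>e c i. i \<le> g e c \<Longrightarrow> sz (rec_nat (s0 e c) (h e c) i) \<le> B e c"
  shows "PC (\<lambda>e c. rec_nat (s0 e c) (h e c) (g e c))"
  using PC_rec[of "\<lambda>e p. h e (fst p) (fst (snd p)) (snd (snd p))" g s0 B] assms by simp

lemma PC_mult [PC_intros]:
  assumes "PC f" "PC g"
  shows "PC (\<lambda>e c. f e c * g e c :: nat)"
proof -
  have r: "rec_nat 0 (\<lambda>i s. s + a) i = a * i" for a i :: nat by (induction i) auto
  have "PC (\<lambda>e c. rec_nat 0 (\<lambda>i s. s + f e c) (g e c))"
    by (rule PC_rec'[where h = "\<lambda>e c i s. s + f e c" and B = "\<lambda>e c. f e c * g e c"])
      (auto simp: r intro!: PC_add PC_snd PC_id PC_const_nat PC_comp[OF PC_fst[OF PC_id] assms(1)] assms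
        poly_bounded_mult PC_size_nat[OF assms(1)] PC_size_nat[OF assms(2)])
  then show ?thesis by (simp add: r)
qed

lemma PC_power [PC_intros]: "PC f \<Longrightarrow> PC (\<lambda>e c. f e c ^ n :: nat)"
  by (induction n) (auto intro!: PC_intros)

lemma PC_Suc [PC_intros]: "PC f \<Longrightarrow> PC (\<lambda>e c. Suc (f e c))"
  using PC_add[of f, OF _ PC_const_nat[of 1]] by simp

lemma PC_sum [PC_intros]:
  assumes "PC g" "PC (\<lambda>e p. h e (fst p) (snd p))"
  shows "PC (\<lambda>e c. \<Sum>i<(g e c :: nat). h e c i :: nat)"
proof -
  have r: "rec_nat 0 (\<lambda>i s. s + k i) i = (\<Sum>j<i. k j)" for k and i :: nat by (induction i) auto
  obtain l where l: "\<And>e p. h e (fst p) (snd p) \<le> (sz p + 2) ^ l"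
    using PC_size_nat[OF assms(2)] unfolding poly_bounded_def by blast
  define B where "B e c = g e c * (sz c + g e c + 2) ^ l" for e c
  have "(\<Sum>j<i. h e c j) \<le> B e c" if "i \<le> g e c" for e c i
  proof -
    have "h e c j \<le> (sz c + g e c + 2) ^ l" if "j < g e c" for j
      by (rule order_trans, use l[of e "(c, j)"] in simp) (rule power_mono, use that in auto)
    then have "(\<Sum>j<i. h e c j) \<le> (\<Sum>j<i. (sz c + g e c + 2) ^ l)" using that by (intro sum_mono) auto
    also have "\<dots> \<le> B e c" unfolding B_def using that by simp
    finally show ?thesis .
  qed
  moreover have "poly_bounded B" unfolding B_def[abs_def]
    by (intro poly_bounded_mult poly_bounded_power poly_bounded_add poly_bounded_sz poly_bounded_const PC_size_nat assms(1))
  moreover have "PC (\<lambda>e p. snd (snd p) + h e (fst p) (fst (snd p)))"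
    using PC_comp[OF PC_pair[OF PC_fst[OF PC_id] PC_fst[OF PC_snd[OF PC_id]]] assms(2)]
    by (intro PC_intros) simp
  ultimately have "PC (\<lambda>e c. rec_nat 0 (\<lambda>i s. s + h e c i) (g e c))"
    by (intro PC_rec'[where h = "\<lambda>e c i s. s + h e c i" and B = B]) (auto simp: r intro!: PC_intros assms)
  then show ?thesis by (simp add: r)
qed

lemma PC_all [PC_intros]:
  assumes "PC g" "PC (\<lambda>e p. P e (fst p) (snd p))"
  shows "PC (\<lambda>e c. \<forall>i<(g e c :: nat). P e c i)"
proof -
  have "PC (\<lambda>e c. (\<Sum>i<g e c. of_bool (\<not> P e c i)) = (0::nat))"
    by (intro PC_intros assms)
  moreover have "((\<Sum>i<n. of_bool (\<not> p i)) = (0::nat)) = (\<forall>i<n. p i)" for n :: nat and p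
    by (auto simp: sum_eq_0_iff)
  ultimately show ?thesis by simp
qed

lemma PC_ex [PC_intros]:
  assumes "PC g" "PC (\<lambda>e p. P e (fst p) (snd p))"
  shows "PC (\<lambda>e c. \<exists>i<(g e c :: nat). P e c i)"
  using PC_not[OF PC_all[OF assms(1) PC_not[OF assms(2)]]] by simp

text \<open>Counting multiples is affordable in pseudo-polynomial time and reduces division to a
  bounded sum; the guard \<open>0 < b\<close> gives 0 for division by zero.\<close>

lemma div_eq_sum: "(a::nat) div b = (\<Sum>i<a. of_bool (0 < b \<and> (i + 1) * b \<le> a))"
proof (cases "b = 0")
  case False
  then have "{i. i < a \<and> (i + 1) * b \<le> a} = {..<a div b}"
  proof (intro set_eqI)
    fix i
    have "Suc i \<le> a div b \<longleftrightarrow> Suc i * b \<le> a" using False by (simp only: less_eq_div_iff_mult_less_eq neq0_conv)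
    moreover have "a div b \<le> a" by simp
    ultimately show "i \<in> {i. i < a \<and> (i + 1) * b \<le> a} \<longleftrightarrow> i \<in> {..<a div b}"
      by (simp only: mem_Collect_eq lessThan_iff Suc_eq_plus1[symmetric] Suc_le_eq[symmetric]) linarith
  qed
  then show ?thesis using False by (simp add: sum_of_bool_eq Int_def lessThan_def)
qed auto

lemma PC_div [PC_intros]: "PC f \<Longrightarrow> PC g \<Longrightarrow> PC (\<lambda>e c. f e c div g e c :: nat)"
  unfolding div_eq_sum
  by (intro PC_intros PC_comp[OF PC_fst[OF PC_id], of f] PC_comp[OF PC_fst[OF PC_id], of g])

lemma PC_mod [PC_intros]: "PC f \<Longrightarrow> PC g \<Longrightarrow> PC (\<lambda>e c. f e c mod g e c :: nat)"
  unfolding modulo_nat_def by (intro PC_intros)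

lemma PC_min [PC_intros]: "PC f \<Longrightarrow> PC g \<Longrightarrow> PC (\<lambda>e c. min (f e c) (g e c :: nat))"
  unfolding min_def by (intro PC_intros)

text \<open>The capped power \<open>min N (b ^ x)\<close>: without the cap its size would not be polynomial.\<close>

lemma PC_capped_power [PC_intros]:
  assumes "PC N" "PC b" "PC x"
  shows "PC (\<lambda>e c. min (N e c) (b e c ^ x e c) :: nat)"
proof -
  \<comment> \<open>Once a product has reached \<open>N\<close>, a further factor either is 0 or
    keeps it at least \<open>N\<close>; so capping every intermediate product does not change the
    capped result.\<close>
  have m: "min N (min N y * z) = min N (y * z)" for N y z :: nat
  proof (cases "z = 0")
    case False
    then have "N \<le> N * z" "y \<le> y * z" by simp_all
    then show ?thesis
    proof (cases "y \<le> N")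
      case False
      with \<open>y \<le> y * z\<close> have "N \<le> y * z" by linarith
      with False \<open>N \<le> N * z\<close> show ?thesis by (simp add: min_absorb1)
    qed (simp add: min_absorb2)
  qed simp
  have r: "rec_nat (min N 1) (\<lambda>i s. min N (s * b)) i = min N (b ^ i)" for N b i :: nat
    by (induction i) (auto simp: m power_commutes[symmetric])
  have "PC (\<lambda>e c. rec_nat (min (N e c) 1) (\<lambda>i s. min (N e c) (s * b e c)) (x e c))"
    by (rule PC_rec'[where h = "\<lambda>e c i s. min (N e c) (s * b e c)" and B = N])
      (simp_all only: r sz_simps, auto intro!: PC_min PC_mult PC_snd PC_id PC_const_nat PC_comp[OF PC_fst[OF PC_id] assms(1)]
        PC_comp[OF PC_fst[OF PC_id] assms(2)] assms PC_size_nat[OF assms(1)])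
  then show ?thesis by (simp only: r)
qed

text \<open>A fixed finite table becomes a nest of case distinctions. In this way the finite control
  of the quantum machine is built into the programs.\<close>

lemma PC_table:
  "PC g \<Longrightarrow> PC (\<lambda>e c. if g e c < (m::nat) then t (g e c) else (0::nat))"
proof (induction m)
  case 0
  then show ?case by (auto intro!: PC_intros)
next
  case (Suc m)
  have "PC (\<lambda>e c. if g e c = m then t m else if g e c < m then t (g e c) else 0)"
    by (intro PC_intros Suc)
  moreover have "(if g e c = m then t m else if g e c < m then t (g e c) else 0) =
    (if g e c < Suc m then t (g e c) else 0)" for e c by auto
  ultimately show ?case by simp
qed

text \<open>Bounded search; the value is \<open>b\<close> if there is no witness below \<open>b\<close>.\<close>

definition bleast :: "nat \<Rightarrow> (nat \<Rightarrow> bool) \<Rightarrow> nat" where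
  "bleast b P = (\<Sum>i<b. of_bool (\<forall>j<Suc i. \<not> P j))"

lemma bleast:
  assumes "j < b" "P j"
  shows "P (bleast b P)" "bleast b P < b"
proof -
  define l where "l = (LEAST j. P j)"
  have l: "P l" "l \<le> j" "\<And>i. i < l \<Longrightarrow> \<not> P i"
    unfolding l_def using assms by (auto intro: LeastI Least_le dest: not_less_Least)
  have "{i. i < b \<and> (\<forall>j<Suc i. \<not> P j)} = {..<l}"
    using l assms by (auto simp: less_Suc_eq_le) (meson not_le order_trans le_less_trans less_imp_le)+
  then have "bleast b P = l" by (simp add: bleast_def sum_of_bool_eq Int_def lessThan_def)
  then show "P (bleast b P)" "bleast b P < b" using l assms by auto
qed

lemma PC_bleast [PC_intros]:
  assumes "PC g" "PC (\<lambda>e p. P e (fst p) (snd p))"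
  shows "PC (\<lambda>e c. bleast (g e c) (P e c))"
proof -
  have "PC (\<lambda>e p. P e (fst (fst p)) (snd p))"
    using PC_comp[OF PC_pair[OF PC_fst[OF PC_fst[OF PC_id]] PC_snd[OF PC_id]] assms(2)] by simp
  then show ?thesis unfolding bleast_def by (intro PC_intros assms)
qed

section \<open>Small certificates from query weights\<close>

definition flips :: "bool list \<Rightarrow> nat set \<Rightarrow> bool list" where
  "flips x B = map (\<lambda>i. x ! i \<noteq> (i \<in> B)) [0..<length x]"

lemma length_flips [simp]: "length (flips x B) = length x"
  by (simp add: flips_def)

lemma nth_flips [simp]: "i < length x \<Longrightarrow> flips x B ! i = (x ! i \<noteq> (i \<in> B))"
  by (simp add: flips_def)

text \<open>A weighted form of bounding certificate complexity by block sensitivity. A largest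
  disjoint family of minimal sensitive blocks has at most \<open>A * T\<close> members, since they
  share the total weight \<open>T\<close> at \<open>x\<close>; each block has at most
  \<open>A * T\<close> elements, by the weight at the input in which it is flipped. The union of the
  family is the certificate.\<close>

lemma certificate_exists:
  fixes L :: "bool list set" and wgt :: "bool list \<Rightarrow> nat \<Rightarrow> real" and A T n :: nat
  assumes nonneg: "\<And>x i. 0 \<le> wgt x i"
    and total: "\<And>x. length x = n \<Longrightarrow> (\<Sum>i<n. wgt x i) \<le> T"
    and diff: "\<And>x y. length x = n \<Longrightarrow> length y = n \<Longrightarrow> (x \<in> L) \<noteq> (y \<in> L) \<Longrightarrow>
      1 \<le> A * (\<Sum>i | i < n \<and> x ! i \<noteq> y ! i. wgt x i)"
    and x: "length x = n"
  shows "\<exists>S\<subseteq>{..<n}. card S \<le> (A * T)\<^sup>2 \<and>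
     (\<forall>y. length y = n \<longrightarrow> (\<forall>i\<in>S. y ! i = x ! i) \<longrightarrow> (y \<in> L \<longleftrightarrow> x \<in> L))"
proof -
  define sens where "sens x B \<longleftrightarrow> B \<subseteq> {..<n} \<and> (flips x B \<in> L) \<noteq> (x \<in> L)" for x B
  have sens: "1 \<le> A * (\<Sum>i\<in>B. wgt x i)" if "sens x B" "length x = n" for x B
  proof -
    have "{i. i < n \<and> x ! i \<noteq> flips x B ! i} = B" using that by (auto simp: sens_def)
    then show ?thesis using diff[of x "flips x B"] that by (auto simp: sens_def)
  qed
  have le_total: "A * (\<Sum>i\<in>B. wgt x i) \<le> real A * real T" if "B \<subseteq> {..<n}" "length x = n" for x B
    by (intro mult_left_mono order_trans[OF sum_mono2 total[OF that(2)]]) (use that nonneg in auto)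
  define msens where "msens B \<longleftrightarrow> sens x B \<and> (\<forall>C. C \<subset> B \<longrightarrow> \<not> sens x C)" for B
  have card_block: "card B \<le> A * T" if B: "msens B" for B
  proof -
    have Bn: "B \<subseteq> {..<n}" using B by (simp add: msens_def sens_def)
    \<comment> \<open>By minimality, flipping any single \<open>i\<close> of \<open>B\<close> back
      restores the answer of \<open>x\<close>. So every coordinate of \<open>B\<close> is sensitive
      at \<open>z\<close> by itself and carries weight at least \<open>1 / A\<close> there.\<close>
    define z where "z = flips x B"
    have z: "length z = n" using x by (simp add: z_def)
    have "1 \<le> A * wgt z i" if i: "i \<in> B" for i
    proof -
      have "flips z {i} = flips x (B - {i})"
        by (rule nth_equalityI) (use i Bn x in \<open>auto simp: z_def\<close>)
      moreover have "\<not> sens x (B - {i})" using B i by (auto simp: msens_def)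
      moreover have "sens x B" using B by (simp add: msens_def)
      ultimately have "sens z {i}" using i Bn unfolding sens_def z_def by auto
      from sens[OF this z] show ?thesis by simp
    qed
    then have "(\<Sum>i\<in>B. 1::real) \<le> (\<Sum>i\<in>B. A * wgt z i)" by (rule sum_mono)
    also have "\<dots> \<le> real A * real T" using le_total[OF Bn z] by (simp add: sum_distrib_left)
    finally show ?thesis by (simp flip: of_nat_mult)
  qed
  have card_family: "card F \<le> A * T" if F: "F \<subseteq> {B. msens B}" "disjoint F" for F
  proof -
    have Fn: "\<Union>F \<subseteq> {..<n}" using F by (auto simp: msens_def sens_def)
    have fin: "finite B" if "B \<in> F" for B
      by (rule finite_subset[OF _ finite_lessThan[of n]]) (use that Fn in auto)
    have "1 \<le> A * (\<Sum>i\<in>B. wgt x i)" if "B \<in> F" for B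
      using sens[of x B] x F that by (auto simp: msens_def)
    then have "(\<Sum>B\<in>F. 1::real) \<le> (\<Sum>B\<in>F. A * (\<Sum>i\<in>B. wgt x i))" by (rule sum_mono)
    also have "\<dots> = A * (\<Sum>i\<in>\<Union>F. wgt x i)"
      using F(2) fin by (subst sum.Union_disjoint) (auto simp: disjoint_def sum_distrib_left)
    also have "\<dots> \<le> real A * real T" by (rule le_total[OF Fn x])
    finally show ?thesis by (simp flip: of_nat_mult)
  qed
  define FF where "FF = {F. F \<subseteq> {B. msens B} \<and> disjoint F}"
  have "FF \<subseteq> Pow (Pow {..<n})" by (auto simp: FF_def msens_def sens_def)
  then have finFF: "finite FF" by (rule finite_subset) simp
  have "{} \<in> FF" by (simp add: FF_def disjoint_def)
  then have "Max (card ` FF) \<in> card ` FF" using finFF by (intro Max_in) auto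
  then obtain F where "F \<in> FF" "card F = Max (card ` FF)" by auto
  then have F: "F \<in> FF" "\<And>G. G \<in> FF \<Longrightarrow> card G \<le> card F"
    using finFF by simp_all
  have Fn: "\<Union>F \<subseteq> {..<n}" using F(1) by (auto simp: FF_def msens_def sens_def)
  have finF: "finite F" using F(1) finite_subset[of F "Pow {..<n}"] by (auto simp: FF_def msens_def sens_def)
  have "card (\<Union>F) \<le> (\<Sum>B\<in>F. card B)" by (rule card_Union_le_sum_card)
  also have "\<dots> \<le> (\<Sum>B\<in>F. A * T)" by (rule sum_mono) (use F(1) card_block in \<open>auto simp: FF_def\<close>)
  also have "\<dots> \<le> (A * T)\<^sup>2" using card_family[of F] F(1) by (auto simp: FF_def power2_eq_square)
  finally have card: "card (\<Union>F) \<le> (A * T)\<^sup>2" .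
  have "y \<in> L \<longleftrightarrow> x \<in> L" if y: "length y = n" "\<forall>i\<in>\<Union>F. y ! i = x ! i" for y
  proof (rule ccontr)
    assume ne: "(y \<in> L) \<noteq> (x \<in> L)"
    \<comment> \<open>The set where \<open>y\<close> differs from \<open>x\<close> contains a
      minimal block, which is disjoint from the family and could be added to it, against
      maximality.\<close>
    define D where "D = {i. i < n \<and> x ! i \<noteq> y ! i}"
    have "flips x D = y" by (rule nth_equalityI) (use x y in \<open>auto simp: D_def\<close>)
    then have D: "sens x D" using ne by (auto simp: sens_def D_def)
    have "finite D" by (simp add: D_def)
    then obtain B where B: "B \<subseteq> D" "sens x B" "\<And>C. C \<subset> B \<Longrightarrow> \<not> sens x C"
      using D
    proof (induction D rule: finite_psubset_induct)
      case (psubset D)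
      then show ?case by (metis dual_order.refl dual_order.strict_implies_order order_trans psubset_imp_subset)
    qed
    have "flips x {} = x" by (rule nth_equalityI) auto
    then have Bne: "B \<noteq> {}" using B(2) by (auto simp: sens_def)
    have disj: "B \<inter> \<Union>F = {}" using B(1) y(2) by (auto simp: D_def)
    then have "B \<notin> F" using Bne by auto
    moreover have "insert B F \<in> FF" using F(1) B disj
      by (auto simp: FF_def msens_def disjoint_def)
    ultimately show False using F(2)[of "insert B F"] finF by simp
  qed
  then show ?thesis using Fn card by (intro exI[of _ "\<Union>F"]) auto
qed

section \<open>The hybrid argument\<close>

instance move :: finite
proof
  have "(UNIV :: move set) = {Lft, Stay, Rgt}" using move.exhaust by auto
  then show "finite (UNIV :: move set)" by (metis finite.emptyI finite.insertI)
qed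

section \<open>Finite superpositions and their squared norm\<close>

definition restrict_to :: "('c \<Rightarrow> bool) \<Rightarrow> ('c \<Rightarrow> complex) \<Rightarrow> 'c \<Rightarrow> complex" where
  "restrict_to E \<phi> = (\<lambda>c. if E c then \<phi> c else 0)"

definition fsp :: "('q::finite, 's::finite) qtm \<Rightarrow> ('q, 's) superpos \<Rightarrow> bool" where
  "fsp M \<phi> \<longleftrightarrow> finite (supp \<phi>) \<and> supp \<phi> \<subseteq> confs M"

definition sqnorm :: "('q::finite, 's::finite) superpos \<Rightarrow> real" where
  "sqnorm \<phi> = (\<Sum>c\<in>supp \<phi>. (cmod (\<phi> c))\<^sup>2)"

lemma sqnorm_eq: "finite A \<Longrightarrow> supp \<phi> \<subseteq> A \<Longrightarrow> sqnorm \<phi> = (\<Sum>c\<in>A. (cmod (\<phi> c))\<^sup>2)"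
  unfolding sqnorm_def by (rule sum.mono_neutral_left) (auto simp: supp_def)

lemma sqnorm_nonneg: "0 \<le> sqnorm \<phi>"
  unfolding sqnorm_def by (simp add: sum_nonneg)

lemma fsp_diff: "fsp M \<phi> \<Longrightarrow> fsp M \<psi> \<Longrightarrow> fsp M (\<lambda>c. \<phi> c - \<psi> c)"
proof -
  have "supp (\<lambda>c. \<phi> c - \<psi> c) \<subseteq> supp \<phi> \<union> supp \<psi>" by (auto simp: supp_def)
  then show "fsp M \<phi> \<Longrightarrow> fsp M \<psi> \<Longrightarrow> fsp M (\<lambda>c. \<phi> c - \<psi> c)"
    unfolding fsp_def by (meson finite_UnI finite_subset le_sup_iff order_trans)
qed

lemma fsp_restrict: "fsp M \<phi> \<Longrightarrow> fsp M (restrict_to E \<phi>)"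
proof -
  have "supp (restrict_to E \<phi>) \<subseteq> supp \<phi>" by (auto simp: supp_def restrict_to_def)
  then show "fsp M \<phi> \<Longrightarrow> fsp M (restrict_to E \<phi>)"
    unfolding fsp_def by (meson finite_subset order_trans)
qed

lemma sqnorm_triangle:
  assumes "fsp M \<phi>" "fsp M \<psi>"
  shows "sqrt (sqnorm (\<lambda>c. \<phi> c + \<psi> c)) \<le> sqrt (sqnorm \<phi>) + sqrt (sqnorm \<psi>)"
    and "sqrt (sqnorm (\<lambda>c. \<phi> c - \<psi> c)) \<le> sqrt (sqnorm \<phi>) + sqrt (sqnorm \<psi>)"
proof -
  define A where "A = supp \<phi> \<union> supp \<psi>"
  have A: "finite A" "supp \<phi> \<subseteq> A" "supp \<psi> \<subseteq> A" "supp (\<lambda>c. \<phi> c + \<psi> c) \<subseteq> A" "supp (\<lambda>c. \<phi> c - \<psi> c) \<subseteq> A"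
    using assms by (auto simp: A_def supp_def fsp_def)
  have L: "sqrt (sqnorm \<chi>) = L2_set (\<lambda>c. cmod (\<chi> c)) A" if "supp \<chi> \<subseteq> A" for \<chi>
    using sqnorm_eq[OF A(1) that] by (simp add: L2_set_def)
  note L2 = order_trans[OF L2_set_mono[where K = A] L2_set_triangle_ineq]
  show "sqrt (sqnorm (\<lambda>c. \<phi> c + \<psi> c)) \<le> sqrt (sqnorm \<phi>) + sqrt (sqnorm \<psi>)"
    unfolding L[OF A(2)] L[OF A(3)] L[OF A(4)] by (rule L2) (auto intro: norm_triangle_ineq)
  show "sqrt (sqnorm (\<lambda>c. \<phi> c - \<psi> c)) \<le> sqrt (sqnorm \<phi>) + sqrt (sqnorm \<psi>)"
    unfolding L[OF A(2)] L[OF A(3)] L[OF A(5)] by (rule L2) (auto intro: norm_triangle_ineq4)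
qed

lemma sqnorm_minus_commute: "sqnorm (\<lambda>c. \<phi> c - \<psi> c) = sqnorm (\<lambda>c. \<psi> c - \<phi> c)"
proof -
  have "supp (\<lambda>c. \<phi> c - \<psi> c) = supp (\<lambda>c. \<psi> c - \<phi> c)" by (auto simp: supp_def)
  then show ?thesis unfolding sqnorm_def by (auto intro!: sum.cong simp: norm_minus_commute)
qed

text \<open>An over-approximation of the one-step successors that ignores the state; it serves to
  show that supports stay finite and within \<open>confs M\<close>.\<close>

definition succs :: "('q, 's) qtm \<Rightarrow> bool list \<Rightarrow> ('q, 's) conf \<Rightarrow> ('q, 's) conf set" where
  "succs M x c = insert (query_step M x c) ((\<lambda>y. local_step y c) ` UNIV)"

lemma finite_succs: "finite (succs (M :: ('q::finite, 's::finite) qtm) x c)"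
  by (simp add: succs_def)

lemma amplitude_succs: "amplitude M x c c' \<noteq> 0 \<Longrightarrow> c' \<in> succs M x c"
proof (rule ccontr)
  assume a: "amplitude M x c c' \<noteq> 0" and n: "c' \<notin> succs M x c"
  have e: "{y. local_step y c = c'} = {}" and q: "c' \<noteq> query_step M x c" using n unfolding succs_def by blast+
  have "amplitude M x c c' = 0" unfolding amplitude_def e using q by simp
  with a show False by simp
qed

lemma succs_confs:
  assumes "c \<in> confs M"
  shows "succs M x c \<subseteq> confs M"
proof -
  have upd: "finite {j. (f(h := u)) j \<noteq> b}" if "finite {j. f j \<noteq> b}" for f :: "int \<Rightarrow> 's" and h u b
    by (rule finite_subset[of _ "insert h {j. f j \<noteq> b}"]) (use that in auto)
  have "local_step y c \<in> confs M" for y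
    using assms by (cases y) (auto simp: confs_def simp del: fun_upd_apply intro!: upd)
  moreover have "query_step M x c \<in> confs M"
    using assms by (auto simp: confs_def query_step_def simp del: fun_upd_apply intro!: upd)
  ultimately show ?thesis by (auto simp: succs_def)
qed

lemma evolve_eq:
  "finite A \<Longrightarrow> supp \<phi> \<subseteq> A \<Longrightarrow> evolve M x \<phi> c' = (\<Sum>c\<in>A. \<phi> c * amplitude M x c c')"
  unfolding evolve_def by (rule sum.mono_neutral_left) (auto simp: supp_def)

lemma supp_evolve: "supp (evolve M x \<phi>) \<subseteq> (\<Union>c\<in>supp \<phi>. succs M x c)"
proof
  fix c' assume "c' \<in> supp (evolve M x \<phi>)"
  then have "(\<Sum>c\<in>supp \<phi>. \<phi> c * amplitude M x c c') \<noteq> 0" by (simp add: supp_def evolve_def)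
  then obtain c where "c \<in> supp \<phi>" "\<phi> c * amplitude M x c c' \<noteq> 0"
    by (rule sum.not_neutral_contains_not_neutral)
  then show "c' \<in> (\<Union>c\<in>supp \<phi>. succs M x c)" using amplitude_succs by fastforce
qed

lemma fsp_evolve:
  assumes "fsp M \<phi>"
  shows "fsp M (evolve M x \<phi>)"
proof -
  have "finite (\<Union>c\<in>supp \<phi>. succs M x c)" using assms by (simp add: fsp_def finite_succs)
  moreover have "(\<Union>c\<in>supp \<phi>. succs M x c) \<subseteq> confs M" using assms succs_confs by (fastforce simp: fsp_def)
  ultimately show ?thesis unfolding fsp_def using supp_evolve[of M x \<phi>] by (meson finite_subset order_trans)
qed

lemma evolve_diff:
  assumes "fsp M \<phi>" "fsp M \<psi>"
  shows "evolve M x (\<lambda>c. \<phi> c - \<psi> c) = (\<lambda>c. evolve M x \<phi> c - evolve M x \<psi> c)"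
proof
  fix c'
  define A where "A = supp \<phi> \<union> supp \<psi>"
  have A: "finite A" "supp \<phi> \<subseteq> A" "supp \<psi> \<subseteq> A" "supp (\<lambda>c. \<phi> c - \<psi> c) \<subseteq> A"
    using assms by (auto simp: A_def supp_def fsp_def)
  show "evolve M x (\<lambda>c. \<phi> c - \<psi> c) c' = evolve M x \<phi> c' - evolve M x \<psi> c'"
    unfolding evolve_eq[OF A(1,2)] evolve_eq[OF A(1,3)] evolve_eq[OF A(1,4)]
    by (simp add: left_diff_distrib sum_subtractf)
qed

lemma sqnorm_evolve: "well_formed M \<Longrightarrow> fsp M \<phi> \<Longrightarrow> sqnorm (evolve M x \<phi>) = sqnorm \<phi>"
  unfolding well_formed_def fsp_def sqnorm_def by blast

lemma fsp_qrun: "fsp M (qrun M x t)"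
proof (induction t)
  case 0
  have s: "supp (qrun M x 0) = {init_conf M (length x)}" by (auto simp: qrun_def supp_def)
  have "{j. work (init_conf M (length x)) j \<noteq> blank M} \<subseteq> {0..int (length x)}"
  proof
    fix j assume "j \<in> {j. work (init_conf M (length x)) j \<noteq> blank M}"
    then have j: "0 \<le> j" "2 ^ nat j \<le> length x" by (auto simp: init_conf_def split: if_splits)
    have "nat j < 2 ^ nat j" by simp
    then have "nat j \<le> length x" using j by linarith
    then show "j \<in> {0..int (length x)}" using j by auto
  qed
  then have "finite {j. work (init_conf M (length x)) j \<noteq> blank M}" by (rule finite_subset) simp
  then show ?case unfolding fsp_def s by (simp add: confs_def) (simp add: init_conf_def)
next
  case (Suc t)
  then show ?case using fsp_evolve by (simp add: qrun_def)
qed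

lemma qrun_Suc: "qrun M x (Suc t) = evolve M x (qrun M x t)"
  by (simp add: qrun_def)

lemma sqnorm_qrun: "well_formed M \<Longrightarrow> sqnorm (qrun M x t) = 1"
proof (induction t)
  case 0
  have "supp (qrun M x 0) = {init_conf M (length x)}" by (auto simp: qrun_def supp_def)
  then show ?case by (simp add: sqnorm_def) (simp add: qrun_def)
next
  case (Suc t)
  then show ?case by (simp add: qrun_Suc sqnorm_evolve fsp_qrun)
qed

section \<open>Query weights and the hybrid bound\<close>

definition asks :: "('q, 's) qtm \<Rightarrow> nat set \<Rightarrow> ('q, 's) conf \<Rightarrow> bool" where
  "asks M B c \<longleftrightarrow> state c = prequery M \<and> address M c \<in> B"

definition qweight :: "('q::finite, 's::finite) qtm \<Rightarrow> bool list \<Rightarrow> nat \<Rightarrow> nat set \<Rightarrow> real" where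
  "qweight M x t B = sqnorm (restrict_to (asks M B) (qrun M x t))"

definition differ :: "bool list \<Rightarrow> bool list \<Rightarrow> nat set" where
  "differ x y = {i. bit_at x i \<noteq> bit_at y i}"

text \<open>The two oracles act alike outside the configurations that query a differing coordinate,
  so the difference only sees that part of \<open>\<phi>\<close>. Both images of the part keep its
  norm, which gives the factor 2.\<close>

lemma evolve_differ:
  assumes wf: "well_formed M" and f: "fsp M \<phi>"
  shows "sqrt (sqnorm (\<lambda>c. evolve M x \<phi> c - evolve M y \<phi> c)) \<le> 2 * sqrt (sqnorm (restrict_to (asks M (differ x y)) \<phi>))"
proof -
  let ?\<phi> = "restrict_to (asks M (differ x y)) \<phi>"
  have f': "fsp M ?\<phi>" by (rule fsp_restrict[OF f])
  have fin: "finite (supp \<phi>)" using f by (simp add: fsp_def)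
  have sub: "supp ?\<phi> \<subseteq> supp \<phi>" by (auto simp: supp_def restrict_to_def)
  have eq: "amplitude M x c = amplitude M y c" if "\<not> asks M (differ x y) c" for c
    using that by (auto simp: fun_eq_iff amplitude_def asks_def differ_def query_step_def)
  have "evolve M x \<phi> c' - evolve M y \<phi> c' = evolve M x ?\<phi> c' - evolve M y ?\<phi> c'" for c'
    unfolding evolve_eq[OF fin order_refl] evolve_eq[OF fin sub] sum_subtractf[symmetric]
    by (rule sum.cong) (auto simp: restrict_to_def eq)
  then have "sqrt (sqnorm (\<lambda>c. evolve M x \<phi> c - evolve M y \<phi> c)) = sqrt (sqnorm (\<lambda>c. evolve M x ?\<phi> c - evolve M y ?\<phi> c))"
    by simp
  also have "\<dots> \<le> sqrt (sqnorm (evolve M x ?\<phi>)) + sqrt (sqnorm (evolve M y ?\<phi>))"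
    by (rule sqnorm_triangle(2)) (rule fsp_evolve[OF f'])+
  also have "\<dots> = 2 * sqrt (sqnorm ?\<phi>)" by (simp add: sqnorm_evolve[OF wf f'])
  finally show ?thesis .
qed

text \<open>The hybrid is one step with oracle \<open>y\<close> applied to the run on
  \<open>x\<close>. It splits the new difference into one caused by the current query and the old
  difference, which linearity and well-formedness carry on with unchanged norm.\<close>

lemma hybrid_sum:
  assumes wf: "well_formed M" and len: "length x = length y"
  shows "sqrt (sqnorm (\<lambda>c. qrun M x t c - qrun M y t c)) \<le> (\<Sum>s<t. 2 * sqrt (qweight M x s (differ x y)))"
proof (induction t)
  case 0
  show ?case using len by (simp add: qrun_def sqnorm_def supp_def)
next
  case (Suc t)
  let ?\<phi> = "qrun M x t" and ?\<psi> = "qrun M y t"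
  have "sqrt (sqnorm (\<lambda>c. qrun M x (Suc t) c - qrun M y (Suc t) c)) =
    sqrt (sqnorm (\<lambda>c. (evolve M x ?\<phi> c - evolve M y ?\<phi> c) + evolve M y (\<lambda>c. ?\<phi> c - ?\<psi> c) c))"
    by (simp add: qrun_Suc evolve_diff[OF fsp_qrun fsp_qrun])
  also have "\<dots> \<le> sqrt (sqnorm (\<lambda>c. evolve M x ?\<phi> c - evolve M y ?\<phi> c)) + sqrt (sqnorm (evolve M y (\<lambda>c. ?\<phi> c - ?\<psi> c)))"
    by (rule sqnorm_triangle(1)[of M]) (intro fsp_diff fsp_evolve fsp_qrun)+
  also have "\<dots> \<le> 2 * sqrt (qweight M x t (differ x y)) + (\<Sum>s<t. 2 * sqrt (qweight M x s (differ x y)))"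
    unfolding sqnorm_evolve[OF wf fsp_diff[OF fsp_qrun fsp_qrun]] qweight_def
    by (rule add_mono[OF evolve_differ[OF wf fsp_qrun] Suc.IH[unfolded qweight_def]])
  finally show ?case by simp
qed

text \<open>Cauchy-Schwarz against the constant 1 turns the sum of square roots into a sum of
  weights, at the cost of a factor \<open>t\<close>.\<close>

lemma hybrid:
  assumes wf: "well_formed M" and len: "length x = length y"
  shows "sqnorm (\<lambda>c. qrun M x t c - qrun M y t c) \<le> 4 * t * (\<Sum>s<t. qweight M x s (differ x y))"
proof -
  let ?q = "\<lambda>s. qweight M x s (differ x y)"
  have q: "0 \<le> ?q s" for s by (simp add: qweight_def sqnorm_nonneg)
  have "sqnorm (\<lambda>c. qrun M x t c - qrun M y t c) = (sqrt (sqnorm (\<lambda>c. qrun M x t c - qrun M y t c)))\<^sup>2"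
    by (simp add: sqnorm_nonneg)
  also have "\<dots> \<le> (\<Sum>s<t. 2 * sqrt (?q s))\<^sup>2"
    by (rule power_mono[OF hybrid_sum[OF wf len]]) (simp add: sqnorm_nonneg)
  also have "\<dots> \<le> (\<Sum>s<t. (1::real)\<^sup>2) * (\<Sum>s<t. (2 * sqrt (?q s))\<^sup>2)"
    using Cauchy_Schwarz_ineq_sum[of "\<lambda>_. 1" "\<lambda>s. 2 * sqrt (?q s)" "{..<t}"] by simp
  also have "\<dots> = 4 * t * (\<Sum>s<t. ?q s)"
    using q by (simp add: power_mult_distrib sum_distrib_left mult.left_commute mult.assoc)
  finally show ?thesis by simp
qed

lemma qweight_differ:
  assumes len: "length x = n" "length y = n"
  shows "qweight M x s (differ x y) = (\<Sum>i | i < n \<and> x ! i \<noteq> y ! i. qweight M x s {i})"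
proof -
  let ?D = "{i. i < n \<and> x ! i \<noteq> y ! i}" and ?\<phi> = "qrun M x s"
  have D: "differ x y = ?D" using len by (auto simp: differ_def bit_at_def)
  have fin: "finite (supp ?\<phi>)" using fsp_qrun by (auto simp: fsp_def)
  have q: "qweight M x s B = (\<Sum>c\<in>{c \<in> supp ?\<phi>. asks M B c}. (cmod (?\<phi> c))\<^sup>2)" for B
    unfolding qweight_def by (subst sqnorm_eq[of "{c \<in> supp ?\<phi>. asks M B c}"])
      (use fin in \<open>auto simp: supp_def restrict_to_def intro!: sum.cong\<close>)
  have "{c \<in> supp ?\<phi>. asks M ?D c} = (\<Union>i\<in>?D. {c \<in> supp ?\<phi>. asks M {i} c})"
    by (auto simp: asks_def)
  then show ?thesis unfolding D q
    by (simp only:) (rule sum.UNION_disjoint, use fin in \<open>auto simp: asks_def\<close>)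
qed

lemma qweight_total:
  assumes wf: "well_formed M"
  shows "(\<Sum>i<n. qweight M x s {i}) \<le> 1"
proof -
  let ?\<phi> = "qrun M x s"
  have fin: "finite (supp ?\<phi>)" using fsp_qrun by (auto simp: fsp_def)
  have q: "qweight M x s B = (\<Sum>c\<in>{c \<in> supp ?\<phi>. asks M B c}. (cmod (?\<phi> c))\<^sup>2)" for B
    unfolding qweight_def by (subst sqnorm_eq[of "{c \<in> supp ?\<phi>. asks M B c}"])
      (use fin in \<open>auto simp: supp_def restrict_to_def intro!: sum.cong\<close>)
  have "(\<Sum>i<n. qweight M x s {i}) = (\<Sum>c\<in>(\<Union>i<n. {c \<in> supp ?\<phi>. asks M {i} c}). (cmod (?\<phi> c))\<^sup>2)"
    unfolding q by (rule sum.UNION_disjoint[symmetric]) (use fin in \<open>auto simp: asks_def\<close>)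
  also have "\<dots> \<le> sqnorm ?\<phi>" unfolding sqnorm_def by (rule sum_mono2) (use fin in auto)
  finally show ?thesis by (simp add: sqnorm_qrun[OF wf])
qed

section \<open>Telling accepting and rejecting runs apart\<close>

lemma sqnorm_restrict: "sqnorm (restrict_to E \<phi>) = (\<Sum>c | c \<in> supp \<phi> \<and> E c. (cmod (\<phi> c))\<^sup>2)"
proof -
  have "supp (restrict_to E \<phi>) = {c. c \<in> supp \<phi> \<and> E c}" by (auto simp: supp_def restrict_to_def)
  then show ?thesis unfolding sqnorm_def by (auto simp: restrict_to_def intro!: sum.cong)
qed

lemma distinguishable:
  assumes f: "fsp M \<phi>" "fsp M \<psi>"
    and E: "2 / 3 \<le> sqnorm (restrict_to E \<phi>)" "sqnorm (restrict_to E \<psi>) \<le> 1 / 3"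
  shows "1 / 20 \<le> sqnorm (\<lambda>c. \<phi> c - \<psi> c)"
proof -
  let ?d = "\<lambda>c. \<phi> c - \<psi> c"
  have fd: "fsp M ?d" by (rule fsp_diff[OF f])
  have "sqnorm (restrict_to E ?d) \<le> sqnorm ?d"
    unfolding sqnorm_restrict unfolding sqnorm_def by (rule sum_mono2) (use fd in \<open>auto simp: fsp_def\<close>)
  then have d: "sqrt (sqnorm (restrict_to E ?d)) \<le> sqrt (sqnorm ?d)" by simp
  have "restrict_to E \<phi> = (\<lambda>c. restrict_to E ?d c + restrict_to E \<psi> c)" by (auto simp: restrict_to_def)
  then have "sqrt (sqnorm (restrict_to E \<phi>)) \<le> sqrt (sqnorm (restrict_to E ?d)) + sqrt (sqnorm (restrict_to E \<psi>))"
    using sqnorm_triangle(1)[OF fsp_restrict[OF fd] fsp_restrict[OF f(2)]] by simp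
  with d have s: "sqrt (sqnorm (restrict_to E \<phi>)) \<le> sqrt (sqnorm ?d) + sqrt (sqnorm (restrict_to E \<psi>))" by linarith
  define u v where "u = sqrt (sqnorm ?d)" and "v = sqrt (sqnorm (restrict_to E \<psi>))"
  have "2 / 3 \<le> (sqrt (sqnorm (restrict_to E \<phi>)))\<^sup>2" using E(1) by (simp add: sqnorm_nonneg)
  also have "\<dots> \<le> (u + v)\<^sup>2" unfolding u_def v_def by (rule power_mono[OF s]) (simp add: sqnorm_nonneg)
  \<comment> \<open>The mixed term is split so that \<open>7 / 5 * (1 / 3) = 7 / 15\<close> stays
    below \<open>2 / 3\<close>. The remaining \<open>1 / 5\<close> makes the square of
    \<open>u\<close> at least \<open>2 / 35\<close>, which exceeds \<open>1 / 20\<close>.\<close>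
  also have "\<dots> \<le> 7 / 2 * u\<^sup>2 + 7 / 5 * v\<^sup>2"
  proof -
    have "0 \<le> (5 * u - 2 * v)\<^sup>2" by simp
    then show ?thesis by (simp add: power2_eq_square algebra_simps)
  qed
  finally have "2 / 3 \<le> 7 / 2 * u\<^sup>2 + 7 / 5 * v\<^sup>2" .
  moreover have "v\<^sup>2 \<le> 1 / 3" "u\<^sup>2 = sqnorm ?d" using E(2) by (simp_all add: u_def v_def sqnorm_nonneg)
  ultimately show ?thesis by linarith
qed

lemma prob_state_le:
  fixes M :: "('q::finite, 's::finite) qtm"
  assumes wf: "well_formed M"
  shows "prob_state M x t (acc M) + prob_state M x t (rej M) \<le> 1"
proof -
  let ?\<phi> = "qrun M x t"
  have fin: "finite (supp ?\<phi>)" using fsp_qrun by (auto simp: fsp_def)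
  have ne: "acc M \<noteq> rej M" using wf by (auto simp: well_formed_def)
  have "prob_state M x t (acc M) + prob_state M x t (rej M) =
     (\<Sum>c\<in>{c. c \<in> supp ?\<phi> \<and> state c = acc M} \<union> {c. c \<in> supp ?\<phi> \<and> state c = rej M}. (cmod (?\<phi> c))\<^sup>2)"
    unfolding prob_state_def by (rule sum.union_disjoint[symmetric]) (use fin ne in auto)
  also have "\<dots> \<le> sqnorm ?\<phi>" unfolding sqnorm_def by (rule sum_mono2) (use fin in auto)
  finally show ?thesis by (simp add: sqnorm_qrun[OF wf])
qed

text \<open>Halting times may depend on the input. If they differ, the earlier time gives a perfect
  test: one run then has only final configurations, the other none. If they agree, the accepting
  state tells the runs apart.\<close>

lemma halting_separates:
  assumes wf: "well_formed M"
    and x: "halts_at M x tx" and y: "halts_at M y ty"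
    and px: "2 / 3 \<le> prob_state M x tx (acc M)" and py: "2 / 3 \<le> prob_state M y ty (rej M)"
  shows "1 / 20 \<le> sqnorm (\<lambda>c. qrun M x (min tx ty) c - qrun M y (min tx ty) c)"
proof -
  have halt: "1 / 20 \<le> sqnorm (\<lambda>c. qrun M x' s c - qrun M y' s c)"
    if "halts_at M x' s" "halts_at M y' t" "s < t" for x' y' s t
  proof (rule distinguishable[OF fsp_qrun fsp_qrun])
    have "{c. c \<in> supp (qrun M x' s) \<and> final_conf M c} = supp (qrun M x' s)"
      using that by (auto simp: halts_at_def)
    then have "sqnorm (restrict_to (final_conf M) (qrun M x' s)) = sqnorm (qrun M x' s)"
      unfolding sqnorm_restrict by (simp add: sqnorm_def)
    then show "2 / 3 \<le> sqnorm (restrict_to (final_conf M) (qrun M x' s))"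
      by (simp add: sqnorm_qrun[OF wf])
    have "{c. c \<in> supp (qrun M y' s) \<and> final_conf M c} = {}"
      using that by (auto simp: halts_at_def)
    then have "sqnorm (restrict_to (final_conf M) (qrun M y' s)) = 0" by (simp only: sqnorm_restrict sum.empty)
    then show "sqnorm (restrict_to (final_conf M) (qrun M y' s)) \<le> 1 / 3" by simp
  qed
  consider "tx < ty" | "ty < tx" | "tx = ty" by linarith
  then show ?thesis
  proof cases
    case 1 then show ?thesis using halt[OF x y] by (simp add: min_def)
  next
    case 2 then show ?thesis using halt[OF y x] by (subst sqnorm_minus_commute) (simp add: min_def)
  next
    case 3
    have "prob_state M y ty (acc M) \<le> 1 / 3" using prob_state_le[OF wf, of y ty] py by simp
    then have "1 / 20 \<le> sqnorm (\<lambda>c. qrun M x tx c - qrun M y tx c)"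
      by (intro distinguishable[OF fsp_qrun fsp_qrun, where E = "\<lambda>c. state c = acc M"])
        (use px 3 in \<open>auto simp: sqnorm_restrict prob_state_def\<close>)
    then show ?thesis using 3 by simp
  qed
qed

text \<open>A coordinate is weighted by its query weight summed over all steps, in total at most
  \<open>T n\<close>. The separation \<open>1 / 20\<close> and the factor \<open>4 * T n\<close> of
  the hybrid bound combine to \<open>A = 80 * T n\<close>.\<close>

theorem small_certificates_quantum:
  fixes M :: "('q::finite, 's::finite) qtm"
  assumes dec: "qtm_decides M L T m" and x: "length x = n"
  shows "\<exists>S\<subseteq>{..<n}. card S \<le> (80 * T n * T n)\<^sup>2 \<and>
     (\<forall>y. length y = n \<longrightarrow> (\<forall>i\<in>S. y ! i = x ! i) \<longrightarrow> (y \<in> L \<longleftrightarrow> x \<in> L))"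
proof (rule certificate_exists[where wgt = "\<lambda>x i. \<Sum>s<T n. qweight M x s {i}", OF _ _ _ x])
  have wf: "well_formed M" using dec by (simp add: qtm_decides_def)
  show "0 \<le> (\<Sum>s<T n. qweight M x s {i})" for x i by (simp add: sum_nonneg qweight_def sqnorm_nonneg)
  show "(\<Sum>i<n. \<Sum>s<T n. qweight M x s {i}) \<le> T n" for x
  proof -
    have "(\<Sum>i<n. \<Sum>s<T n. qweight M x s {i}) = (\<Sum>s<T n. \<Sum>i<n. qweight M x s {i})" by (rule sum.swap)
    also have "\<dots> \<le> (\<Sum>s<T n. 1)" by (rule sum_mono) (rule qweight_total[OF wf])
    finally show ?thesis by simp
  qed
  fix x y assume len: "length x = n" "length y = n" and ne: "(x \<in> L) \<noteq> (y \<in> L)"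
  from dec len obtain tx ty where t: "tx \<le> T n" "ty \<le> T n" and h: "halts_at M x tx" "halts_at M y ty"
    and px: "x \<in> L \<longrightarrow> 2 / 3 \<le> prob_state M x tx (acc M)" "x \<notin> L \<longrightarrow> 2 / 3 \<le> prob_state M x tx (rej M)"
    and py: "y \<in> L \<longrightarrow> 2 / 3 \<le> prob_state M y ty (acc M)" "y \<notin> L \<longrightarrow> 2 / 3 \<le> prob_state M y ty (rej M)"
    unfolding qtm_decides_def by metis
  let ?t = "min tx ty"
  have "1 / 20 \<le> sqnorm (\<lambda>c. qrun M x ?t c - qrun M y ?t c)"
  proof (cases "x \<in> L")
    case True
    then show ?thesis using halting_separates[OF wf h] px py ne by blast
  next
    case False
    then have "1 / 20 \<le> sqnorm (\<lambda>c. qrun M y (min ty tx) c - qrun M x (min ty tx) c)"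
      using halting_separates[OF wf h(2,1)] px py ne by blast
    then show ?thesis by (subst sqnorm_minus_commute) (simp add: min.commute)
  qed
  also have "\<dots> \<le> 4 * real ?t * (\<Sum>s<?t. qweight M x s (differ x y))"
    by (rule hybrid[OF wf]) (simp add: len)
  also have "\<dots> \<le> 4 * real (T n) * (\<Sum>s<T n. qweight M x s (differ x y))"
    by (intro mult_mono sum_mono2) (use t in \<open>auto simp: qweight_def sqnorm_nonneg intro!: sum_nonneg\<close>)
  also have "\<dots> = 4 * real (T n) * (\<Sum>i | i < n \<and> x ! i \<noteq> y ! i. \<Sum>s<T n. qweight M x s {i})"
    unfolding qweight_differ[OF len] by (subst sum.swap) (rule refl)
  finally show "1 \<le> real (80 * T n) * (\<Sum>i | i < n \<and> x ! i \<noteq> y ! i. \<Sum>s<T n. qweight M x s {i})"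
    by simp
qed

section \<open>A decision tree from certificates\<close>

text \<open>
  A transcript is a number whose digits in base \<open>\<beta>\<close> are the fields \<open>2 * i + b\<close> (coordinate \<open>i\<close> has
  value \<open>b\<close>), the most recent one least significant.  Powers are capped by \<open>N\<close> to keep all functions
  pseudo-polynomial.
\<close>

definition fld :: "nat \<Rightarrow> nat \<Rightarrow> nat \<Rightarrow> nat \<Rightarrow> nat" where
  "fld N \<beta> e j = e div min N (\<beta> ^ j) mod \<beta>"

text \<open>Besides being a partial assignment, a number denotes an input: the coordinates claimed
  to be 1 are its ones, all others are 0. As 0 is an even field, vanishing fields claim
  nothing.\<close>

definition claims :: "nat \<Rightarrow> nat \<Rightarrow> nat \<Rightarrow> nat \<Rightarrow> nat \<Rightarrow> nat \<Rightarrow> bool" where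
  "claims N \<beta> K n e i \<longleftrightarrow> i < n \<and> (\<exists>l<K. fld N \<beta> e l = 2 * i + 1)"

definition ones :: "nat \<Rightarrow> nat \<Rightarrow> nat \<Rightarrow> nat \<Rightarrow> nat \<Rightarrow> bool list" where
  "ones N \<beta> K n e = map (claims N \<beta> K n e) [0..<n]"

definition agrees :: "nat \<Rightarrow> nat \<Rightarrow> nat \<Rightarrow> nat \<Rightarrow> nat \<Rightarrow> nat \<Rightarrow> nat \<Rightarrow> bool" where
  "agrees N \<beta> K n C \<sigma> y \<longleftrightarrow> (\<forall>j<C. claims N \<beta> K n y (fld N \<beta> \<sigma> j div 2) = (fld N \<beta> \<sigma> j mod 2 = 1))"

text \<open>The range has \<open>2 * C\<close> fields because a counterexample only has to be fixed
  on the coordinates of \<open>\<sigma>\<close> and on a certificate of its own. The first conjunct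
  rules out contradictory \<open>\<sigma>\<close>.\<close>

definition certifies :: "nat \<Rightarrow> nat \<Rightarrow> nat \<Rightarrow> nat \<Rightarrow> nat \<Rightarrow> (nat \<Rightarrow> bool) \<Rightarrow> nat \<Rightarrow> bool" where
  "certifies N \<beta> K n C F \<sigma> \<longleftrightarrow> agrees N \<beta> K n C \<sigma> \<sigma> \<and>
     (\<forall>y<min N (\<beta> ^ (2 * C)). agrees N \<beta> K n C \<sigma> y \<longrightarrow> F y)"

definition compatible :: "nat \<Rightarrow> nat \<Rightarrow> nat \<Rightarrow> nat \<Rightarrow> nat \<Rightarrow> nat \<Rightarrow> bool" where
  "compatible N \<beta> C \<sigma> E k \<longleftrightarrow>
     (\<forall>j<C. \<forall>l<k. fld N \<beta> \<sigma> j div 2 = fld N \<beta> E l div 2 \<longrightarrow> fld N \<beta> \<sigma> j = fld N \<beta> E l)"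

definition choice :: "nat \<Rightarrow> nat \<Rightarrow> nat \<Rightarrow> nat \<Rightarrow> nat \<Rightarrow> (nat \<Rightarrow> bool) \<Rightarrow> nat \<Rightarrow> nat \<Rightarrow> nat" where
  "choice N \<beta> K n C F E k =
     bleast (min N (\<beta> ^ C)) (\<lambda>\<sigma>. certifies N \<beta> K n C F \<sigma> \<and> compatible N \<beta> C \<sigma> E k)"

text \<open>
  In each round of \<open>C\<close> queries, a transcript reads all coordinates of one certificate for membership
  that is still compatible with it.  Such a certificate contradicts every certificate against
  membership, so each round meets a new coordinate of the latter, and \<open>C\<close> rounds settle the answer.
\<close>

definition next_query :: "nat \<Rightarrow> nat \<Rightarrow> nat \<Rightarrow> nat \<Rightarrow> nat \<Rightarrow> (nat \<Rightarrow> bool) \<Rightarrow> nat \<Rightarrow> nat \<Rightarrow> nat" where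
  "next_query N \<beta> K n C F E k =
     fld N \<beta> (choice N \<beta> K n C F (E div min N (\<beta> ^ (k mod C))) (k - k mod C)) (k mod C) div 2"

lemma numeral_with_digits:
  assumes "\<And>j. j < k \<Longrightarrow> f j < \<beta>" "0 < (\<beta>::nat)"
  shows "\<exists>e<\<beta> ^ k. \<forall>j<k. e div \<beta> ^ j mod \<beta> = f j"
  using assms(1)
proof (induction k arbitrary: f)
  case 0
  then show ?case by simp
next
  case (Suc k)
  have "\<exists>e<\<beta> ^ k. \<forall>j<k. e div \<beta> ^ j mod \<beta> = f (Suc j)"
    by (rule Suc.IH) (use Suc.prems in auto)
  then obtain e where e: "e < \<beta> ^ k" "\<forall>j<k. e div \<beta> ^ j mod \<beta> = f (Suc j)" by blast
  have f0: "f 0 < \<beta>" using Suc.prems by simp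
  have "e * \<beta> + f 0 < \<beta> ^ Suc k"
  proof -
    have "e * \<beta> + f 0 < (e + 1) * \<beta>" using f0 by simp
    also have "\<dots> \<le> \<beta> ^ k * \<beta>" using e(1) by (intro mult_le_mono1) simp
    finally show ?thesis by (simp add: mult.commute)
  qed
  moreover have "(e * \<beta> + f 0) div \<beta> ^ j mod \<beta> = f j" if "j < Suc k" for j
  proof (cases j)
    case 0 then show ?thesis using f0 by simp
  next
    case (Suc i)
    have "(e * \<beta> + f 0) div \<beta> ^ Suc i = (e * \<beta> + f 0) div \<beta> div \<beta> ^ i" by (simp add: div_mult2_eq)
    also have "(e * \<beta> + f 0) div \<beta> = e" using f0 assms(2) by simp
    finally show ?thesis using e(2) that Suc by simp
  qed
  ultimately show ?case by blast
qed

text \<open>\<open>K\<close> fields leave room for both uses of numbers, \<open>2 * C\<close> fields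
  for candidate counterexamples and \<open>C * C\<close> for complete transcripts. A field
  \<open>2 * i + b\<close> with \<open>i < 2 ^ w\<close> fits below \<open>\<beta>\<close>.\<close>

locale strategy =
  fixes n w C K N \<beta> :: nat and F :: "nat \<Rightarrow> bool" and L :: "bool list set"
  assumes n: "n < 2 ^ w" and \<beta>: "\<beta> = 2 ^ (w + 1)" and C: "0 < C" and K: "K = 2 * C + C * C"
    and N: "\<beta> ^ K \<le> N"
    and F: "\<And>e. e < \<beta> ^ K \<Longrightarrow> F e \<longleftrightarrow> ones N \<beta> K n e \<in> L"
    and cert: "\<And>z. length z = n \<Longrightarrow> \<exists>S\<subseteq>{..<n}. card S \<le> C \<and>
      (\<forall>y. length y = n \<longrightarrow> (\<forall>i\<in>S. y ! i = z ! i) \<longrightarrow> (y \<in> L \<longleftrightarrow> z \<in> L))"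
begin

abbreviation "fl \<equiv> fld N \<beta>"
abbreviation "xof \<equiv> ones N \<beta> K n"
abbreviation "nq \<equiv> next_query N \<beta> K n C F"

lemma \<beta>_pos: "0 < \<beta>" "1 < \<beta>" using less_exp[of "w + 1"] unfolding \<beta> by (simp, linarith)

lemma pow_le: "j \<le> K \<Longrightarrow> \<beta> ^ j \<le> N"
  using N \<beta>_pos power_increasing[of j K \<beta>] by linarith

lemma less_pow: "y < \<beta> ^ i \<Longrightarrow> i \<le> j \<Longrightarrow> y < \<beta> ^ j"
  using \<beta>_pos power_increasing[of i j \<beta>] by linarith

lemma pow_min: "j \<le> K \<Longrightarrow> min N (\<beta> ^ j) = \<beta> ^ j"
  using pow_le[of j] by (simp add: min_def)

lemma fl: "j \<le> K \<Longrightarrow> fl e j = e div \<beta> ^ j mod \<beta>"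
  by (simp add: fld_def pow_min)

lemma fl_less: "fl e j < \<beta>"
  by (simp add: fld_def \<beta>_pos)

lemma fl_half: "fl e j div 2 < 2 ^ w"
  using fl_less[of e j] by (simp add: \<beta> less_mult_imp_div_less mult.commute)

lemma fl_zero: "e < \<beta> ^ k \<Longrightarrow> k \<le> j \<Longrightarrow> j \<le> K \<Longrightarrow> fl e j = 0"
proof -
  assume a: "e < \<beta> ^ k" "k \<le> j" "j \<le> K"
  have "\<beta> ^ k \<le> \<beta> ^ j" using a(2) \<beta>_pos by (intro power_increasing) auto
  then have "e < \<beta> ^ j" using a(1) by simp
  then show "fl e j = 0" using a(3) by (simp add: fl)
qed

lemma length_xof [simp]: "length (xof e) = n"
  by (simp add: ones_def)

lemma bit_at_xof: "bit_at (xof e) i \<longleftrightarrow> claims N \<beta> K n e i"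
  by (auto simp: bit_at_def ones_def claims_def)

lemma field_split: "2 * i + (of_bool b :: nat) = 2 * j + of_bool c \<longleftrightarrow> i = j \<and> b = c"
  by (cases b; cases c) (auto, presburger+)

definition consistent :: "nat \<Rightarrow> bool list \<Rightarrow> bool" where
  "consistent \<sigma> z \<longleftrightarrow> (\<forall>j<C. bit_at z (fl \<sigma> j div 2) = odd (fl \<sigma> j))"

lemma agrees_iff: "agrees N \<beta> K n C \<sigma> y \<longleftrightarrow> consistent \<sigma> (xof y)"
  by (simp add: agrees_def consistent_def bit_at_xof odd_iff_mod_2_eq_one)

text \<open>The fields are read off from \<open>z\<close> at the positions \<open>s j\<close>.
  Unwritten fields are 0, which is even, so they add no ones that could spoil the agreement with
  \<open>z\<close>.\<close>

lemma code_restriction: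
  assumes k: "k \<le> K" and s: "\<And>j. j < k \<Longrightarrow> s j < 2 ^ w" and z: "length z = n"
  shows "\<exists>e<\<beta> ^ k. (\<forall>j<k. fl e j = 2 * s j + of_bool (bit_at z (s j))) \<and>
    (\<forall>j<k. bit_at (xof e) (s j) = bit_at z (s j))"
proof -
  have lt: "2 * s j + of_bool (bit_at z (s j)) < \<beta>" if "j < k" for j
  proof -
    have "2 * s j + 2 \<le> 2 * 2 ^ w" using s[OF that] by simp
    then show ?thesis by (simp add: \<beta> of_bool_def)
  qed
  obtain e where e: "e < \<beta> ^ k" "\<forall>j<k. e div \<beta> ^ j mod \<beta> = 2 * s j + of_bool (bit_at z (s j))"
    using numeral_with_digits[of k "\<lambda>j. 2 * s j + of_bool (bit_at z (s j))", OF lt \<beta>_pos(1)] by blast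
  have f: "fl e j = 2 * s j + of_bool (bit_at z (s j))" if "j < k" for j
    using e(2) that k by (simp add: fl)
  have "bit_at (xof e) (s j) = bit_at z (s j)" if j: "j < k" for j
  proof
    assume "bit_at (xof e) (s j)"
    then obtain l where l: "l < K" "fl e l = 2 * s j + of_bool True" by (auto simp: bit_at_xof claims_def)
    then have "l < k" using fl_zero[OF e(1), of l] by (cases "l < k") auto
    then show "bit_at z (s j)" using l(2) unfolding f[OF \<open>l < k\<close>] field_split by auto
  next
    assume b: "bit_at z (s j)"
    then have "s j < n" using z by (simp add: bit_at_def)
    moreover have "fl e j = 2 * s j + 1" using f[OF j] b by simp
    ultimately show "bit_at (xof e) (s j)" using j k order.strict_trans2 unfolding bit_at_xof claims_def by blast
  qed
  then show ?thesis using e(1) f by blast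
qed

text \<open>Padding with coordinate 0 makes exactly \<open>C\<close> fields out of at most
  \<open>C\<close> coordinates; 0 is below \<open>2 ^ w\<close> even if
  \<open>n = 0\<close>.\<close>

lemma enumerate_certificate:
  assumes "S \<subseteq> {..<n}" "card S \<le> C"
  obtains s where "\<And>j. j < C \<Longrightarrow> s j < 2 ^ w" "S \<subseteq> s ` {..<C}"
proof -
  obtain h where h: "bij_betw h {0..<card S} S"
    using ex_bij_betw_nat_finite finite_subset[OF assms(1)] by blast
  define s where "s j = (if j < card S then h j else 0)" for j
  have "h j < n" if "j < card S" for j using bij_betwE[OF h] that assms(1) by fastforce
  then have "s j < 2 ^ w" for j using n unfolding s_def by (auto intro: order.strict_trans)
  moreover have "S \<subseteq> s ` {..<C}"
  proof
    fix i assume "i \<in> S"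
    then obtain j where "j < card S" "i = h j" using bij_betw_imp_surj_on[OF h] by force
    then show "i \<in> s ` {..<C}" using assms(2) by (auto simp: s_def)
  qed
  ultimately show thesis using that by blast
qed

text \<open>\<open>z\<close> is arbitrary, while \<open>certifies\<close> only tests inputs with few
  ones. If \<open>z\<close> were a counterexample, keeping it on its own certificate and on the
  coordinates of \<open>\<sigma>\<close> and putting 0 elsewhere would leave a counterexample with
  \<open>2 * C\<close> fields, which has been tested.\<close>

lemma certifiesD:
  assumes \<sigma>: "certifies N \<beta> K n C F \<sigma>" and z: "length z = n" "consistent \<sigma> z"
  shows "z \<in> L"
proof (rule ccontr)
  assume zL: "z \<notin> L"
  obtain S where S: "S \<subseteq> {..<n}" "card S \<le> C"
    "\<And>y. length y = n \<Longrightarrow> (\<And>i. i \<in> S \<Longrightarrow> y ! i = z ! i) \<Longrightarrow> (y \<in> L \<longleftrightarrow> z \<in> L)"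
    using cert[OF z(1)] by blast
  obtain s where s: "\<And>j. j < C \<Longrightarrow> s j < 2 ^ w" "S \<subseteq> s ` {..<C}" by (rule enumerate_certificate[OF S(1,2)]) blast
  \<comment> \<open>The first \<open>C\<close> positions come from the certificate of
    \<open>z\<close>, the others from \<open>\<sigma>\<close>.\<close>
  define s' where "s' j = (if j < C then s j else fl \<sigma> (j - C) div 2)" for j
  have k: "2 * C \<le> K" by (simp add: K)
  have s': "s' j < 2 ^ w" if "j < 2 * C" for j using s(1) fl_half that by (simp add: s'_def)
  obtain y where y: "y < \<beta> ^ (2 * C)" "\<forall>j<2 * C. bit_at (xof y) (s' j) = bit_at z (s' j)"
    using code_restriction[of _ s' z, OF k s' z(1)] by blast
  have "consistent \<sigma> (xof y)" unfolding consistent_def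
  proof (intro allI impI)
    fix j assume "j < C"
    then have "bit_at (xof y) (s' (C + j)) = bit_at z (s' (C + j))" using y(2) by auto
    then show "bit_at (xof y) (fl \<sigma> j div 2) = odd (fl \<sigma> j)"
      using z(2) \<open>j < C\<close> by (simp add: s'_def consistent_def)
  qed
  then have "F y" using \<sigma> y(1) k by (simp add: certifies_def agrees_iff pow_min)
  moreover have "y < \<beta> ^ K" using less_pow[OF y(1) k] .
  ultimately have "xof y \<in> L" by (simp add: F)
  moreover have "xof y ! i = z ! i" if i: "i \<in> S" for i
  proof -
    obtain j where "j < C" "i = s j" using s(2) i by auto
    then have "bit_at (xof y) i = bit_at z i" using y(2)[rule_format, of j] by (simp add: s'_def)
    moreover have "i < n" using S(1) i by auto
    ultimately show ?thesis using z(1) by (simp add: bit_at_def)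
  qed
  ultimately show False using S(3)[of "xof y"] zL by simp
qed

text \<open>The start value 1 acts as a leading digit; without it, transcripts of different lengths
  could be the same number, since 0 is a legitimate field.\<close>

definition tr :: "bool list \<Rightarrow> nat \<Rightarrow> nat" where
  "tr x = rec_nat 1 (\<lambda>k E. E * \<beta> + (2 * nq E k + of_bool (bit_at x (nq E k))))"

definition asked :: "bool list \<Rightarrow> nat \<Rightarrow> nat" where
  "asked x k = nq (tr x k) k"

lemma tr_0: "tr x 0 = 1"
  and tr_Suc: "tr x (Suc k) = tr x k * \<beta> + (2 * asked x k + of_bool (bit_at x (asked x k)))"
  by (simp_all add: tr_def asked_def)

lemma asked_less: "asked x k < 2 ^ w"
  unfolding asked_def next_query_def by (rule fl_half)

lemma field_less: "2 * asked x k + of_bool (bit_at x (asked x k)) < \<beta>"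
proof -
  have "2 * asked x k + 2 \<le> 2 * 2 ^ w" using asked_less[of x k] by simp
  then show ?thesis by (simp add: \<beta> of_bool_def)
qed

lemma tr_bounds: "\<beta> ^ k \<le> tr x k" "tr x k < 2 * \<beta> ^ k"
proof (induction k)
  case (Suc k)
  case 1
  then show ?case using mult_le_mono1[OF Suc(1), of \<beta>] unfolding tr_Suc power_Suc2 by linarith
next
  case (Suc k)
  case 2
  have "tr x (Suc k) < (tr x k + 1) * \<beta>" using field_less[of x k] by (simp add: tr_Suc)
  also have "\<dots> \<le> 2 * \<beta> ^ k * \<beta>" using Suc(2) by (intro mult_le_mono1) simp
  finally show ?case by (simp add: mult.commute mult.left_commute)
qed (auto simp: tr_0)

lemma tr_div: "tr x (k + r) div \<beta> ^ r = tr x k"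
proof (induction r)
  case (Suc r)
  have "tr x (Suc (k + r)) div \<beta> = tr x (k + r)" using field_less[of x "k + r"] \<beta>_pos by (simp add: tr_Suc)
  then show ?case using Suc by (simp add: div_mult2_eq)
qed simp

lemma fl_tr:
  assumes "l < k" "k \<le> K"
  shows "fl (tr x k) l = 2 * asked x (k - 1 - l) + of_bool (bit_at x (asked x (k - 1 - l)))"
proof -
  define i where "i = k - 1 - l"
  have k: "k = Suc i + l" using assms by (simp add: i_def)
  have "tr x k div \<beta> ^ l = tr x (Suc i)" unfolding k by (rule tr_div)
  then have "fl (tr x k) l = 2 * asked x i + of_bool (bit_at x (asked x i))"
    using assms field_less[of x i] by (simp add: fl tr_Suc del: of_bool_eq_iff)
  then show ?thesis by (simp only: i_def)
qed

text \<open>Before a complete transcript is read as an input, its leading digit has to go: it would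
  be taken for the field \<open>2 * 0 + 1\<close>, the claim that coordinate 0 is 1.\<close>

lemma fl_minus_leading:
  assumes "l < k" "k \<le> K"
  shows "fl (tr x k - \<beta> ^ k) l = fl (tr x k) l"
proof -
  have "tr x k = (tr x k - \<beta> ^ k) + \<beta> ^ (k - l - 1) * \<beta> * \<beta> ^ l"
  proof -
    have "\<beta> ^ (k - l - 1) * \<beta> * \<beta> ^ l = \<beta> ^ k"
      using assms by (metis Suc_diff_Suc diff_Suc_1 diff_Suc_eq_diff_pred less_imp_add_positive mult.commute
          power_Suc power_add le_add_diff_inverse2 less_imp_le One_nat_def)
    then show ?thesis using tr_bounds(1)[of k x] by simp
  qed
  then have "tr x k div \<beta> ^ l = (tr x k - \<beta> ^ k) div \<beta> ^ l + \<beta> ^ (k - l - 1) * \<beta>"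
    using \<beta>_pos by (metis div_mult_self1 mult.commute not_gr_zero power_not_zero add.commute)
  then show ?thesis using assms by (simp add: fl)
qed

text \<open>As \<open>z1\<close> agrees with the transcript, its certificate is a compatible
  candidate, so the search succeeds. The certificate found must contradict \<open>z0\<close> on some
  coordinate of \<open>S0\<close>, and this coordinate is new: on coordinates already asked, both it
  and \<open>z0\<close> agree with the transcript.\<close>

lemma asked_fresh:
  assumes p: "p < C" and z0: "length z0 = n" "z0 \<notin> L" and z1: "length z1 = n" "z1 \<in> L"
    and ag0: "\<And>j. j < C * C \<Longrightarrow> bit_at z0 (asked x j) = bit_at x (asked x j)"
    and ag1: "\<And>j. j < C * C \<Longrightarrow> bit_at z1 (asked x j) = bit_at x (asked x j)"
    and S0: "S0 \<subseteq> {..<n}" "\<And>y. length y = n \<Longrightarrow> (\<And>i. i \<in> S0 \<Longrightarrow> y ! i = z0 ! i) \<Longrightarrow> (y \<in> L \<longleftrightarrow> z0 \<in> L)"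
  shows "\<exists>r<C. asked x (p * C + r) \<in> S0 \<and> asked x (p * C + r) \<notin> asked x ` {..<p * C}"
proof -
  have pC: "p * C + C \<le> C * C" using mult_le_mono1[of "Suc p" C C] p by simp
  have pK: "p * C \<le> K" "C \<le> K" using pC by (simp_all add: K)
  let ?E = "tr x (p * C)"
  have fE: "\<exists>j<p * C. fl ?E l = 2 * asked x j + of_bool (bit_at x (asked x j))" if "l < p * C" for l
    using fl_tr[OF that pK(1), of x] that by (intro exI[of _ "p * C - 1 - l"]) auto
  have fE': "\<exists>l<p * C. fl ?E l = 2 * asked x j + of_bool (bit_at x (asked x j))" if "j < p * C" for j
    using fl_tr[OF _ pK(1), of "p * C - 1 - j" x] that by (intro exI[of _ "p * C - 1 - j"]) auto
  obtain S1 where S1: "S1 \<subseteq> {..<n}" "card S1 \<le> C"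
    "\<And>y. length y = n \<Longrightarrow> (\<And>i. i \<in> S1 \<Longrightarrow> y ! i = z1 ! i) \<Longrightarrow> (y \<in> L \<longleftrightarrow> z1 \<in> L)"
    using cert[OF z1(1)] by blast
  obtain s where s: "\<And>j. j < C \<Longrightarrow> s j < 2 ^ w" "S1 \<subseteq> s ` {..<C}" by (rule enumerate_certificate[OF S1(1,2)]) blast
  obtain \<sigma>1 where \<sigma>1: "\<sigma>1 < \<beta> ^ C" "\<forall>j<C. fl \<sigma>1 j = 2 * s j + of_bool (bit_at z1 (s j))"
    "\<forall>j<C. bit_at (xof \<sigma>1) (s j) = bit_at z1 (s j)"
    using code_restriction[of C s z1, OF pK(2) s(1) z1(1)] by blast
  have half: "fl \<sigma>1 j div 2 = s j" "odd (fl \<sigma>1 j) = bit_at z1 (s j)" if "j < C" for j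
    using \<sigma>1(2) that by (auto simp: of_bool_def)
  have "certifies N \<beta> K n C F \<sigma>1" unfolding certifies_def agrees_iff
  proof (intro conjI allI impI)
    show "consistent \<sigma>1 (xof \<sigma>1)" using \<sigma>1(3) half by (simp add: consistent_def)
    fix y assume y: "y < min N (\<beta> ^ (2 * C))" "consistent \<sigma>1 (xof y)"
    have "xof y ! i = z1 ! i" if i: "i \<in> S1" for i
    proof -
      obtain j where j: "j < C" "i = s j" using s(2) i by auto
      then have "bit_at (xof y) i = bit_at z1 i" using y(2)[unfolded consistent_def, rule_format, OF j(1)] half[OF j(1)] by simp
      moreover have "i < n" using S1(1) i by auto
      ultimately show ?thesis using z1(1) by (simp add: bit_at_def)
    qed
    then have "xof y \<in> L" using S1(3)[of "xof y"] z1(2) by simp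
    moreover have "2 * C \<le> K" by (simp add: K)
    then have "y < \<beta> ^ K" using y(1) less_pow[of y "2 * C" K] by simp
    ultimately show "F y" by (simp add: F)
  qed
  moreover have "compatible N \<beta> C \<sigma>1 ?E (p * C)" unfolding compatible_def
  proof (intro allI impI)
    fix j l assume j: "j < C" and l: "l < p * C" and e: "fl \<sigma>1 j div 2 = fl ?E l div 2"
    obtain i where i: "i < p * C" "fl ?E l = 2 * asked x i + of_bool (bit_at x (asked x i))" using fE[OF l] by blast
    then have "s j = asked x i" using e half[OF j] by (simp add: of_bool_def split: if_splits)
    moreover have "i < C * C" using i(1) pC by linarith
    ultimately show "fl \<sigma>1 j = fl ?E l" using \<sigma>1(2) j ag1[of i] i(2) by simp
  qed
  ultimately have sel1: "\<sigma>1 < min N (\<beta> ^ C)" "certifies N \<beta> K n C F \<sigma>1 \<and> compatible N \<beta> C \<sigma>1 ?E (p * C)"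
    using \<sigma>1(1) pow_min[OF pK(2)] by auto
  define \<sigma> where "\<sigma> = choice N \<beta> K n C F ?E (p * C)"
  have \<sigma>: "certifies N \<beta> K n C F \<sigma>" "compatible N \<beta> C \<sigma> ?E (p * C)"
    unfolding \<sigma>_def choice_def using bleast(1)[of _ _ "\<lambda>\<sigma>. certifies N \<beta> K n C F \<sigma> \<and> compatible N \<beta> C \<sigma> ?E (p * C)", OF sel1] by auto
  have q: "asked x (p * C + r) = fl \<sigma> r div 2" if "r < C" for r
  proof -
    have "r \<le> K" using that pK(2) by linarith
    then have "tr x (p * C + r) div min N (\<beta> ^ r) = ?E" by (simp add: pow_min tr_div)
    then show ?thesis using that by (simp add: asked_def next_query_def \<sigma>_def)
  qed
  have "\<exists>r<C. fl \<sigma> r div 2 \<in> S0 \<and> bit_at z0 (fl \<sigma> r div 2) \<noteq> odd (fl \<sigma> r)"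
  proof (rule ccontr)
    assume no: "\<not> ?thesis"
    \<comment> \<open>Without a conflict, \<open>z0\<close> on \<open>S0\<close> spliced with the
      input coded by \<open>\<sigma>\<close> elsewhere would have both answers.\<close>
    define v where "v = map (\<lambda>i. if i \<in> S0 then z0 ! i else xof \<sigma> ! i) [0..<n]"
    have v: "length v = n" by (simp add: v_def)
    have "consistent \<sigma> v" unfolding consistent_def
    proof (intro allI impI)
      fix j assume j: "j < C"
      have "bit_at (xof \<sigma>) (fl \<sigma> j div 2) = odd (fl \<sigma> j)"
        using \<sigma>(1) j by (simp add: certifies_def agrees_iff consistent_def)
      moreover have "bit_at v i = (if i \<in> S0 then bit_at z0 i else bit_at (xof \<sigma>) i)" for i
        using z0(1) S0(1) by (auto simp: bit_at_def v_def)
      ultimately show "bit_at v (fl \<sigma> j div 2) = odd (fl \<sigma> j)" using no j by auto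
    qed
    then have "v \<in> L" by (rule certifiesD[OF \<sigma>(1) v])
    moreover have "v ! i = z0 ! i" if "i \<in> S0" for i using that S0(1) by (auto simp: v_def)
    ultimately show False using S0(2)[OF v] z0(2) by simp
  qed
  then obtain r where r: "r < C" "fl \<sigma> r div 2 \<in> S0" "bit_at z0 (fl \<sigma> r div 2) \<noteq> odd (fl \<sigma> r)" by blast
  have "asked x (p * C + r) \<notin> asked x ` {..<p * C}"
  proof
    assume "asked x (p * C + r) \<in> asked x ` {..<p * C}"
    then obtain j where j: "j < p * C" "fl \<sigma> r div 2 = asked x j" unfolding q[OF r(1)] by auto
    obtain l where l: "l < p * C" "fl ?E l = 2 * asked x j + of_bool (bit_at x (asked x j))" using fE'[OF j(1)] by blast
    have "fl ?E l div 2 = asked x j" using l(2) by (simp add: of_bool_def)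
    then have "fl \<sigma> r = fl ?E l" using \<sigma>(2) r(1) l(1) j(2) by (simp add: compatible_def)
    then have "odd (fl \<sigma> r) = bit_at x (asked x j)" using l(2) by (simp add: of_bool_def)
    moreover have "j < C * C" using j(1) pC by linarith
    ultimately show False using r(3) j(2) ag0 by simp
  qed
  then show ?thesis using r q by auto
qed

text \<open>Each of the \<open>C\<close> rounds meets a new element of \<open>S0\<close>, which has
  at most \<open>C\<close> of them. In the end all of \<open>S0\<close> has been asked, and
  \<open>z1\<close> agrees with \<open>z0\<close> on a certificate against membership.\<close>

lemma determined:
  assumes z0: "length z0 = n" "z0 \<notin> L" and z1: "length z1 = n" "z1 \<in> L"
    and ag0: "\<And>j. j < C * C \<Longrightarrow> bit_at z0 (asked x j) = bit_at x (asked x j)"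
    and ag1: "\<And>j. j < C * C \<Longrightarrow> bit_at z1 (asked x j) = bit_at x (asked x j)"
  shows False
proof -
  obtain S0 where S0: "S0 \<subseteq> {..<n}" "card S0 \<le> C"
    "\<And>y. length y = n \<Longrightarrow> (\<And>i. i \<in> S0 \<Longrightarrow> y ! i = z0 ! i) \<Longrightarrow> (y \<in> L \<longleftrightarrow> z0 \<in> L)"
    using cert[OF z0(1)] by blast
  have fin: "finite S0" using S0(1) finite_subset by blast
  have "p \<le> card (S0 \<inter> asked x ` {..<p * C})" if "p \<le> C" for p
    using that
  proof (induction p)
    case (Suc p)
    then have "p < C" by simp
    from asked_fresh[OF this z0 z1 ag0 ag1 S0(1,3)] obtain r where r: "r < C" "asked x (p * C + r) \<in> S0"
      "asked x (p * C + r) \<notin> asked x ` {..<p * C}" by blast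
    have "S0 \<inter> asked x ` {..<p * C} \<subset> S0 \<inter> asked x ` {..<Suc p * C}"
    proof (intro psubsetI subsetI)
      fix i assume "i \<in> S0 \<inter> asked x ` {..<p * C}"
      then show "i \<in> S0 \<inter> asked x ` {..<Suc p * C}" by auto
    next
      have "asked x (p * C + r) \<in> S0 \<inter> asked x ` {..<Suc p * C}" using r by auto
      then show "S0 \<inter> asked x ` {..<p * C} \<noteq> S0 \<inter> asked x ` {..<Suc p * C}" using r(3) by blast
    qed
    then have "card (S0 \<inter> asked x ` {..<p * C}) < card (S0 \<inter> asked x ` {..<Suc p * C})"
      using fin by (intro psubset_card_mono) auto
    then show ?case using Suc by simp
  qed simp
  then have "card S0 \<le> card (S0 \<inter> asked x ` {..<C * C})" using S0(2) by (meson order_refl order_trans)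
  then have "S0 \<inter> asked x ` {..<C * C} = S0" using fin by (intro card_seteq) auto
  then have "S0 \<subseteq> asked x ` {..<C * C}" by blast
  have "z1 ! i = z0 ! i" if i: "i \<in> S0" for i
  proof -
    obtain j where "j < C * C" "i = asked x j" using \<open>S0 \<subseteq> asked x ` {..<C * C}\<close> i by auto
    then have "bit_at z1 i = bit_at z0 i" using ag0 ag1 by simp
    moreover have "i < n" using S0(1) i by auto
    ultimately show ?thesis using z0(1) z1(1) by (simp add: bit_at_def)
  qed
  then show False using S0(3)[OF z1(1)] z0(2) z1(2) by simp
qed

text \<open>The transcript without its leading digit codes an input that gives the same replies as
  \<open>x\<close> to all questions, so by \<open>determined\<close> it has the same answer. A leaf
  is evaluated by a single call of \<open>F\<close>.\<close>

theorem decision: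
  assumes x: "length x = n"
  shows "F (tr x (C * C) - \<beta> ^ (C * C)) \<longleftrightarrow> x \<in> L"
proof -
  let ?k = "C * C"
  define e where "e = tr x ?k - \<beta> ^ ?k"
  have k: "?k \<le> K" by (simp add: K)
  have e: "e < \<beta> ^ ?k" using tr_bounds(2)[of x ?k] tr_bounds(1)[of ?k x] by (simp add: e_def)
  have eK: "e < \<beta> ^ K" using less_pow[OF e k] .
  have "bit_at (xof e) (asked x j) = bit_at x (asked x j)" if j: "j < ?k" for j
  proof
    assume "bit_at (xof e) (asked x j)"
    then obtain l where l: "l < K" "fl e l = 2 * asked x j + of_bool True" by (auto simp: bit_at_xof claims_def)
    have lk: "l < ?k" using fl_zero[OF e, of l] l by (cases "l < ?k") auto
    show "bit_at x (asked x j)"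
      using l(2) unfolding e_def fl_minus_leading[OF lk k] fl_tr[OF lk k] field_split by auto
  next
    assume b: "bit_at x (asked x j)"
    define l where "l = ?k - 1 - j"
    have l: "l < ?k" "?k - 1 - l = j" using j by (auto simp: l_def)
    have "fl e l = 2 * asked x j + 1" unfolding e_def fl_minus_leading[OF l(1) k] fl_tr[OF l(1) k] l(2) using b by simp
    moreover have "asked x j < n" using b x by (simp add: bit_at_def)
    ultimately show "bit_at (xof e) (asked x j)" using order.strict_trans2[OF l(1) k] unfolding bit_at_xof claims_def by blast
  qed
  then have "xof e \<in> L \<longleftrightarrow> x \<in> L" using determined[of "xof e" x x] determined[of x "xof e" x] x by auto
  then show ?thesis using F[OF eK] by (simp add: e_def)
qed

end

section \<open>Programs from code fragments\<close>

lemma halted_funpow: "halted P s \<Longrightarrow> (ram_step P x a ^^ t) s = s"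
  by (induction t) (simp_all add: ram_step_def)

lemma ram_run_halted:
  assumes "ram_run P x a n t = s" "halted P s" "t \<le> u"
  shows "ram_run P x a n u = s"
proof -
  have "ram_run P x a n u = (ram_step P x a ^^ (u - t)) (ram_run P x a n t)"
    unfolding ram_run_def 
    by (metis assms(3) comp_apply funpow_add le_add_diff_inverse2)
  then show ?thesis using assms halted_funpow by simp
qed

lemma runs_program:
  assumes "runs x a g t (\<mu>, []) (\<mu>', out)" "\<mu> = (\<lambda>_. 0)(0 := n)" "t \<le> u"
  shows "ram_run (g 0) x a n u = \<lparr>pc = length (g 0), mem = \<mu>', outp = out\<rparr>" "halted (g 0) (ram_run (g 0) x a n u)"
proof -
  have "ram_run (g 0) x a n t = \<lparr>pc = length (g 0), mem = \<mu>', outp = out\<rparr>"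
    using assms(1)[unfolded runs_def, rule_format, of "g 0" 0] code_at_self[of "g 0"] assms(2)
    by (simp add: ram_run_def)
  then show 1: "ram_run (g 0) x a n u = \<lparr>pc = length (g 0), mem = \<mu>', outp = out\<rparr>"
    by (rule ram_run_halted) (use assms(3) in \<open>simp_all add: halted_def\<close>)
  show "halted (g 0) (ram_run (g 0) x a n u)" unfolding 1 by (simp add: halted_def)
qed

lemma computes_program:
  fixes f :: "env \<Rightarrow> nat \<Rightarrow> bool"
  assumes "computes f T"
  shows "\<exists>D. \<forall>x a t. T (x, a) (length x) \<le> t \<longrightarrow> ram_decides D x a t (f (x, a) (length x))"
proof -
  obtain G M where "implements G M f (\<lambda>_ _. []) T" by (rule emitsE[OF assms])
  note G = implementsD[OF this]
  have "ram_decides (G 0 0) x a t (f (x, a) (length x))" if t: "T (x, a) (length x) \<le> t" for x a t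
  proof -
    define \<mu> :: "nat \<Rightarrow> nat" where "\<mu> = (\<lambda>_. 0)(0 := length x)"
    have "holds \<mu> 0 (length x)" by (simp add: \<mu>_def)
    from G[OF this, of x a "[]"] obtain u \<mu>' where u: "u \<le> T (x, a) (length x)"
      "runs x a (G 0) u (\<mu>, []) (\<mu>', [])" "\<mu>' 0 = of_bool (f (x, a) (length x))" by auto
    show ?thesis
      using runs_program[OF u(2) \<mu>_def order_trans[OF u(1) t]] u(3) by (simp add: ram_decides_def)
  qed
  then show ?thesis by blast
qed

section \<open>The number of binary digits\<close>

text \<open>At least 1, also for \<open>n = 0\<close>: the table reserves \<open>bits n\<close>
  positions per transcript, and the answer at a leaf takes one.\<close>

definition bits :: "nat \<Rightarrow> nat" where
  "bits n = Suc (LEAST i. n < 2 ^ Suc i)"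

lemma less_bits: "n < 2 ^ bits n"
proof -
  have "n < 2 ^ Suc n" using less_exp[of n] unfolding power_Suc by linarith
  then show ?thesis unfolding bits_def by (rule LeastI)
qed

lemma bits_pos: "0 < bits n"
  by (simp add: bits_def)

lemma computes_unbig: "computes (\<lambda>_ b. unbig b) (\<lambda>_ _. 0)"
  by (rule computes_reinterpret) (auto simp: enc_simps)

lemma computes_big: "computes (\<lambda>_ b. Big b) (\<lambda>_ _. 0)"
  by (rule computes_reinterpret) (auto simp: enc_simps)

text \<open>The closure properties of \<open>PC\<close> alone would give time polynomial in the
  value of \<open>n\<close>. Typed as \<open>big\<close>, \<open>n\<close> has size 0 and the
  counter governs the cost; the third component runs through the numbers \<open>2 ^ i - 1\<close>
  until it reaches \<open>n\<close>.\<close>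

lemma computes_bits: "\<exists>k. computes (\<lambda>_ n. (Big n, bits n)) (\<lambda>_ n. (bits n + 2) ^ k)"
proof -
  define st where "st p = (fst p, fst (snd p) + 1, Big (unbig (snd (snd p)) + unbig (snd (snd p)) + 1))"
    for p :: "big \<times> nat \<times> big"
  have "PC (\<lambda>_ (p :: big \<times> nat \<times> big). (fst p, fst (snd p) + 1, Big (unbig (Big (unbig (snd (snd p)) + unbig (snd (snd p)))) + unbig (Big 1))))"
    by (intro PC_intros)
  then have "PC (\<lambda>_. st)" by (simp add: st_def[abs_def])
  then obtain T kT where T: "computes (\<lambda>_. st) T" and kT: "\<And>e c. T e c \<le> (sz c + 2) ^ kT"
    unfolding PC_def poly_bounded_def by blast
  have "PC (\<lambda>_ (p :: big \<times> nat \<times> big). Big (unbig (fst p) - unbig (snd (snd p))))" by (intro PC_intros)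
  then obtain R0 kR where R0: "computes (\<lambda>_ (p :: big \<times> nat \<times> big). Big (unbig (fst p) - unbig (snd (snd p)))) R0"
    and kR: "\<And>e c. R0 e c \<le> (sz c + 2) ^ kR"
    unfolding PC_def poly_bounded_def by blast
  have R: "computes (\<lambda>_ (p :: big \<times> nat \<times> big). unbig (fst p) - unbig (snd (snd p))) R0"
    using computes_comp[OF R0 computes_unbig, of R0] by simp
  have st_it: "(st ^^ i) (N, w, p) = (N, w + i, Big ((unbig p + 1) * 2 ^ i - 1))" for i N w p
  proof (induction i)
    case (Suc i)
    have "0 < (unbig p + 1) * 2 ^ i" by simp
    then have "(unbig p + 1) * 2 ^ i - 1 + ((unbig p + 1) * 2 ^ i - 1) + 1 = (unbig p + 1) * 2 ^ Suc i - 1"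
      unfolding power_Suc by linarith
    then show ?case using Suc by (simp add: st_def del: power_Suc)
  qed simp
  define m where "m p = (LEAST i. unbig (fst p) \<le> (unbig (snd (snd p)) + 1) * 2 ^ i - 1)" for p :: "big \<times> nat \<times> big"
  have ex: "\<exists>i. unbig (fst p) \<le> (unbig (snd (snd p)) + 1) * 2 ^ i - 1" for p :: "big \<times> nat \<times> big"
  proof (intro exI)
    have "unbig (fst p) < 2 ^ unbig (fst p)" by (rule less_exp)
    also have "\<dots> \<le> (unbig (snd (snd p)) + 1) * 2 ^ unbig (fst p)" by simp
    finally show "unbig (fst p) \<le> (unbig (snd (snd p)) + 1) * 2 ^ unbig (fst p) - 1" by linarith
  qed
  define V where "V e p = (\<Sum>i<m p. R0 e ((st ^^ i) p) + T e ((st ^^ i) p) + 2 * width TYPE(big \<times> nat \<times> big) + 2)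
         + R0 e ((st ^^ m p) p) + 2 * width TYPE(big \<times> nat \<times> big) + 1" for e p
  have W: "computes (\<lambda>_ p. (st ^^ m p) p) V"
  proof (rule emits_mono[OF emits_while[where m = "\<lambda>_. m" and U = V, OF R T]])
    fix e :: env and c :: "big \<times> nat \<times> big" and i
    obtain N w p where c: "c = (N, w, p)" by (cases c)
    show "unbig (fst ((st ^^ m c) c)) - unbig (snd (snd ((st ^^ m c) c))) = 0"
      using LeastI_ex[OF ex[of c]] by (simp add: m_def c st_it)
    assume "i < m c"
    from not_less_Least[OF this[unfolded m_def]]
    show "unbig (fst ((st ^^ i) c)) - unbig (snd (snd ((st ^^ i) c))) \<noteq> 0" by (simp add: c st_it)
  qed (auto simp: V_def)
  define ini where "ini n = (Big n, 1::nat, Big 1)" for n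
  have mi: "Suc (m (ini n)) = bits n" for n
  proof -
    have "(n \<le> (1 + 1) * 2 ^ i - 1) = (n < 2 ^ Suc i)" for i :: nat
    proof -
      have "0 < (2::nat) ^ i" by simp
      then show ?thesis unfolding power_Suc one_add_one by linarith
    qed
    then show ?thesis by (simp only: m_def ini_def bits_def fst_conv snd_conv big.sel)
  qed
  obtain T0 where T0: "computes (\<lambda>_. ini) T0" "\<exists>k. \<forall>e n. T0 e n \<le> k"
  proof -
    have c: "computes (\<lambda>_ n. Big n) (\<lambda>_ _. 0)" by (rule computes_big)
    have k: "computes (\<lambda>_ (n::nat). (1::nat, Big 1)) (\<lambda>_ _. 1 + 1 + 4 * width TYPE(nat) + 2 * width TYPE(nat) + 2 * width TYPE(big))"
      by (rule computes_pair) (rule computes_const, simp)+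
    show thesis by (rule that[of "\<lambda>_ _. 20"], rule emits_mono[OF computes_pair[OF c k]]) (auto simp: ini_def)
  qed
  obtain k0 where k0: "\<And>e n. T0 e n \<le> k0" using T0(2) by blast
  have run: "(st ^^ i) (ini n) = (Big n, 1 + i, Big (2 * 2 ^ i - 1))" for i n
    unfolding ini_def st_it by simp
  have fin: "computes (\<lambda>_ (p :: big \<times> nat \<times> big). (fst p, fst (snd p))) (\<lambda>_ _. 0)"
    by (rule computes_reinterpret) (auto simp: enc_simps)
  define B where "B b = b * ((b + 2) ^ kR + (b + 2) ^ kT + 8) + (b + 2) ^ kR + 7" for b :: nat
  have VB: "V e (ini n) \<le> B (bits n)" for e n
  proof -
    have R': "R0 e ((st ^^ i) (ini n)) \<le> (bits n + 2) ^ kR" if "i \<le> m (ini n)" for i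
      by (rule order_trans[OF kR]) (rule power_mono, use that mi[of n] in \<open>auto simp: run\<close>)
    have T': "T e ((st ^^ i) (ini n)) \<le> (bits n + 2) ^ kT" if "i \<le> m (ini n)" for i
      by (rule order_trans[OF kT]) (rule power_mono, use that mi[of n] in \<open>auto simp: run\<close>)
    have "(\<Sum>i<m (ini n). R0 e ((st ^^ i) (ini n)) + T e ((st ^^ i) (ini n)) + 2 * width TYPE(big \<times> nat \<times> big) + 2)
      \<le> (\<Sum>i<m (ini n). (bits n + 2) ^ kR + (bits n + 2) ^ kT + 8)"
      by (rule sum_mono) (use R' T' in \<open>auto intro!: add_mono\<close>)
    also have "\<dots> \<le> bits n * ((bits n + 2) ^ kR + (bits n + 2) ^ kT + 8)" using mi[of n] by simp
    finally show ?thesis using R'[of "m (ini n)"] unfolding V_def B_def by simp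
  qed
  have comp: "computes (\<lambda>_ n. (fst ((st ^^ m (ini n)) (ini n)), fst (snd ((st ^^ m (ini n)) (ini n))))) (\<lambda>_ n. k0 + B (bits n))"
    by (rule computes_comp[OF computes_comp[OF T0(1) W, of "\<lambda>_ n. k0 + B (bits n)"] fin])
      (use k0 VB in \<open>auto intro: add_mono\<close>)
  have "poly_bounded (\<lambda>_ (b::nat). k0 + B b)" unfolding B_def
    by (intro poly_bounded_add poly_bounded_mult poly_bounded_power poly_bounded_const poly_bounded_mono[OF poly_bounded_sz])
      (simp_all)
  then obtain k where k: "\<And>b::nat. k0 + B b \<le> (b + 2) ^ k" unfolding poly_bounded_def by auto
  have "computes (\<lambda>_ n. (Big n, bits n)) (\<lambda>_ n. (bits n + 2) ^ k)"
    by (rule emits_mono[OF comp k]) (auto simp: run mi[symmetric])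
  then show ?thesis by blast
qed

section \<open>The deciding machine\<close>

definition stored_index :: "bool list \<Rightarrow> nat \<Rightarrow> nat \<Rightarrow> nat" where
  "stored_index a w E = rec_nat 0 (\<lambda>b s. s + s + of_bool (bit_at a (w * E + b))) w"

text \<open>The recursion of \<open>tr\<close>, with the next query looked up in the table instead
  of computed.\<close>

definition descend :: "bool list \<Rightarrow> bool list \<Rightarrow> nat \<Rightarrow> nat \<Rightarrow> nat" where
  "descend x a w d = rec_nat 1 (\<lambda>_ E. E * 2 ^ (w + 1) +
     (2 * stored_index a w E + of_bool (bit_at x (stored_index a w E)))) d"

lemma Big_rec_nat: "Big (rec_nat s f n) = rec_nat (Big s) (\<lambda>i b. Big (f i (unbig b))) n"
  by (induction n) (simp, metis big.sel nat.rec(2))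

text \<open>A state of type \<open>big\<close> has size 0, so the bound on intermediate values
  demanded by \<open>PC_rec'\<close> is trivial: the rounds count, not the growth of the
  numbers.\<close>

lemma PC_big_rec:
  assumes "PC (\<lambda>e p. h e (fst p) (fst (snd p)) (snd (snd p)))" "PC g" "PC s0"
  shows "PC (\<lambda>e c. rec_nat (s0 e c) (h e c) (g e c) :: big)"
  by (rule PC_rec'[OF assms poly_bounded_const[of 0]]) simp

lemma PC_scale:
  assumes "PC g" "PC E"
  shows "PC (\<lambda>e c. Big (g e c * unbig (E e c)))"
proof -
  have "PC (\<lambda>e c. rec_nat (Big 0) (\<lambda>_ s. Big (unbig s + unbig (E e c))) (g e c))"
    by (rule PC_big_rec) (intro PC_intros PC_comp[OF PC_fst[OF PC_id] assms(2)] assms)+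
  moreover have "rec_nat (Big 0) (\<lambda>_ s. Big (unbig s + E)) k = Big (k * E)" for k E
    by (induction k) auto
  ultimately show ?thesis by simp
qed

lemma PC_shift:
  assumes "PC g" "PC E"
  shows "PC (\<lambda>e c. Big (unbig (E e c) * 2 ^ g e c))"
proof -
  have "PC (\<lambda>e c. rec_nat (E e c) (\<lambda>_ s. Big (unbig s + unbig s)) (g e c))"
    by (rule PC_big_rec) (intro PC_intros assms)+
  moreover have "rec_nat E (\<lambda>_ s. Big (unbig s + unbig s)) k = Big (unbig E * 2 ^ k)" for k E
    by (induction k) auto
  ultimately show ?thesis by simp
qed

lemma PC_stored_index:
  assumes "PC g" "PC E"
  shows "PC (\<lambda>e c. Big (stored_index (snd e) (g e c) (unbig (E e c))))"
proof -
  have "PC (\<lambda>e c. rec_nat (Big 0) (\<lambda>b s. Big (unbig (Big (unbig s + unbig s)) +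
      unbig (Big (of_bool (bit_at (snd e) (unbig (Big (unbig (Big (g e c * unbig (E e c))) + unbig (Big b))))))))) (g e c))"
    by (rule PC_big_rec) (intro PC_big_add PC_snd PC_fst PC_id PC_big_of_bool PC_read_pre PC_Big assms PC_const_big
        PC_comp[OF PC_fst[OF PC_id] PC_scale[OF assms]])+
  then show ?thesis unfolding stored_index_def Big_rec_nat by simp
qed

lemma PC_descend:
  assumes "PC g" "PC d"
  shows "PC (\<lambda>e c. Big (descend (fst e) (snd e) (g e c) (d e c)))"
proof -
  have 1: "PC (\<lambda>e p. Big (stored_index (snd e) (g e (fst p)) (unbig (snd (snd p)))))"
    by (intro PC_stored_index PC_snd PC_id PC_comp[OF PC_fst[OF PC_id] assms(1)])
  have 2: "PC (\<lambda>e p. Big (unbig (snd (snd p)) * 2 ^ (g e (fst p) + 1)))"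
    by (intro PC_shift PC_snd PC_id PC_add PC_const_nat PC_comp[OF PC_fst[OF PC_id] assms(1)])
  have "PC (\<lambda>e c. rec_nat (Big 1) (\<lambda>b s. Big (unbig (Big (unbig s * 2 ^ (g e c + 1))) +
      unbig (Big (unbig (Big (unbig (Big (stored_index (snd e) (g e c) (unbig s))) + unbig (Big (stored_index (snd e) (g e c) (unbig s))))) + unbig (Big (of_bool (bit_at (fst e) (unbig (Big (stored_index (snd e) (g e c) (unbig s)))))))))))
      (d e c))"
    by (rule PC_big_rec) (intro PC_big_add PC_big_of_bool PC_read_input 1 2 assms PC_const_big)+
  then show ?thesis unfolding descend_def Big_rec_nat by (simp add: mult_2)
qed

text \<open>The input length enters as \<open>Big n\<close>, so the time is polynomial in
  \<open>bits n\<close> although the positions probed are far larger numbers.\<close>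

lemma deciding_machine:
  assumes "PC (\<lambda>_. d :: nat \<Rightarrow> nat)"
  shows "\<exists>D k. \<forall>x a. ram_decides D x a ((bits (length x) + 2) ^ k)
     (bit_at a (bits (length x) * descend x a (bits (length x)) (d (bits (length x)))))"
proof -
  have "PC (\<lambda>e p :: big \<times> nat. Big (descend (fst e) (snd e) (snd p) (d (snd p))))"
    by (intro PC_descend PC_snd PC_id PC_app[OF assms])
  then have "PC (\<lambda>e p :: big \<times> nat. Big (snd p * unbig (Big (descend (fst e) (snd e) (snd p) (d (snd p))))))"
    by (intro PC_scale PC_snd PC_id)
  from PC_read_pre[OF this]
  have P: "PC (\<lambda>e p :: big \<times> nat. bit_at (snd e) (snd p * descend (fst e) (snd e) (snd p) (d (snd p))))" by simp
  then obtain T k where T: "computes (\<lambda>e p :: big \<times> nat. bit_at (snd e) (snd p * descend (fst e) (snd e) (snd p) (d (snd p)))) T"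
    and k: "\<And>e c. T e c \<le> (sz c + 2) ^ k"
    unfolding PC_def poly_bounded_def by blast
  obtain k' where k': "computes (\<lambda>_ n. (Big n, bits n)) (\<lambda>_ n. (bits n + 2) ^ k')" using computes_bits by blast
  have b: "(bits n + 2) ^ k' + T e (Big n, bits n) \<le> (bits n + 2) ^ Suc (max k k')" for e n
  proof -
    have "(bits n + 2) ^ k' \<le> (bits n + 2) ^ max k k'" by (rule power_increasing) auto
    moreover have "T e (Big n, bits n) \<le> (bits n + 2) ^ max k k'"
      by (rule order_trans[OF k]) (auto intro: power_increasing)
    moreover have "2 * (bits n + 2) ^ max k k' \<le> (bits n + 2) ^ Suc (max k k')" by simp
    ultimately show ?thesis by linarith
  qed
  have "computes (\<lambda>e n. bit_at (snd e) (bits n * descend (fst e) (snd e) (bits n) (d (bits n)))) (\<lambda>_ n. (bits n + 2) ^ Suc (max k k'))"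
    using computes_comp[OF k' T b] by simp
  from computes_program[OF this] obtain D where "\<And>x a t. (bits (length x) + 2) ^ Suc (max k k') \<le> t \<Longrightarrow>
     ram_decides D x a t (bit_at a (bits (length x) * descend x a (bits (length x)) (d (bits (length x)))))"
    by (auto simp del: power_Suc)
  then show ?thesis by (intro exI[of _ D] exI[of _ "Suc (max k k')"]) (simp del: power_Suc)
qed

text \<open>Horner's scheme from the most significant bit: after \<open>b\<close> bits the
  accumulator is \<open>q div 2 ^ (w - b)\<close>.\<close>

lemma stored_index_eq:
  assumes "\<And>b. b < w \<Longrightarrow> bit_at a (w * E + b) = odd (q div 2 ^ (w - 1 - b))" "q < 2 ^ w"
  shows "stored_index a w E = q"
proof -
  have "rec_nat 0 (\<lambda>b s. s + s + of_bool (bit_at a (w * E + b))) b = q div 2 ^ (w - b)" if "b \<le> w" for b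
    using that
  proof (induction b)
    case 0
    then show ?case using assms(2) by simp
  next
    case (Suc b)
    have e: "w - b = Suc (w - Suc b)" "w - 1 - b = w - Suc b" using Suc.prems by auto
    define u where "u = q div 2 ^ (w - Suc b)"
    have "q div 2 ^ (w - b) = u div 2" unfolding e u_def power_Suc2 div_mult2_eq ..
    then have "rec_nat 0 (\<lambda>b s. s + s + of_bool (bit_at a (w * E + b))) (Suc b) = u div 2 + u div 2 + of_bool (odd u)"
      using Suc assms(1)[of b] unfolding e by (simp add: u_def)
    also have "\<dots> = u" by (cases "even u") (auto elim!: evenE oddE)
    finally show ?case by (simp add: u_def)
  qed
  from this[of w] show ?thesis by (simp add: stored_index_def)
qed

section \<open>Path sums\<close>

type_synonym ('q, 's) action = "'q \<times> 's \<times> 's \<times> move \<times> move"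

definition idle :: "('q, 's) qtm \<Rightarrow> ('q, 's) conf \<Rightarrow> bool" where
  "idle M c \<longleftrightarrow> final_conf M c \<or> state c = prequery M"

definition scanned :: "('q, 's) conf \<Rightarrow> 'q \<times> 's \<times> 's" where
  "scanned c = (state c, work c (whead c), query c (qhead c))"

text \<open>
  A digit \<open>4 * j + u\<close> of a path selects the \<open>j\<close>-th local transition and the \<open>u\<close>-th of the four
  nonnegative parts of its amplitude \<open>(r\<^sub>0 - r\<^sub>1) + \<i> (r\<^sub>2 - r\<^sub>3)\<close>.  Final configurations are frozen, and
  where there is nothing to select, only the digit 0 has a nonzero weight.
\<close>

definition path_step :: "('q, 's) qtm \<Rightarrow> (nat \<Rightarrow> ('q, 's) action) \<Rightarrow> bool list \<Rightarrow> ('q, 's) conf \<Rightarrow> nat \<Rightarrow> ('q, 's) conf" where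
  "path_step M act x c d = (if final_conf M c then c else if state c = prequery M then query_step M x c
     else local_step (act (d div 4)) c)"

definition part :: "nat \<Rightarrow> complex \<Rightarrow> real" where
  "part u z = max 0 (if u = 0 then Re z else if u = 1 then - Re z else if u = 2 then Im z else - Im z)"

text \<open>The four parts carry the factors 1, -1, i and -i, that is, the powers 0, 2, 1 and 3 of
  i.\<close>

definition phase :: "nat \<Rightarrow> nat" where
  "phase u = (if u = 1 then 2 else if u = 2 then 1 else u)"

definition weight :: "('q, 's) qtm \<Rightarrow> (nat \<Rightarrow> ('q, 's) action) \<Rightarrow> ('q, 's) conf \<Rightarrow> nat \<Rightarrow> real" where
  "weight M act c d = (if idle M c then of_bool (d = 0) else part (d mod 4) (delta M (scanned c) (act (d div 4))))"

fun path :: "('q, 's) qtm \<Rightarrow> (nat \<Rightarrow> ('q, 's) action) \<Rightarrow> bool list \<Rightarrow> nat \<Rightarrow> nat \<Rightarrow> nat \<Rightarrow> ('q, 's) conf" where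
  "path M act x D p 0 = init_conf M (length x)"
| "path M act x D p (Suc j) = path_step M act x (path M act x D p j) (p div D ^ j mod D)"

text \<open>Polymorphic, to serve both for the exact real weights and for their scaled natural
  approximations.\<close>

definition path_weight :: "('c \<Rightarrow> nat \<Rightarrow> 'r::comm_semiring_1) \<Rightarrow> (nat \<Rightarrow> nat \<Rightarrow> 'c) \<Rightarrow> nat \<Rightarrow> nat \<Rightarrow> nat \<Rightarrow> 'r" where
  "path_weight W P D p t = (\<Prod>j<t. W (P p j) (p div D ^ j mod D))"

definition path_phase :: "nat \<Rightarrow> nat \<Rightarrow> nat \<Rightarrow> nat" where
  "path_phase D p t = (\<Sum>j<t. phase (p div D ^ j mod D mod 4))"

lemma parts_sum: "(\<Sum>u<4. complex_of_real (part u z) * \<i> ^ phase u) = z"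
proof -
  have "{..<4} = {0, 1, 2, 3::nat}" by auto
  then show ?thesis by (auto simp: part_def phase_def complex_eq_iff max_def eval_nat_numeral)
qed

lemma sum_less_mult: "(\<Sum>i<(a::nat) * b. f i) = (\<Sum>j<a. \<Sum>u<b. f (j * b + u))"
proof -
  have s: "sum f {j * b..<j * b + b} = (\<Sum>u<b. f (j * b + u))" for j
    using sum.shift_bounds_nat_ivl[of f 0 "j * b" b] by (simp add: atLeast0LessThan add.commute)
  have "(\<Sum>i<a * b. f i) = (\<Sum>j<a. sum f {j * b..<j * b + b})" by (rule sum.nat_group[symmetric])
  then show ?thesis unfolding s .
qed

lemma digit_shift:
  assumes "p < D ^ t" "d < (D::nat)"
  shows "j < t \<Longrightarrow> (d * D ^ t + p) div D ^ j mod D = p div D ^ j mod D"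
    and "(d * D ^ t + p) div D ^ t mod D = d"
proof -
  assume j: "j < t"
  have D: "D ^ j \<noteq> 0" using assms by auto
  have "D ^ t = D ^ (t - Suc j) * D * D ^ j"
    using j by (metis Suc_diff_Suc add.commute le_add_diff_inverse less_imp_le power_Suc2 power_add)
  then have e: "d * D ^ t + p = (d * D ^ (t - Suc j) * D) * D ^ j + p" by (simp only: mult.assoc)
  have "(d * D ^ t + p) div D ^ j = d * D ^ (t - Suc j) * D + p div D ^ j"
    unfolding e using D by (rule div_mult_self3)
  then show "(d * D ^ t + p) div D ^ j mod D = p div D ^ j mod D" by simp
next
  have "(d * D ^ t + p) div D ^ t = d" using assms by (simp add: div_mult_self3 add.commute)
  then show "(d * D ^ t + p) div D ^ t mod D = d" using assms by simp
qed

lemma path_cong: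
  "(\<And>j. j < t \<Longrightarrow> p div D ^ j mod D = p' div D ^ j mod D) \<Longrightarrow> path M act x D p t = path M act x D p' t"
  by (induction t) auto

locale paths =
  fixes M :: "('q::finite, 's::finite) qtm" and act :: "nat \<Rightarrow> ('q, 's) action" and nY D :: nat
  assumes act: "bij_betw act {..<nY} UNIV" and D: "D = nY * 4" and wf: "well_formed M"
begin

lemma D_pos: "0 < D"
proof -
  have "{..<nY} \<noteq> {}" using act by (auto simp: bij_betw_def)
  then show ?thesis by (auto simp: D)
qed

text \<open>With final configurations absorbing, all inputs of one length can be run for the same
  number of steps, whatever their halting times.\<close>

definition frozen :: "bool list \<Rightarrow> ('q, 's) conf \<Rightarrow> ('q, 's) conf \<Rightarrow> complex" where
  "frozen x c c' = (if final_conf M c then of_bool (c' = c) else amplitude M x c c')"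

lemma frozen_digits:
  "frozen x c c' = (\<Sum>d<D. of_bool (path_step M act x c d = c') * (complex_of_real (weight M act c d) * \<i> ^ phase (d mod 4)))"
proof (cases "idle M c")
  case True
  have "(\<Sum>d<D. of_bool (path_step M act x c d = c') * (complex_of_real (weight M act c d) * \<i> ^ phase (d mod 4))) =
    (\<Sum>d\<in>{0}. of_bool (path_step M act x c d = c') * (complex_of_real (weight M act c d) * \<i> ^ phase (d mod 4)))"
    by (rule sum.mono_neutral_right) (use True D_pos in \<open>auto simp: weight_def\<close>)
  also have "\<dots> = of_bool (path_step M act x c 0 = c')" using True by (simp add: weight_def phase_def)
  also have "\<dots> = frozen x c c'"
    using True wf by (auto simp: frozen_def path_step_def idle_def amplitude_def)
  finally show ?thesis by simp
next
  case False
  let ?g = "\<lambda>y. of_bool (local_step y c = c') * delta M (scanned c) y"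
  have "(\<Sum>d<D. of_bool (path_step M act x c d = c') * (complex_of_real (weight M act c d) * \<i> ^ phase (d mod 4))) =
    (\<Sum>j<nY. \<Sum>u<4. of_bool (local_step (act j) c = c') * (complex_of_real (part u (delta M (scanned c) (act j))) * \<i> ^ phase u))"
    unfolding D sum_less_mult
    by (intro sum.cong refl) (use False in \<open>auto simp: path_step_def weight_def idle_def\<close>)
  also have "\<dots> = (\<Sum>j<nY. ?g (act j))"
    by (simp only: sum_distrib_left[symmetric] parts_sum)
  also have "\<dots> = (\<Sum>y\<in>UNIV. ?g y)" by (rule sum.reindex_bij_betw[OF act])
  also have "\<dots> = (\<Sum>y | local_step y c = c'. delta M (scanned c) y)"
    by (rule sum.mono_neutral_cong_right) auto
  also have "\<dots> = frozen x c c'" using False by (simp add: frozen_def amplitude_def idle_def scanned_def)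
  finally show ?thesis by simp
qed

definition contribution :: "bool list \<Rightarrow> nat \<Rightarrow> nat \<Rightarrow> complex" where
  "contribution x p t = complex_of_real (path_weight (weight M act) (path M act x D) D p t) * \<i> ^ path_phase D p t"

text \<open>The next step is added as the most significant digit, so path, weight and phase of the
  earlier steps stay as they are.\<close>

lemma contribution_shift:
  assumes "p < D ^ t" "d < D"
  shows "path M act x D (d * D ^ t + p) (Suc t) = path_step M act x (path M act x D p t) d"
    and "contribution x (d * D ^ t + p) (Suc t) =
      contribution x p t * (complex_of_real (weight M act (path M act x D p t) d) * \<i> ^ phase (d mod 4))"
proof -
  have c: "path M act x D (d * D ^ t + p) j = path M act x D p j" if "j \<le> t" for j
    by (rule path_cong) (use digit_shift(1)[OF assms] that in auto)
  show "path M act x D (d * D ^ t + p) (Suc t) = path_step M act x (path M act x D p t) d"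
    using c[of t] digit_shift(2)[OF assms] by simp
  have w: "path_weight (weight M act) (path M act x D) D (d * D ^ t + p) t = path_weight (weight M act) (path M act x D) D p t"
    unfolding path_weight_def by (rule prod.cong) (use c digit_shift(1)[OF assms] in auto)
  have p: "path_phase D (d * D ^ t + p) t = path_phase D p t"
    unfolding path_phase_def by (rule sum.cong) (use digit_shift(1)[OF assms] in auto)
  show "contribution x (d * D ^ t + p) (Suc t) =
      contribution x p t * (complex_of_real (weight M act (path M act x D p t) d) * \<i> ^ phase (d mod 4))"
    using w p c[of t] digit_shift(2)[OF assms]
    by (simp add: contribution_def path_weight_def path_phase_def power_add mult_ac)
qed

text \<open>Freezing changes nothing before time \<open>tx\<close>, when no final configuration
  carries amplitude, and everything afterwards, when only final ones do; hence the time
  \<open>min t tx\<close> on the left.\<close>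

lemma path_sum:
  assumes h: "halts_at M x tx"
  shows "qrun M x (min t tx) c = (\<Sum>p<D ^ t. of_bool (path M act x D p t = c) * contribution x p t)"
proof (induction t arbitrary: c)
  case 0
  then show ?case by (simp add: qrun_def contribution_def path_weight_def path_phase_def eq_commute)
next
  case (Suc t)
  let ?\<phi> = "qrun M x (min t tx)"
  define A where "A = (\<lambda>p. path M act x D p t) ` {..<D ^ t}"
  have finA: "finite A" by (simp add: A_def)
  have supp: "supp ?\<phi> \<subseteq> A"
  proof
    fix c assume "c \<in> supp ?\<phi>"
    then have "(\<Sum>p<D ^ t. of_bool (path M act x D p t = c) * contribution x p t) \<noteq> 0"
      by (simp add: supp_def flip: Suc.IH)
    then obtain p where "p \<in> {..<D ^ t}" "of_bool (path M act x D p t = c) * contribution x p t \<noteq> 0"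
      by (rule sum.not_neutral_contains_not_neutral)
    then show "c \<in> A" by (auto simp: A_def split: if_splits)
  qed
  have step: "qrun M x (min (Suc t) tx) c = (\<Sum>d\<in>A. ?\<phi> d * frozen x d c)"
  proof (cases "t < tx")
    case True
    have "qrun M x (min (Suc t) tx) c = (\<Sum>d\<in>A. ?\<phi> d * amplitude M x d c)"
      using True evolve_eq[OF finA supp] by (simp add: min_def qrun_Suc)
    also have "\<dots> = (\<Sum>d\<in>A. ?\<phi> d * frozen x d c)"
    proof (rule sum.cong)
      fix d
      have "\<not> final_conf M d" if "?\<phi> d \<noteq> 0" using h that True by (auto simp: halts_at_def supp_def)
      then show "?\<phi> d * amplitude M x d c = ?\<phi> d * frozen x d c" by (auto simp: frozen_def)
    qed simp
    finally show ?thesis .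
  next
    case False
    then have m: "min t tx = tx" "min (Suc t) tx = tx" by simp_all
    have "(\<Sum>d\<in>A. ?\<phi> d * frozen x d c) = (\<Sum>d\<in>A. if d = c then ?\<phi> d else 0)"
    proof (rule sum.cong)
      fix d
      have "final_conf M d" if "?\<phi> d \<noteq> 0" using h that m by (auto simp: halts_at_def supp_def)
      then show "?\<phi> d * frozen x d c = (if d = c then ?\<phi> d else 0)" by (auto simp: frozen_def)
    qed simp
    also have "\<dots> = ?\<phi> c" using supp finA by (auto simp: supp_def)
    finally show ?thesis using m by simp
  qed
  have D0: "0 < D ^ t" using D_pos by simp
  have "qrun M x (min (Suc t) tx) c = (\<Sum>d\<in>A. \<Sum>p<D ^ t. of_bool (path M act x D p t = d) * contribution x p t * frozen x d c)"
    unfolding step by (simp only: Suc.IH sum_distrib_right)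
  also have "\<dots> = (\<Sum>p<D ^ t. \<Sum>d\<in>A. of_bool (path M act x D p t = d) * contribution x p t * frozen x d c)"
    by (rule sum.swap)
  also have "\<dots> = (\<Sum>p<D ^ t. contribution x p t * frozen x (path M act x D p t) c)"
  proof (rule sum.cong)
    fix p assume "p \<in> {..<D ^ t}"
    then have "path M act x D p t \<in> A" by (simp add: A_def)
    moreover have "(\<Sum>d\<in>A. of_bool (path M act x D p t = d) * contribution x p t * frozen x d c) =
      (\<Sum>d\<in>A. if d = path M act x D p t then contribution x p t * frozen x (path M act x D p t) c else 0)"
      by (rule sum.cong) auto
    ultimately show "(\<Sum>d\<in>A. of_bool (path M act x D p t = d) * contribution x p t * frozen x d c) =
      contribution x p t * frozen x (path M act x D p t) c" using finA by simp
  qed simp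
  also have "\<dots> = (\<Sum>p<D ^ t. \<Sum>d<D. of_bool (path M act x D (d * D ^ t + p) (Suc t) = c) * contribution x (d * D ^ t + p) (Suc t))"
    unfolding frozen_digits sum_distrib_left
    by (intro sum.cong refl) (simp only: contribution_shift lessThan_iff mult.left_commute)
  also have "\<dots> = (\<Sum>d<D. \<Sum>p<D ^ t. of_bool (path M act x D (d * D ^ t + p) (Suc t) = c) * contribution x (d * D ^ t + p) (Suc t))"
    by (rule sum.swap)
  also have "\<dots> = (\<Sum>p<D ^ Suc t. of_bool (path M act x D p (Suc t) = c) * contribution x p (Suc t))"
    unfolding power_Suc sum_less_mult ..
  finally show ?case .
qed

section \<open>The acceptance probability as a sum over pairs of paths\<close>

definition sgn4 :: "nat \<Rightarrow> nat \<Rightarrow> real" where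
  "sgn4 a b = (if a mod 4 = b mod 4 then 1 else if a mod 4 = (b + 2) mod 4 then - 1 else 0)"

lemma i_power_mod: "\<i> ^ a = \<i> ^ (a mod 4)"
proof -
  have "\<i> ^ a = \<i> ^ (4 * (a div 4) + a mod 4)" by simp
  also have "\<dots> = (\<i> ^ 4) ^ (a div 4) * \<i> ^ (a mod 4)" by (simp only: power_add power_mult)
  also have "\<i> ^ 4 = 1" by (simp add: eval_nat_numeral)
  finally show ?thesis by simp
qed

lemma Re_i_powers: "Re (\<i> ^ a * cnj (\<i> ^ b)) = sgn4 a b"
proof -
  have small: "Re (\<i> ^ u * cnj (\<i> ^ v)) = sgn4 u v" if "u = 0 \<or> u = 1 \<or> u = 2 \<or> u = 3" "v = 0 \<or> v = 1 \<or> v = 2 \<or> v = 3" for u v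
    using that by (elim disjE) (simp_all add: sgn4_def power3_eq_cube)
  have r: "u mod 4 = 0 \<or> u mod 4 = 1 \<or> u mod 4 = 2 \<or> u mod 4 = 3" for u :: nat by linarith
  have "sgn4 a b = sgn4 (a mod 4) (b mod 4)" by (simp add: sgn4_def mod_simps)
  also have "\<dots> = Re (\<i> ^ (a mod 4) * cnj (\<i> ^ (b mod 4)))" by (rule small[symmetric]) (rule r)+
  finally show ?thesis by (simp only: i_power_mod[of a, symmetric] i_power_mod[of b, symmetric])
qed

definition meets :: "bool list \<Rightarrow> nat \<Rightarrow> nat \<Rightarrow> nat \<Rightarrow> bool" where
  "meets x t p p' \<longleftrightarrow> path M act x D p t = path M act x D p' t \<and> state (path M act x D p t) = acc M"

text \<open>Expanding the squared modulus of a path sum gives pairs of paths with a common endpoint.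
  The product of their phases is a power of i, of which the real part 1, -1 or 0 survives; what
  remains are nonnegative weights and signs.\<close>

lemma prob_accept:
  assumes h: "halts_at M x tx" and t: "tx \<le> t"
  shows "prob_state M x tx (acc M) = (\<Sum>p<D ^ t. \<Sum>p'<D ^ t. of_bool (meets x t p p') *
     (path_weight (weight M act) (path M act x D) D p t * path_weight (weight M act) (path M act x D) D p' t *
       sgn4 (path_phase D p t) (path_phase D p' t)))"
proof -
  let ?\<phi> = "qrun M x tx"
  have ps: "?\<phi> c = (\<Sum>p<D ^ t. of_bool (path M act x D p t = c) * contribution x p t)" for c
    using path_sum[OF h, of t c] min_absorb2[OF t] by simp
  define A where "A = {c \<in> (\<lambda>p. path M act x D p t) ` {..<D ^ t}. state c = acc M}"
  have finA: "finite A" by (simp add: A_def)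
  have "c \<in> A" if c: "c \<in> supp ?\<phi>" "state c = acc M" for c
  proof -
    have "(\<Sum>p<D ^ t. of_bool (path M act x D p t = c) * contribution x p t) \<noteq> 0"
      using c by (simp add: supp_def flip: ps)
    then obtain p where "p \<in> {..<D ^ t}" "of_bool (path M act x D p t = c) * contribution x p t \<noteq> 0"
      by (rule sum.not_neutral_contains_not_neutral)
    then show "c \<in> A" using c by (auto simp: A_def split: if_splits)
  qed
  then have "prob_state M x tx (acc M) = (\<Sum>c\<in>A. (cmod (?\<phi> c))\<^sup>2)"
    unfolding prob_state_def by (intro sum.mono_neutral_left finA) (auto simp: A_def supp_def)
  also have "complex_of_real \<dots> = (\<Sum>c\<in>A. ?\<phi> c * cnj (?\<phi> c))"
    by (simp only: of_real_sum complex_norm_square)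
  also have "\<dots> = (\<Sum>c\<in>A. \<Sum>p<D ^ t. \<Sum>p'<D ^ t. of_bool (path M act x D p t = c) * contribution x p t *
      (of_bool (path M act x D p' t = c) * cnj (contribution x p' t)))"
    unfolding ps cnj_sum sum_product by (intro sum.cong refl) simp
  also have "\<dots> = (\<Sum>p<D ^ t. \<Sum>p'<D ^ t. \<Sum>c\<in>A. of_bool (path M act x D p t = c) * contribution x p t *
      (of_bool (path M act x D p' t = c) * cnj (contribution x p' t)))"
    by (subst sum.swap, intro sum.cong refl, rule sum.swap)
  also have "\<dots> = (\<Sum>p<D ^ t. \<Sum>p'<D ^ t. of_bool (meets x t p p') * (contribution x p t * cnj (contribution x p' t)))"
  proof (intro sum.cong refl)
    fix p p' assume p: "p \<in> {..<D ^ t}" "p' \<in> {..<D ^ t}"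
    have "(\<Sum>c\<in>A. of_bool (path M act x D p t = c) * contribution x p t * (of_bool (path M act x D p' t = c) * cnj (contribution x p' t))) =
      (\<Sum>c\<in>A. if c = path M act x D p t then of_bool (path M act x D p' t = path M act x D p t) * (contribution x p t * cnj (contribution x p' t)) else 0)"
      by (rule sum.cong) auto
    also have "\<dots> = of_bool (meets x t p p') * (contribution x p t * cnj (contribution x p' t))"
      using finA p by (auto simp: meets_def A_def)
    finally show "(\<Sum>c\<in>A. of_bool (path M act x D p t = c) * contribution x p t * (of_bool (path M act x D p' t = c) * cnj (contribution x p' t))) =
      of_bool (meets x t p p') * (contribution x p t * cnj (contribution x p' t))" .
  qed
  finally have "prob_state M x tx (acc M) = Re (\<Sum>p<D ^ t. \<Sum>p'<D ^ t. of_bool (meets x t p p') * (contribution x p t * cnj (contribution x p' t)))"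
    by (metis Re_complex_of_real)
  also have "\<dots> = (\<Sum>p<D ^ t. \<Sum>p'<D ^ t. Re (of_bool (meets x t p p') * (contribution x p t * cnj (contribution x p' t))))"
    by (simp only: Re_sum)
  also have "\<dots> = (\<Sum>p<D ^ t. \<Sum>p'<D ^ t. of_bool (meets x t p p') *
     (path_weight (weight M act) (path M act x D) D p t * path_weight (weight M act) (path M act x D) D p' t *
       sgn4 (path_phase D p t) (path_phase D p' t)))"
  proof (intro sum.cong refl)
    fix p p'
    have re: "Re (complex_of_real r * z) = r * Re z" for r z by simp
    let ?w = "path_weight (weight M act) (path M act x D) D p t" and ?w' = "path_weight (weight M act) (path M act x D) D p' t"
    have "contribution x p t * cnj (contribution x p' t) =
      complex_of_real (?w * ?w') * (\<i> ^ path_phase D p t * cnj (\<i> ^ path_phase D p' t))"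
      by (simp add: contribution_def mult_ac)
    then have "Re (contribution x p t * cnj (contribution x p' t)) = ?w * ?w' * sgn4 (path_phase D p t) (path_phase D p' t)"
      using Re_i_powers[of "path_phase D p t" "path_phase D p' t"] by (simp only: re)
    then show "Re (of_bool (meets x t p p') * (contribution x p t * cnj (contribution x p' t))) =
      of_bool (meets x t p p') * (?w * ?w' * sgn4 (path_phase D p t) (path_phase D p' t))" by auto
  qed
  finally show ?thesis .
qed

end

section \<open>Approximate amplitudes\<close>

lemma prod_bounds:
  fixes a :: "nat \<Rightarrow> real"
  assumes "\<And>i. i < t \<Longrightarrow> 0 \<le> a i \<and> a i \<le> \<Lambda>"
  shows "0 \<le> (\<Prod>i<t. a i)" "(\<Prod>i<t. a i) \<le> \<Lambda> ^ t"
proof -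
  show "0 \<le> (\<Prod>i<t. a i)" by (rule prod_nonneg) (use assms in auto)
  have "(\<Prod>i<t. a i) \<le> (\<Prod>i<t. \<Lambda>)" by (rule prod_mono) (use assms in auto)
  then show "(\<Prod>i<t. a i) \<le> \<Lambda> ^ t" by simp
qed

text \<open>Exchanging the factors one at a time costs \<open>\<epsilon>\<close> each, magnified by
  at most the other factors.\<close>

lemma prod_diff:
  fixes a b :: "nat \<Rightarrow> real"
  assumes "\<And>i. i < t \<Longrightarrow> 0 \<le> a i \<and> a i \<le> \<Lambda>" "\<And>i. i < t \<Longrightarrow> 0 \<le> b i \<and> b i \<le> \<Lambda>"
    and "\<And>i. i < t \<Longrightarrow> \<bar>a i - b i\<bar> \<le> \<epsilon>" "1 \<le> \<Lambda>" "0 \<le> \<epsilon>"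
  shows "\<bar>(\<Prod>i<t. a i) - (\<Prod>i<t. b i)\<bar> \<le> t * \<epsilon> * \<Lambda> ^ t"
  using assms(1-3)
proof (induction t)
  case (Suc t)
  let ?A = "\<Prod>i<t. a i" and ?B = "\<Prod>i<t. b i"
  have IH: "\<bar>?A - ?B\<bar> \<le> t * \<epsilon> * \<Lambda> ^ t" using Suc by auto
  have B: "0 \<le> ?B" "?B \<le> \<Lambda> ^ t" using prod_bounds[of t b \<Lambda>] Suc.prems by auto
  have "?A * a t - ?B * b t = (?A - ?B) * a t + ?B * (a t - b t)" by (simp add: algebra_simps)
  then have "\<bar>?A * a t - ?B * b t\<bar> \<le> \<bar>?A - ?B\<bar> * a t + ?B * \<bar>a t - b t\<bar>"
    using Suc.prems(1)[of t] B by (simp add: abs_mult order_trans[OF abs_triangle_ineq])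
  also have "\<dots> \<le> (t * \<epsilon> * \<Lambda> ^ t) * \<Lambda> + \<Lambda> ^ t * \<epsilon>"
    using Suc.prems(1,3)[of t] IH B assms(4,5) by (intro add_mono mult_mono) auto
  also have "\<Lambda> ^ t * \<epsilon> \<le> \<Lambda> ^ Suc t * \<epsilon>"
    using assms(4,5) by (intro mult_right_mono power_increasing) auto
  finally show ?case by (simp add: algebra_simps)
qed simp

context paths
begin

text \<open>
  \<open>Pos\<close> and \<open>Neg\<close> collect the pairs of paths to the same accepting configuration with equal and with
  opposite phases; pairs with orthogonal phases do not contribute to the acceptance probability.
\<close>

lemma acceptance_test:
  fixes wn :: "('q, 's) conf \<Rightarrow> nat \<Rightarrow> nat" and \<Lambda> k t :: nat
  assumes dec: "qtm_decides M L T m" and t: "T (length x) \<le> t"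
    and wn: "\<And>c d. d < D \<Longrightarrow> \<bar>real (wn c d) / 2 ^ k - weight M act c d\<bar> \<le> 1 / 2 ^ k"
    and \<Lambda>: "\<And>c d. d < D \<Longrightarrow> weight M act c d + 1 \<le> \<Lambda>"
    and k: "16 * t * (D * \<Lambda>) ^ (2 * t) \<le> 2 ^ k"
    and Pos: "Pos = (\<Sum>p<D ^ t. \<Sum>p'<D ^ t. if meets x t p p' \<and> path_phase D p t mod 4 = path_phase D p' t mod 4
       then path_weight wn (path M act x D) D p t * path_weight wn (path M act x D) D p' t else 0)"
    and Neg: "Neg = (\<Sum>p<D ^ t. \<Sum>p'<D ^ t. if meets x t p p' \<and> path_phase D p t mod 4 = (path_phase D p' t + 2) mod 4
       then path_weight wn (path M act x D) D p t * path_weight wn (path M act x D) D p' t else 0)"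
  shows "x \<in> L \<longleftrightarrow> 2 * Neg + 2 ^ (2 * k * t) \<le> 2 * Pos"
proof -
  define \<epsilon> :: real where "\<epsilon> = 1 / 2 ^ k"
  have \<epsilon>: "0 \<le> \<epsilon>" "\<epsilon> \<le> 1" by (simp_all add: \<epsilon>_def)
  have dbl: "z ^ (2 * t) = z ^ t * z ^ t" for z :: "'z::comm_semiring_1" by (simp only: mult_2 power_add)
  have dbl': "(2::real) ^ (2 * k * t) = 2 ^ (k * t) * 2 ^ (k * t)" by (simp only: mult_2 distrib_right power_add)
  let ?P = "path M act x D"
  define R where "R p = path_weight (weight M act) ?P D p t" for p
  define W where "W p = path_weight wn ?P D p t" for p
  define S where "S p = (\<Prod>j<t. real (wn (?P p j) (p div D ^ j mod D)) / 2 ^ k)" for p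
  have dig: "p div D ^ j mod D < D" for p j using D_pos by simp
  have w0: "0 \<le> weight M act c d" for c d by (simp add: weight_def part_def)
  have L1: "1 \<le> real \<Lambda>" using \<Lambda>[OF D_pos, of undefined] w0[of undefined 0] by linarith
  have wb: "0 \<le> weight M act c d \<and> weight M act c d \<le> \<Lambda>" if "d < D" for c d using \<Lambda>[OF that] w0[of c d] by (smt (verit))
  have nb: "0 \<le> real (wn c d) / 2 ^ k \<and> real (wn c d) / 2 ^ k \<le> \<Lambda>" if "d < D" for c d
    using wn[OF that, of c] \<Lambda>[OF that, of c] \<epsilon> unfolding \<epsilon>_def by (smt (verit) divide_nonneg_nonneg of_nat_0_le_iff zero_le_power)
  have S: "0 \<le> S p" "S p \<le> real \<Lambda> ^ t" for p
    using prod_bounds[of t "\<lambda>j. real (wn (?P p j) (p div D ^ j mod D)) / 2 ^ k" \<Lambda>] nb[OF dig] unfolding S_def by auto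
  have R: "0 \<le> R p" "R p \<le> real \<Lambda> ^ t" for p
    using prod_bounds[of t "\<lambda>j. weight M act (?P p j) (p div D ^ j mod D)" \<Lambda>] wb[OF dig] unfolding R_def path_weight_def by auto
  have SR: "\<bar>S p - R p\<bar> \<le> t * \<epsilon> * real \<Lambda> ^ t" for p
    unfolding S_def R_def path_weight_def
    by (rule prod_diff) (use wb[OF dig] nb[OF dig] wn[OF dig] L1 \<epsilon> in \<open>auto simp: \<epsilon>_def\<close>)
  have SRR: "\<bar>S p * S p' - R p * R p'\<bar> \<le> 2 * t * \<epsilon> * real \<Lambda> ^ (2 * t)" for p p'
  proof -
    have "S p * S p' - R p * R p' = S p * (S p' - R p') + (S p - R p) * R p'" by (simp add: algebra_simps)
    then have "\<bar>S p * S p' - R p * R p'\<bar> \<le> \<bar>S p * (S p' - R p')\<bar> + \<bar>(S p - R p) * R p'\<bar>"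
      by (metis abs_triangle_ineq)
    also have "\<dots> = S p * \<bar>S p' - R p'\<bar> + \<bar>S p - R p\<bar> * R p'"
      using S(1)[of p] R(1)[of p'] by (simp add: abs_mult)
    also have "\<dots> \<le> real \<Lambda> ^ t * (t * \<epsilon> * real \<Lambda> ^ t) + (t * \<epsilon> * real \<Lambda> ^ t) * real \<Lambda> ^ t"
      using S[of p] R[of p'] SR[of p] SR[of p'] \<epsilon> by (intro add_mono mult_mono) auto
    also have "\<dots> = 2 * t * \<epsilon> * real \<Lambda> ^ (2 * t)" unfolding dbl by (simp add: algebra_simps)
    finally show ?thesis .
  qed
  define Q where "Q = (\<Sum>p<D ^ t. \<Sum>p'<D ^ t. of_bool (meets x t p p') * (S p * S p' * sgn4 (path_phase D p t) (path_phase D p' t)))"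
  define A where "A = (\<Sum>p<D ^ t. \<Sum>p'<D ^ t. of_bool (meets x t p p') * (R p * R p' * sgn4 (path_phase D p t) (path_phase D p' t)))"
  \<comment> \<open>There are \<open>D ^ (2 * t)\<close> pairs, each off by at most
    \<open>2 * t * \<epsilon> * \<Lambda> ^ (2 * t)\<close>. The error 1/8 is below 1/6, the
    distance of the threshold 1/2 from 1/3 and 2/3.\<close>
  have QA: "\<bar>Q - A\<bar> \<le> 1 / 8"
  proof -
    have s: "\<bar>sgn4 a b\<bar> \<le> 1" for a b by (simp add: sgn4_def)
    have "\<bar>Q - A\<bar> \<le> (\<Sum>p<D ^ t. \<Sum>p'<D ^ t. \<bar>of_bool (meets x t p p') * (S p * S p' * sgn4 (path_phase D p t) (path_phase D p' t)) -
       of_bool (meets x t p p') * (R p * R p' * sgn4 (path_phase D p t) (path_phase D p' t))\<bar>)"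
      unfolding Q_def A_def sum_subtractf[symmetric] by (intro order_trans[OF sum_abs] sum_mono sum_abs)
    also have "\<dots> \<le> (\<Sum>p<D ^ t. \<Sum>p'<D ^ t. 2 * t * \<epsilon> * real \<Lambda> ^ (2 * t))"
    proof (intro sum_mono)
      fix p p'
      have "\<bar>of_bool (meets x t p p') * (S p * S p' * sgn4 (path_phase D p t) (path_phase D p' t)) -
       of_bool (meets x t p p') * (R p * R p' * sgn4 (path_phase D p t) (path_phase D p' t))\<bar> =
       of_bool (meets x t p p') * (\<bar>S p * S p' - R p * R p'\<bar> * \<bar>sgn4 (path_phase D p t) (path_phase D p' t)\<bar>)"
        by (auto simp flip: left_diff_distrib abs_mult)
      also have "\<dots> \<le> 1 * (2 * real t * \<epsilon> * real \<Lambda> ^ (2 * t) * 1)"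
        by (intro mult_mono s) (use \<epsilon> SRR[of p p'] in auto)
      finally show "\<bar>of_bool (meets x t p p') * (S p * S p' * sgn4 (path_phase D p t) (path_phase D p' t)) -
       of_bool (meets x t p p') * (R p * R p' * sgn4 (path_phase D p t) (path_phase D p' t))\<bar> \<le> 2 * t * \<epsilon> * real \<Lambda> ^ (2 * t)" by simp
    qed
    also have "\<dots> = real (2 * t * (D * \<Lambda>) ^ (2 * t)) * \<epsilon>" unfolding dbl by (simp add: power_mult_distrib algebra_simps)
    also have "\<dots> \<le> 1 / 8"
    proof -
      have "real (16 * t * (D * \<Lambda>) ^ (2 * t)) \<le> real (2 ^ k)" using k by (simp only: of_nat_le_iff)
      then show ?thesis by (simp add: \<epsilon>_def field_simps)
    qed
    finally show ?thesis .
  qed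
  have WS: "real (W p) = 2 ^ (k * t) * S p" for p
    unfolding W_def S_def path_weight_def by (simp add: prod_dividef power_mult)
  have "real Pos - real Neg = 2 ^ (2 * k * t) * Q"
  proof -
    have "real Pos - real Neg = (\<Sum>p<D ^ t. \<Sum>p'<D ^ t. of_bool (meets x t p p') * (real (W p) * real (W p') * sgn4 (path_phase D p t) (path_phase D p' t)))"
      unfolding Pos Neg W_def[symmetric] of_nat_sum sum_subtractf[symmetric]
    proof (intro sum.cong refl)
      fix p p'
      have "(b + 2) mod 4 \<noteq> b mod 4" for b :: nat by presburger
      then show "real (if meets x t p p' \<and> path_phase D p t mod 4 = path_phase D p' t mod 4 then W p * W p' else 0) -
        real (if meets x t p p' \<and> path_phase D p t mod 4 = (path_phase D p' t + 2) mod 4 then W p * W p' else 0) =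
        of_bool (meets x t p p') * (real (W p) * real (W p') * sgn4 (path_phase D p t) (path_phase D p' t))"
        by (auto simp: sgn4_def)
    qed
    also have "\<dots> = 2 ^ (2 * k * t) * Q"
      unfolding Q_def WS sum_distrib_left dbl' by (intro sum.cong refl) (simp only: mult_ac)
    finally show ?thesis .
  qed
  \<comment> \<open>Each pair is scaled by \<open>2 ^ (2 * k * t)\<close>, so the test compares
    twice the estimate \<open>Q\<close> with 1. Moving \<open>Neg\<close> to the other side keeps it
    within the natural numbers.\<close>
  then have test: "2 * Neg + 2 ^ (2 * k * t) \<le> 2 * Pos \<longleftrightarrow> 1 / 2 \<le> Q"
  proof -
    assume a: "real Pos - real Neg = 2 ^ (2 * k * t) * Q"
    have "2 * Neg + 2 ^ (2 * k * t) \<le> 2 * Pos \<longleftrightarrow> real (2 * Neg + 2 ^ (2 * k * t)) \<le> real (2 * Pos)"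
      by (simp only: of_nat_le_iff)
    also have "\<dots> \<longleftrightarrow> 2 ^ (2 * k * t) * 1 \<le> 2 ^ (2 * k * t) * (2 * Q)" using a by (simp add: algebra_simps)
    also have "\<dots> \<longleftrightarrow> 1 \<le> 2 * Q" by (subst mult_le_cancel_left_pos) auto
    finally show ?thesis by auto
  qed
  obtain tx where tx: "tx \<le> T (length x)" "halts_at M x tx"
    "x \<in> L \<longrightarrow> 2 / 3 \<le> prob_state M x tx (acc M)" "x \<notin> L \<longrightarrow> 2 / 3 \<le> prob_state M x tx (rej M)"
    using dec unfolding qtm_decides_def by blast
  have "prob_state M x tx (acc M) = A"
    unfolding A_def R_def by (rule prob_accept[OF tx(2)]) (use tx(1) t in simp)
  then show ?thesis unfolding test using tx(3,4) QA prob_state_le[OF wf, of x tx] by (cases "x \<in> L") (auto simp: abs_if split: if_splits)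
qed

end

section \<open>The simulation on numbers\<close>

lemma PC_lift2:
  assumes "PC (\<lambda>_ c. f (fst c) (snd c))" "PC a" "PC b"
  shows "PC (\<lambda>e c. f (a e c) (b e c))"
  using PC_comp[OF PC_pair[OF assms(2,3)] assms(1)] by simp

lemma PC_lift3:
  assumes "PC (\<lambda>_ c. f (fst c) (fst (snd c)) (snd (snd c)))" "PC a" "PC b" "PC d"
  shows "PC (\<lambda>e c. f (a e c) (b e c) (d e c))"
  using PC_comp[OF PC_pair[OF assms(2) PC_pair[OF assms(3,4)]] assms(1)] by simp

definition tab :: "nat \<Rightarrow> (nat \<Rightarrow> nat) \<Rightarrow> nat \<Rightarrow> nat" where
  "tab m f i = (if i < m then f i else 0)"

lemma PC_tab [PC_intros]: "PC g \<Longrightarrow> PC (\<lambda>e c. tab m f (g e c))"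
  unfolding tab_def by (rule PC_table)

lemma PC_phase [PC_intros]: "PC u \<Longrightarrow> PC (\<lambda>e c. phase (u e c))"
  unfolding phase_def by (intro PC_intros)

lemma PC_fld [PC_intros]: "PC N \<Longrightarrow> PC b \<Longrightarrow> PC x \<Longrightarrow> PC j \<Longrightarrow> PC (\<lambda>e c. fld (N e c) (b e c) (x e c) (j e c))"
  unfolding fld_def by (intro PC_intros)

text \<open>
  Parameters are \<open>(N, n, w, V)\<close>: a cap \<open>N\<close> on all numbers, the input length, its number of binary
  digits, and a table of approximate amplitudes.  A configuration is coded by its state and, for
  both tapes, the contents as a number in base \<open>S\<close> and the power of \<open>S\<close> marking the head position;
  the last two components accumulate the weight and the phase of the path that leads to it.
\<close>

type_synonym prm = "nat \<times> nat \<times> nat \<times> nat"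

abbreviation pN :: "prm \<Rightarrow> nat" where "pN p \<equiv> fst p"
abbreviation pn :: "prm \<Rightarrow> nat" where "pn p \<equiv> fst (snd p)"
abbreviation pw :: "prm \<Rightarrow> nat" where "pw p \<equiv> fst (snd (snd p))"
abbreviation pV :: "prm \<Rightarrow> nat" where "pV p \<equiv> snd (snd (snd p))"

type_synonym sstate = "nat \<times> nat \<times> nat \<times> nat \<times> nat \<times> nat \<times> nat"

abbreviation sQ :: "sstate \<Rightarrow> nat" where "sQ s \<equiv> fst s"
abbreviation sW :: "sstate \<Rightarrow> nat" where "sW s \<equiv> fst (snd s)"
abbreviation sh :: "sstate \<Rightarrow> nat" where "sh s \<equiv> fst (snd (snd s))"
abbreviation sY :: "sstate \<Rightarrow> nat" where "sY s \<equiv> fst (snd (snd (snd s)))"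
abbreviation sv :: "sstate \<Rightarrow> nat" where "sv s \<equiv> fst (snd (snd (snd (snd s))))"
abbreviation sa :: "sstate \<Rightarrow> nat" where "sa s \<equiv> fst (snd (snd (snd (snd (snd s)))))"
abbreviation sf :: "sstate \<Rightarrow> nat" where "sf s \<equiv> snd (snd (snd (snd (snd (snd s)))))"

fun move_code :: "move \<Rightarrow> nat" where
  "move_code Lft = 0" | "move_code Stay = 1" | "move_code Rgt = 2"

locale machine = paths M act nY D
  for M :: "('q::finite, 's::finite) qtm" and act :: "nat \<Rightarrow> ('q, 's) action" and nY D :: nat +
  fixes es :: "'s \<Rightarrow> nat" and eq :: "'q \<Rightarrow> nat" and S g \<kappa> :: nat
  assumes es: "bij_betw es UNIV {..<S}" "es (blank M) = 0" and eq: "inj eq"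
begin

text \<open>
  \<open>prec\<close> binary digits per amplitude keep the error of the acceptance probability small, \<open>csize\<close>
  bounds the size of a certificate, and \<open>nfields\<close> the number of digits of a transcript.
\<close>

definition steps :: "nat \<Rightarrow> nat" where "steps w = \<kappa> * w ^ \<kappa>"
text \<open>A head moves at most \<open>steps w\<close> cells and the start word has at most
  \<open>w\<close> digits; the extra cell keeps both ends of the window of
  \<open>2 * origin w\<close> cells out of reach.\<close>

definition origin :: "nat \<Rightarrow> nat" where "origin w = steps w + w + 1"
definition prec :: "nat \<Rightarrow> nat" where "prec w = 4 + steps w + 2 * g * steps w"
definition csize :: "nat \<Rightarrow> nat" where "csize w = (80 * steps w * steps w) ^ 2 + 1"
definition nfields :: "nat \<Rightarrow> nat" where "nfields w = 2 * csize w + csize w * csize w"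

lemma PC_params [PC_intros]:
  assumes "PC w"
  shows "PC (\<lambda>e c. steps (w e c))" "PC (\<lambda>e c. origin (w e c))" "PC (\<lambda>e c. prec (w e c))"
    "PC (\<lambda>e c. csize (w e c))" "PC (\<lambda>e c. nfields (w e c))"
  unfolding steps_def origin_def prec_def csize_def nfields_def by (intro PC_intros assms)+

definition base :: "prm \<Rightarrow> nat" where "base p = min (pN p) (2 ^ (pw p + 1))"

definition bit_set :: "prm \<Rightarrow> nat \<Rightarrow> nat \<Rightarrow> bool" where
  "bit_set p y i = claims (pN p) (base p) (nfields (pw p)) (pn p) y i"

definition address_code :: "prm \<Rightarrow> nat \<Rightarrow> nat" where
  "address_code p Y = (\<Sum>j<origin (pw p).
     if Y div min (pN p) (S ^ (origin (pw p) + j)) mod S = es (one M) then min (pN p) (2 ^ j) else 0)"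

text \<open>The base of the amplitude table: \<open>prec\<close> counts the fractional binary
  digits, and \<open>g\<close> leaves room for the integral part.\<close>

definition unit :: "prm \<Rightarrow> nat" where "unit p = min (pN p) (2 ^ (prec (pw p) + g))"

definition lookup :: "prm \<Rightarrow> nat \<Rightarrow> nat" where
  "lookup p i = pV p div min (pN p) (unit p ^ i) mod unit p"

definition rdw :: "sstate \<Rightarrow> nat" where "rdw s = sW s div sh s mod S"
definition rdq :: "sstate \<Rightarrow> nat" where "rdq s = sY s div sv s mod S"
definition is_final :: "sstate \<Rightarrow> bool" where "is_final s \<longleftrightarrow> sQ s = eq (acc M) \<or> sQ s = eq (rej M)"
definition is_query :: "sstate \<Rightarrow> bool" where "is_query s \<longleftrightarrow> sQ s = eq (prequery M)"

definition new_q :: "nat \<Rightarrow> sstate \<Rightarrow> nat" where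
  "new_q d s = (if is_final s then sQ s else if is_query s then eq (postquery M)
     else tab nY (\<lambda>j. eq (fst (act j))) (d div 4))"

definition new_w :: "prm \<Rightarrow> nat \<Rightarrow> nat \<Rightarrow> sstate \<Rightarrow> nat" where
  "new_w p y d s = (if is_final s then rdw s
     else if is_query s then (if bit_set p y (address_code p (sY s))
       then tab S (\<lambda>u. es (flip_bit M (inv_into UNIV es u))) (rdw s) else rdw s)
     else tab nY (\<lambda>j. es (fst (snd (act j)))) (d div 4))"

definition new_y :: "nat \<Rightarrow> sstate \<Rightarrow> nat" where
  "new_y d s = (if is_final s \<or> is_query s then rdq s else tab nY (\<lambda>j. es (fst (snd (snd (act j))))) (d div 4))"

definition shifted :: "nat \<Rightarrow> nat \<Rightarrow> nat" where
  "shifted m h = (if m = 0 then h div S else if m = 2 then h * S else h)"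

definition new_h :: "nat \<Rightarrow> sstate \<Rightarrow> nat" where
  "new_h d s = (if is_final s \<or> is_query s then sh s
     else shifted (tab nY (\<lambda>j. move_code (fst (snd (snd (snd (act j)))))) (d div 4)) (sh s))"

definition new_v :: "nat \<Rightarrow> sstate \<Rightarrow> nat" where
  "new_v d s = (if is_final s \<or> is_query s then sv s
     else shifted (tab nY (\<lambda>j. move_code (snd (snd (snd (snd (act j)))))) (d div 4)) (sv s))"

text \<open>Where there is nothing to select, digit 0 has weight 1, which scales to
  \<open>2 ^ prec\<close>. Otherwise the index enumerates state, scanned symbols, action and part in
  mixed radix.\<close>

definition factor :: "prm \<Rightarrow> nat \<Rightarrow> sstate \<Rightarrow> nat" where
  "factor p d s = (if is_final s \<or> is_query s then (if d = 0 then min (pN p) (2 ^ prec (pw p)) else 0)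
     else lookup p (4 * (((sQ s * S + rdw s) * S + rdq s) * nY + d div 4) + d mod 4))"

text \<open>A write subtracts the scanned digit at the head position and adds the new one. The caps
  bound every intermediate state, as \<open>PC_rec'\<close> demands; \<open>capacious\<close>
  ensures that they do not distort the simulation.\<close>

definition sstep :: "prm \<Rightarrow> nat \<Rightarrow> nat \<Rightarrow> sstate \<Rightarrow> sstate" where
  "sstep p y d s = (min (pN p) (new_q d s),
     min (pN p) (sW s - rdw s * sh s + new_w p y d s * sh s), min (pN p) (new_h d s),
     min (pN p) (sY s - rdq s * sv s + new_y d s * sv s), min (pN p) (new_v d s),
     min (pN p) (sa s * factor p d s), (sf s + phase (d mod 4)) mod 4)"

definition sinit :: "prm \<Rightarrow> sstate" where
  "sinit p = (min (pN p) (eq (start M)),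
     min (pN p) (\<Sum>j<pw p. (if min (pN p) (2 ^ j) \<le> pn p
       then (if pn p div min (pN p) (2 ^ j) mod 2 = 1 then es (one M) else es (zero M)) else 0)
         * min (pN p) (S ^ (origin (pw p) + j))),
     min (pN p) (S ^ origin (pw p)), 0, min (pN p) (S ^ origin (pw p)), min (pN p) 1, 0)"

definition srun :: "prm \<Rightarrow> nat \<Rightarrow> nat \<Rightarrow> sstate" where
  "srun p y r = rec_nat (sinit p) (\<lambda>i. sstep p y (r div min (pN p) (D ^ i) mod D)) (steps (pw p))"

definition smatch :: "sstate \<Rightarrow> sstate \<Rightarrow> bool" where
  "smatch s s' \<longleftrightarrow> sQ s = sQ s' \<and> sW s = sW s' \<and> sh s = sh s' \<and> sY s = sY s' \<and> sv s = sv s' \<and> sQ s = eq (acc M)"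

definition spair :: "nat \<Rightarrow> sstate \<Rightarrow> sstate \<Rightarrow> nat" where
  "spair b s s' = (if smatch s s' \<and> sf s = (sf s' + b) mod 4 then sa s * sa s' else 0)"

definition total :: "prm \<Rightarrow> nat \<Rightarrow> nat \<Rightarrow> nat" where
  "total p y b = (\<Sum>r<min (pN p) (D ^ steps (pw p)). \<Sum>r'<min (pN p) (D ^ steps (pw p)). spair b (srun p y r) (srun p y r'))"

definition accepts :: "prm \<Rightarrow> nat \<Rightarrow> bool" where
  "accepts p y \<longleftrightarrow> 2 * total p y 2 + min (pN p) (2 ^ (2 * prec (pw p) * steps (pw p))) \<le> 2 * total p y 0"

section \<open>The simulation is pseudo-polynomial\<close>

lemma PC_base [PC_intros]: "PC p \<Longrightarrow> PC (\<lambda>e c. base (p e c))"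
  unfolding base_def by (intro PC_intros)

lemma PC_unit [PC_intros]: "PC p \<Longrightarrow> PC (\<lambda>e c. unit (p e c))"
  unfolding unit_def by (intro PC_intros)

lemma PC_lookup [PC_intros]: "PC p \<Longrightarrow> PC i \<Longrightarrow> PC (\<lambda>e c. lookup (p e c) (i e c))"
  unfolding lookup_def by (intro PC_intros)

lemma PC_bit_set [PC_intros]: "PC p \<Longrightarrow> PC y \<Longrightarrow> PC i \<Longrightarrow> PC (\<lambda>e c. bit_set (p e c) (y e c) (i e c))"
  by (rule PC_lift3[where f = bit_set]) (unfold bit_set_def claims_def, intro PC_intros)

lemma PC_address_code [PC_intros]: "PC p \<Longrightarrow> PC Y \<Longrightarrow> PC (\<lambda>e c. address_code (p e c) (Y e c))"
  by (rule PC_lift2[where f = address_code]) (unfold address_code_def, intro PC_intros)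

lemma PC_reads [PC_intros]:
  assumes "PC s"
  shows "PC (\<lambda>e c. rdw (s e c))" "PC (\<lambda>e c. rdq (s e c))" "PC (\<lambda>e c. is_final (s e c))" "PC (\<lambda>e c. is_query (s e c))"
  unfolding rdw_def rdq_def is_final_def is_query_def by (intro PC_intros assms)+

lemma PC_sstep [PC_intros]: "PC p \<Longrightarrow> PC y \<Longrightarrow> PC d \<Longrightarrow> PC s \<Longrightarrow> PC (\<lambda>e c. sstep (p e c) (y e c) (d e c) (s e c))"
  unfolding sstep_def new_q_def new_w_def new_y_def new_h_def new_v_def factor_def shifted_def by (intro PC_intros)

lemma PC_sinit [PC_intros]: "PC p \<Longrightarrow> PC (\<lambda>e c. sinit (p e c))"
  by (rule PC_app[where f = sinit]) (unfold sinit_def, intro PC_intros)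

lemma sz_capped: "sz ((min N a, min N b, min N c, min N d, min N e, min N f, r mod 4) :: sstate) \<le> 6 * N + 3"
proof -
  have "r mod 4 \<le> 3" by simp
  then show ?thesis
    using min.cobounded1[of N a] min.cobounded1[of N b] min.cobounded1[of N c] min.cobounded1[of N d]
      min.cobounded1[of N e] min.cobounded1[of N f] unfolding sz_simps fst_conv snd_conv by linarith
qed

lemma sz_srun: "sz (rec_nat (sinit p) (\<lambda>i. sstep p y (r div min (pN p) (D ^ i) mod D)) i) \<le> 6 * pN p + 3"
proof (cases i)
  case 0
  then show ?thesis
    using sz_capped[of "pN p" "eq (start M)" _ "S ^ origin (pw p)" 0 "S ^ origin (pw p)" 1 0]
    by (simp only: sinit_def old.nat.simps(6) mod_0 min_0R)
next
  case (Suc j)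
  then show ?thesis unfolding sstep_def by (simp only: old.nat.simps(7) sz_capped)
qed

lemma PC_srun [PC_intros]: "PC p \<Longrightarrow> PC y \<Longrightarrow> PC r \<Longrightarrow> PC (\<lambda>e c. srun (p e c) (y e c) (r e c))"
proof (rule PC_lift3[where f = srun])
  show "PC (\<lambda>_ c. srun (fst c) (fst (snd c)) (snd (snd c)))" unfolding srun_def
  proof (rule PC_rec'[where B = "\<lambda>_ c. 6 * fst (fst c) + 3"])
    show "poly_bounded (\<lambda>_ c :: prm \<times> nat \<times> nat. 6 * fst (fst c) + 3)"
      by (rule PC_size_nat) (intro PC_intros)
  qed (intro PC_intros | rule sz_srun)+
qed

lemma PC_total [PC_intros]: "PC p \<Longrightarrow> PC y \<Longrightarrow> PC b \<Longrightarrow> PC (\<lambda>e c. total (p e c) (y e c) (b e c))"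
  by (rule PC_lift3[where f = total]) (unfold total_def spair_def smatch_def, intro PC_intros)

lemma PC_accepts [PC_intros]: "PC p \<Longrightarrow> PC y \<Longrightarrow> PC (\<lambda>e c. accepts (p e c) (y e c))"
  unfolding accepts_def by (intro PC_intros)

end

section \<open>Digits of numbers in a fixed base\<close>

definition num :: "nat \<Rightarrow> (nat \<Rightarrow> nat) \<Rightarrow> nat \<Rightarrow> nat" where
  "num S f m = (\<Sum>j<m. f j * S ^ j)"

lemma num_Suc: "num S f (Suc m) = f 0 + S * num S (\<lambda>j. f (Suc j)) m"
  unfolding num_def sum.lessThan_Suc_shift by (simp add: sum_distrib_left mult_ac)

lemma power_le_cap: "0 < b \<Longrightarrow> i \<le> j \<Longrightarrow> b ^ j \<le> N \<Longrightarrow> b ^ i \<le> (N::nat)"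
  using power_increasing[of i j b] by linarith

lemma sum_less_add: "(\<Sum>j<a + b. f j) = (\<Sum>j<a. f j) + (\<Sum>j<b. f (a + j :: nat))"
  by (induction b) (simp_all add: add.assoc)

lemma num_less:
  assumes "\<And>j. j < m \<Longrightarrow> f j < S"
  shows "num S f m < S ^ m"
  using assms
proof (induction m)
  case (Suc m)
  then have IH: "num S f m < S ^ m" and f: "f m < S" by auto
  have "num S f (Suc m) < (f m + 1) * S ^ m" using IH by (simp add: num_def)
  also have "\<dots> \<le> S * S ^ m" using f by (intro mult_le_mono1) simp
  finally show ?case by simp
qed (simp add: num_def)

lemma num_digit:
  assumes "\<And>j. f j < S" "h < m"
  shows "num S f m div S ^ h mod S = f h"
  using assms
proof (induction m arbitrary: f h)
  case (Suc m)
  have S: "0 < S" using Suc.prems(1)[of 0] by simp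
  show ?case
  proof (cases h)
    case 0
    then show ?thesis using Suc.prems(1)[of 0] by (simp add: num_Suc)
  next
    case (Suc i)
    have "num S f (Suc m) div S = num S (\<lambda>j. f (Suc j)) m"
      unfolding num_Suc using Suc.prems(1)[of 0] S by simp
    then have "num S f (Suc m) div S ^ h = num S (\<lambda>j. f (Suc j)) m div S ^ i"
      unfolding Suc power_Suc by (simp add: div_mult2_eq)
    then show ?thesis using Suc.IH[of "\<lambda>j. f (Suc j)" i] Suc.prems Suc by simp
  qed
qed simp

lemma num_update:
  assumes "h < m"
  shows "num S (f(h := u)) m = num S f m - f h * S ^ h + u * S ^ h"
proof -
  have r: "num S k m = k h * S ^ h + (\<Sum>j\<in>{..<m} - {h}. k j * S ^ j)" for k
    unfolding num_def using assms by (simp add: sum.remove)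
  have "(\<Sum>j\<in>{..<m} - {h}. (f(h := u)) j * S ^ j) = (\<Sum>j\<in>{..<m} - {h}. f j * S ^ j)"
    by (rule sum.cong) auto
  then show ?thesis unfolding r[of f] r[of "f(h := u)"] by simp
qed

section \<open>Correctness of the simulation\<close>

context machine
begin

lemma es_inj: "es a = es b \<longleftrightarrow> a = b"
  using es(1) by (auto simp: bij_betw_def inj_on_def)

lemma es_less: "es a < S"
  using es(1) by (auto simp: bij_betw_def)

lemma S_gt1: "1 < S"
proof -
  have "blank M \<noteq> one M" using wf by (auto simp: well_formed_def)
  then have "es (one M) \<noteq> 0" using es(2) es_inj by metis
  then show ?thesis using es_less[of "one M"] by simp
qed

lemma eq_inj: "eq a = eq b \<longleftrightarrow> a = b"
  using eq by (auto simp: inj_def)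

lemma tab_act: "d < D \<Longrightarrow> tab nY f (d div 4) = f (d div 4)"
  by (simp add: tab_def D less_mult_imp_div_less)

definition tape :: "nat \<Rightarrow> (int \<Rightarrow> 's) \<Rightarrow> nat" where
  "tape z \<tau> = num S (\<lambda>j. es (\<tau> (int j - int z))) (2 * z)"

definition confined :: "nat \<Rightarrow> nat \<Rightarrow> ('q, 's) conf \<Rightarrow> bool" where
  "confined w i c \<longleftrightarrow> \<bar>whead c\<bar> \<le> int i \<and> \<bar>qhead c\<bar> \<le> int i \<and>
     (\<forall>j. work c j \<noteq> blank M \<longrightarrow> \<bar>j\<bar> \<le> int (i + w)) \<and> (\<forall>j. query c j \<noteq> blank M \<longrightarrow> \<bar>j\<bar> \<le> int (i + w))"

definition represents :: "nat \<Rightarrow> ('q, 's) conf \<Rightarrow> sstate \<Rightarrow> bool" where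
  "represents z c s \<longleftrightarrow> sQ s = eq (state c) \<and> sW s = tape z (work c) \<and> sh s = S ^ nat (whead c + int z) \<and>
     sY s = tape z (query c) \<and> sv s = S ^ nat (qhead c + int z)"

lemma tape_digit: "- int z \<le> j \<Longrightarrow> j < int z \<Longrightarrow> tape z \<tau> div S ^ nat (j + int z) mod S = es (\<tau> j)"
  unfolding tape_def by (subst num_digit) (auto simp: es_less)

lemma tape_less: "tape z \<tau> < S ^ (2 * z)"
  unfolding tape_def by (rule num_less) (rule es_less)

lemma tape_update:
  assumes "- int z \<le> j" "j < int z"
  shows "tape z (\<tau>(j := u)) = tape z \<tau> - es (\<tau> j) * S ^ nat (j + int z) + es u * S ^ nat (j + int z)"
proof -
  have "(\<lambda>i. es ((\<tau>(j := u)) (int i - int z))) = (\<lambda>i. es (\<tau> (int i - int z)))(nat (j + int z) := es u)"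
    using assms by (auto simp: fun_eq_iff)
  then show ?thesis unfolding tape_def
    using num_update[of "nat (j + int z)" "2 * z" S "\<lambda>i. es (\<tau> (int i - int z))" "es u"] assms by simp
qed

text \<open>The simulation compares codes, whereas \<open>meets\<close> compares configurations.
  Confinement guarantees that nothing lies outside the window of \<open>2 * z\<close> cells that a
  code describes.\<close>

lemma represents_inj:
  assumes "represents z c s" "represents z c' s'" "confined w i c" "confined w i c'" "i + w < z"
    and "sQ s = sQ s'" "sW s = sW s'" "sh s = sh s'" "sY s = sY s'" "sv s = sv s'"
  shows "c = c'"
proof -
  have pow: "a = b" if "S ^ nat (a + int z) = S ^ nat (b + int z)" "\<bar>a\<bar> \<le> int i" "\<bar>b\<bar> \<le> int i" for a b
    using that S_gt1 assms(5) by (simp add: power_inject_exp)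
  have tp: "\<tau> = \<tau>'" if t: "tape z \<tau> = tape z \<tau>'" and n: "\<And>j. \<tau> j \<noteq> blank M \<Longrightarrow> \<bar>j\<bar> \<le> int (i + w)"
    "\<And>j. \<tau>' j \<noteq> blank M \<Longrightarrow> \<bar>j\<bar> \<le> int (i + w)" for \<tau> \<tau>'
  proof
    fix j
    show "\<tau> j = \<tau>' j"
    proof (cases "\<bar>j\<bar> \<le> int (i + w)")
      case True
      then have "- int z \<le> j" "j < int z" using assms(5) by auto
      from tape_digit[OF this, of \<tau>] tape_digit[OF this, of \<tau>'] show ?thesis by (simp add: t es_inj)
    next
      case False
      then show ?thesis using n by metis
    qed
  qed
  show ?thesis
  proof (rule conf.equality)
    show "state c = state c'" using assms by (simp add: represents_def eq_inj)
    show "whead c = whead c'" using assms by (intro pow) (auto simp: represents_def confined_def)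
    show "qhead c = qhead c'" using assms by (intro pow) (auto simp: represents_def confined_def)
    show "work c = work c'" using assms by (intro tp) (auto simp: represents_def confined_def)
    show "query c = query c'" using assms by (intro tp) (auto simp: represents_def confined_def)
  qed simp
qed

definition entry :: "('q, 's) conf \<Rightarrow> nat \<Rightarrow> nat" where
  "entry c d = 4 * (((eq (state c) * S + es (work c (whead c))) * S + es (query c (qhead c))) * nY + d div 4) + d mod 4"

definition wn :: "prm \<Rightarrow> ('q, 's) conf \<Rightarrow> nat \<Rightarrow> nat" where
  "wn p c d = (if idle M c then (if d = 0 then 2 ^ prec (pw p) else 0) else lookup p (entry c d))"

definition input_of :: "prm \<Rightarrow> nat \<Rightarrow> bool list" where
  "input_of p y = ones (pN p) (base p) (nfields (pw p)) (pn p) y"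

text \<open>Room for each kind of number that a run produces: state codes, tapes, path codes, the
  scaled threshold, table digits, accumulated path weights and query addresses.\<close>

definition capacious :: "prm \<Rightarrow> bool" where
  "capacious p \<longleftrightarrow> pn p < 2 ^ pw p \<and> (\<forall>q. eq q \<le> pN p) \<and> S ^ (2 * origin (pw p)) \<le> pN p \<and>
     D ^ steps (pw p) \<le> pN p \<and> 2 ^ (2 * prec (pw p) * steps (pw p)) \<le> pN p \<and>
     2 ^ (prec (pw p) + g) \<le> pN p \<and> (2 ^ (prec (pw p) + g)) ^ steps (pw p) \<le> pN p \<and> 2 ^ origin (pw p) \<le> pN p"

lemma confined_step:
  assumes "confined w i c"
  shows "confined w (Suc i) (path_step M act x c d)"
proof -
  obtain q u v m e where y: "act (d div 4) = (q, u, v, m, e)" by (cases "act (d div 4)")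
  have sh: "\<bar>shift m h\<bar> \<le> 1 + int i" if "\<bar>h\<bar> \<le> int i" for m h using that by (cases m) auto
  show ?thesis
    using assms unfolding path_step_def y by (auto simp: confined_def query_step_def sh)
qed

lemma confined_path: "length x < 2 ^ w \<Longrightarrow> confined w i (path M act x D r i)"
proof (induction i)
  case 0
  have "j < int w" if "0 \<le> j" "2 ^ nat j \<le> length x" for j
  proof -
    have "(2::nat) ^ nat j < 2 ^ w" using that(2) 0 by linarith
    then show ?thesis using that(1) by (simp add: nat_less_iff)
  qed
  then show ?case by (force simp: confined_def init_conf_def)
next
  case (Suc i)
  then show ?case using confined_step by simp
qed

context
  fixes p :: prm and y :: nat
  assumes cap: "capacious p"
begin

abbreviation "z \<equiv> origin (pw p)"
abbreviation "N \<equiv> pN p"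

lemma caps: "pn p < 2 ^ pw p" "eq q \<le> N" "S ^ (2 * z) \<le> N" "D ^ steps (pw p) \<le> N"
  "2 ^ (2 * prec (pw p) * steps (pw p)) \<le> N" "2 ^ (prec (pw p) + g) \<le> N"
  "(2 ^ (prec (pw p) + g)) ^ steps (pw p) \<le> N" "2 ^ z \<le> N"
  using cap by (auto simp: capacious_def)

lemma S_pow: "j \<le> 2 * z \<Longrightarrow> S ^ j \<le> N"
  using S_gt1 by (intro power_le_cap[OF _ _ caps(3)]) auto

lemma two_pow: "j \<le> z \<Longrightarrow> 2 ^ j \<le> N"
  by (rule power_le_cap[OF _ _ caps(8)]) auto

lemma prec_pow: "2 ^ prec (pw p) \<le> N"
  by (rule power_le_cap[OF _ _ caps(6)]) auto

lemma length_input_of: "length (input_of p y) = pn p"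
  by (simp add: input_of_def ones_def)

lemma bit_at_input_of: "bit_at (input_of p y) j \<longleftrightarrow> bit_set p y j"
  by (auto simp: bit_at_def input_of_def ones_def bit_set_def claims_def)

lemma represents_init: "represents z (init_conf M (pn p)) (sinit p)"
proof -
  let ?f = "\<lambda>j. if 2 ^ j \<le> pn p then (if pn p div 2 ^ j mod 2 = 1 then es (one M) else es (zero M)) else 0"
  have z: "pw p \<le> z" by (simp add: origin_def)
  have len: "2 ^ j \<le> pn p \<Longrightarrow> j < pw p" for j
    using caps(1) by (meson le_less_trans nat_power_less_imp_less pos2)
  have "tape z (work (init_conf M (pn p))) = (\<Sum>j<z + z. es (work (init_conf M (pn p)) (int j - int z)) * S ^ j)"
    by (simp add: tape_def num_def mult_2)
  also have "\<dots> = (\<Sum>j<z. es (work (init_conf M (pn p)) (int j - int z)) * S ^ j) +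
      (\<Sum>j<z. es (work (init_conf M (pn p)) (int (z + j) - int z)) * S ^ (z + j))"
    by (rule sum_less_add)
  also have "(\<Sum>j<z. es (work (init_conf M (pn p)) (int j - int z)) * S ^ j) = 0"
    by (simp add: init_conf_def es(2))
  also have "(\<Sum>j<z. es (work (init_conf M (pn p)) (int (z + j) - int z)) * S ^ (z + j)) = (\<Sum>j<z. ?f j * S ^ (z + j))"
    by (intro sum.cong refl) (simp add: init_conf_def es(2) odd_iff_mod_2_eq_one)
  also have "\<dots> = (\<Sum>j<pw p. ?f j * S ^ (z + j))"
    by (rule sum.mono_neutral_right) (use z in \<open>auto dest: len\<close>)
  also have "\<dots> = (\<Sum>j<pw p. (if min N (2 ^ j) \<le> pn p then (if pn p div min N (2 ^ j) mod 2 = 1 then es (one M) else es (zero M)) else 0)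
         * min N (S ^ (z + j)))"
    by (intro sum.cong refl) (use two_pow S_pow z in \<open>simp add: min_absorb2\<close>)
  finally have W: "tape z (work (init_conf M (pn p))) = \<dots>" by simp
  have "tape z (query (init_conf M (pn p))) = 0" by (simp add: tape_def num_def init_conf_def es(2))
  moreover have "tape z (work (init_conf M (pn p))) \<le> N" using tape_less caps(3) by (meson less_imp_le order.strict_trans2)
  ultimately show ?thesis
    using caps(2) S_pow[of z] unfolding represents_def sinit_def fst_conv snd_conv W[symmetric]
    by (simp add: min_absorb2) (simp add: init_conf_def)
qed

lemma address_code:
  assumes "confined (pw p) i c" "i < steps (pw p)"
  shows "address_code p (tape z (query c)) = address M c"
proof -
  have bo: "blank M \<noteq> one M" using wf by (auto simp: well_formed_def)
  have "tape z (query c) div min N (S ^ (z + j)) mod S = es (query c (int j))" if "j < z" for j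
    using tape_digit[of z "int j" "query c"] S_pow[of "z + j"] that by (simp add: min_absorb2 nat_add_distrib add.commute)
  then have "address_code p (tape z (query c)) = (\<Sum>j<z. if query c (int j) = one M then 2 ^ j else 0)"
    unfolding address_code_def by (intro sum.cong refl) (use two_pow in \<open>simp add: es_inj min_absorb2\<close>)
  also have "\<dots> = (\<Sum>j\<in>{j \<in> {..<z}. query c (int j) = one M}. 2 ^ j)" by (rule sum.inter_filter[symmetric]) simp
  also have "{j \<in> {..<z}. query c (int j) = one M} = {j. query c (int j) = one M}"
  proof -
    have "j < z" if "query c (int j) = one M" for j
    proof -
      have "query c (int j) \<noteq> blank M" using that bo by simp
      then have "\<bar>int j\<bar> \<le> int (i + pw p)" using assms(1) unfolding confined_def by blast
      then show ?thesis using assms(2) by (simp add: origin_def)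
    qed
    then show ?thesis by auto
  qed
  finally show ?thesis by (simp add: address_def)
qed

lemma represents_step:
  assumes r: "represents z c s" and c: "confined (pw p) i c" "i < steps (pw p)" and d: "d < D"
  shows "represents z (path_step M act (input_of p y) c d) (sstep p y d s)"
    and "factor p d s = wn p c d"
proof -
  \<comment> \<open>The strict bounds leave a cell on either side, so that dividing or multiplying
    the marker of the head position by \<open>S\<close> yields the marker of the neighbouring cell;
    in particular \<open>S ^ 0 div S = 0\<close> is avoided.\<close>
  have wb: "- int z \<le> whead c" "whead c < int z" "0 < whead c + int z" "whead c + 1 < int z"
    and qb: "- int z \<le> qhead c" "qhead c < int z" "0 < qhead c + int z" "qhead c + 1 < int z"
    using c by (auto simp: confined_def origin_def)
  have h: "sQ s = eq (state c)" "sW s = tape z (work c)" "sh s = S ^ nat (whead c + int z)"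
    "sY s = tape z (query c)" "sv s = S ^ nat (qhead c + int z)"
    using r by (auto simp: represents_def)
  have rdw: "rdw s = es (work c (whead c))" unfolding rdw_def h by (rule tape_digit[OF wb(1,2)])
  have rdq: "rdq s = es (query c (qhead c))" unfolding rdq_def h by (rule tape_digit[OF qb(1,2)])
  have fin: "is_final s = final_conf M c" by (simp add: is_final_def final_conf_def h eq_inj)
  have que: "is_query s = (state c = prequery M)" by (simp add: is_query_def h eq_inj)
  have pre_not_final: "\<not> final_conf M c" if "state c = prequery M"
    using that wf by (auto simp: final_conf_def well_formed_def)
  show "factor p d s = wn p c d"
    using prec_pow by (simp add: factor_def wn_def fin que idle_def entry_def rdw rdq h min_absorb2)
  define c' where "c' = path_step M act (input_of p y) c d"
  obtain q u v m e where a: "act (d div 4) = (q, u, v, m, e)" by (cases "act (d div 4)")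
  have shifted: "shifted (move_code m) (S ^ nat (j + int z)) = S ^ nat (shift m j + int z)"
    if "0 < j + int z" for m j
  proof (cases m)
    case Lft
    have "nat (j + int z) = Suc (nat (j - 1 + int z))" using that by simp
    then show ?thesis using S_gt1 Lft by (simp add: shifted_def)
  next
    case Stay
    then show ?thesis by (simp add: shifted_def)
  next
    case Rgt
    have "nat (j + 1 + int z) = Suc (nat (j + int z))" using that by simp
    then show ?thesis using Rgt by (simp add: shifted_def mult.commute)
  qed
  have headbound: "S ^ nat (shift m j + int z) \<le> N" if "0 < j + int z" "j + 1 < int z" for m j
    by (rule S_pow, cases m) (use that in auto)
  have hb0: "S ^ nat (j + int z) \<le> N" if "0 < j + int z" "j + 1 < int z" for j
    using headbound[OF that, of Stay] by simp
  have tb: "min N (tape z \<tau>) = tape z \<tau>" for \<tau>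
    using tape_less[of z \<tau>] caps(3) by simp
  have q': "new_q d s = eq (state c')"
    unfolding new_q_def fin que c'_def path_step_def tab_act[OF d] a
    by (auto simp: h query_step_def)
  have Wupd: "sW s - rdw s * sh s + es u' * sh s = tape z ((work c)(whead c := u'))" for u'
    unfolding rdw h using tape_update[OF wb(1,2)] by simp
  have Yupd: "sY s - rdq s * sv s + es u' * sv s = tape z ((query c)(qhead c := u'))" for u'
    unfolding rdq h using tape_update[OF qb(1,2)] by simp
  have flip: "tab S (\<lambda>u. es (flip_bit M (inv_into UNIV es u))) (es b) = es (flip_bit M b)" for b
    using es(1) es_less by (simp add: tab_def bij_betw_def inv_into_f_f)
  have adr: "bit_set p y (address_code p (sY s)) = bit_at (input_of p y) (address M c)"
    unfolding h by (simp add: address_code[OF c] bit_at_input_of)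
  have W': "sW s - rdw s * sh s + new_w p y d s * sh s = tape z (work c')"
  proof (cases "final_conf M c")
    case True
    then show ?thesis using Wupd[of "work c (whead c)"] by (simp add: new_w_def fin c'_def path_step_def rdw)
  next
    case False
    note nf = this
    show ?thesis
    proof (cases "state c = prequery M")
      case True
      have "new_w p y d s = es (if bit_at (input_of p y) (address M c) then flip_bit M (work c (whead c)) else work c (whead c))"
        using True nf by (simp add: new_w_def fin que adr rdw flip)
      moreover have "work c' = (work c)(whead c := if bit_at (input_of p y) (address M c) then flip_bit M (work c (whead c)) else work c (whead c))"
        using True nf by (simp add: c'_def path_step_def query_step_def)
      ultimately show ?thesis by (simp only: Wupd)
    next
      case False
      then show ?thesis using nf Wupd[of u] by (simp add: new_w_def fin que tab_act[OF d] a c'_def path_step_def)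
    qed
  qed
  have Y': "sY s - rdq s * sv s + new_y d s * sv s = tape z (query c')"
  proof (cases "final_conf M c \<or> state c = prequery M")
    case True
    then show ?thesis using Yupd[of "query c (qhead c)"]
      by (auto simp add: new_y_def fin que c'_def path_step_def rdq query_step_def)
  next
    case False
    then show ?thesis using Yupd[of v] by (simp add: new_y_def fin que tab_act[OF d] a c'_def path_step_def)
  qed
  have h': "new_h d s = S ^ nat (whead c' + int z)" "new_h d s \<le> N"
    using shifted[OF wb(3)] headbound[OF wb(3,4)] hb0[OF wb(3,4)]
    by (auto simp: new_h_def fin que tab_act[OF d] a c'_def path_step_def query_step_def h)
  have v': "new_v d s = S ^ nat (qhead c' + int z)" "new_v d s \<le> N"
    using shifted[OF qb(3)] headbound[OF qb(3,4)] hb0[OF qb(3,4)]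
    by (auto simp: new_v_def fin que tab_act[OF d] a c'_def path_step_def query_step_def h)
  show "represents z (path_step M act (input_of p y) c d) (sstep p y d s)"
    unfolding represents_def sstep_def fst_conv snd_conv c'_def[symmetric] W' Y' q' tb
    using h' v' caps(2) by (simp add: min_absorb2)
qed

lemma wn_le: "wn p c d \<le> 2 ^ (prec (pw p) + g)"
proof -
  have "unit p = 2 ^ (prec (pw p) + g)" using caps(6) by (simp add: unit_def min_absorb2)
  then have "lookup p i \<le> 2 ^ (prec (pw p) + g)" for i by (simp add: lookup_def less_imp_le)
  moreover have "(2::nat) ^ prec (pw p) \<le> 2 ^ (prec (pw p) + g)" by (intro power_increasing) auto
  ultimately show ?thesis by (simp add: wn_def)
qed

lemma simulation:
  assumes "i \<le> steps (pw p)"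
  shows "let s = rec_nat (sinit p) (\<lambda>i. sstep p y (r div min N (D ^ i) mod D)) i in
     represents z (path M act (input_of p y) D r i) s \<and>
     sa s = path_weight (wn p) (path M act (input_of p y) D) D r i \<and> sf s = path_phase D r i mod 4"
  using assms
proof (induction i)
  case 0
  have "1 \<le> N" using two_pow[of 0] by simp
  then show ?case using represents_init
    by (simp add: length_input_of path_weight_def path_phase_def) (simp add: sinit_def min_absorb2)
next
  case (Suc i)
  let ?x = "input_of p y"
  define s where "s = rec_nat (sinit p) (\<lambda>i. sstep p y (r div min N (D ^ i) mod D)) i"
  have IH: "represents z (path M act ?x D r i) s" "sa s = path_weight (wn p) (path M act ?x D) D r i"
    "sf s = path_phase D r i mod 4"
    using Suc by (simp_all add: s_def Let_def)
  have "D ^ i \<le> D ^ steps (pw p)" using Suc.prems D_pos by (intro power_increasing) auto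
  then have m: "min N (D ^ i) = D ^ i" using caps(4) by simp
  let ?d = "r div D ^ i mod D"
  have d: "?d < D" using D_pos by simp
  have cf: "confined (pw p) i (path M act ?x D r i)"
    by (rule confined_path) (use caps(1) in \<open>simp add: length_input_of\<close>)
  have i: "i < steps (pw p)" using Suc.prems by simp
  note st = represents_step[OF IH(1) cf i d]
  have "path_weight (wn p) (path M act ?x D) D r j \<le> (2 ^ (prec (pw p) + g)) ^ j" for j
    unfolding path_weight_def using prod_mono[of "{..<j}" "\<lambda>j. wn p (path M act ?x D r j) (r div D ^ j mod D)" "\<lambda>_. 2 ^ (prec (pw p) + g)"] wn_le
    by simp
  also have "(2 ^ (prec (pw p) + g)) ^ Suc i \<le> ((2::nat) ^ (prec (pw p) + g)) ^ steps (pw p)"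
    using Suc.prems by (intro power_increasing) auto
  finally have wle: "path_weight (wn p) (path M act ?x D) D r (Suc i) \<le> N" using caps(7) by simp
  have w: "sa s * factor p ?d s = path_weight (wn p) (path M act ?x D) D r (Suc i)"
    by (simp add: IH(2) st(2) path_weight_def)
  have "represents z (path M act ?x D r (Suc i)) (sstep p y ?d s)" using st(1) by simp
  moreover have "sa (sstep p y ?d s) = path_weight (wn p) (path M act ?x D) D r (Suc i)"
    unfolding sstep_def fst_conv snd_conv w using wle by simp
  moreover have "sf (sstep p y ?d s) = path_phase D r (Suc i) mod 4"
    unfolding sstep_def fst_conv snd_conv IH(3) by (simp add: path_phase_def mod_simps)
  ultimately show ?case by (simp add: Let_def m flip: s_def)
qed

theorem accepts_iff:
  assumes dec: "qtm_decides M L T m" and t: "T (pn p) \<le> steps (pw p)"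
    and app: "\<And>c d. d < D \<Longrightarrow> \<not> idle M c \<Longrightarrow>
      \<bar>real (lookup p (entry c d)) / 2 ^ prec (pw p) - part (d mod 4) (delta M (scanned c) (act (d div 4)))\<bar> \<le> 1 / 2 ^ prec (pw p)"
    and \<Lambda>: "\<And>u a b. part u (delta M a b) + 1 \<le> real \<Lambda>" "D * \<Lambda> \<le> 2 ^ g" "2 \<le> \<Lambda>"
  shows "accepts p y \<longleftrightarrow> input_of p y \<in> L"
proof -
  let ?x = "input_of p y" and ?t = "steps (pw p)" and ?k = "prec (pw p)"
  let ?P = "path M act ?x D"
  have rep: "represents z (?P r ?t) (srun p y r)" "sa (srun p y r) = path_weight (wn p) ?P D r ?t"
    "sf (srun p y r) = path_phase D r ?t mod 4" for r
    using simulation[of ?t r] by (simp_all add: srun_def Let_def)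
  have cf: "confined (pw p) ?t (?P r ?t)" for r
    by (rule confined_path) (use caps(1) in \<open>simp add: length_input_of\<close>)
  have zz: "?t + pw p < z" by (simp add: origin_def)
  have match: "smatch (srun p y r) (srun p y r') \<longleftrightarrow> meets ?x ?t r r'" for r r'
  proof
    assume "smatch (srun p y r) (srun p y r')"
    then show "meets ?x ?t r r'"
      using represents_inj[OF rep(1) rep(1) cf cf zz, of r r'] rep(1)[of r]
      by (auto simp: smatch_def meets_def represents_def eq_inj)
  next
    assume "meets ?x ?t r r'"
    then show "smatch (srun p y r) (srun p y r')"
      using rep(1)[of r] rep(1)[of r'] by (auto simp: smatch_def meets_def represents_def)
  qed
  have tot: "total p y b = (\<Sum>r<D ^ ?t. \<Sum>r'<D ^ ?t. if meets ?x ?t r r' \<and> path_phase D r ?t mod 4 = (path_phase D r' ?t + b) mod 4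
       then path_weight (wn p) ?P D r ?t * path_weight (wn p) ?P D r' ?t else 0)" for b
    unfolding total_def spair_def match rep(2,3) using caps(4) by (simp add: min_absorb2 mod_simps)
  \<comment> \<open>This is where \<open>prec\<close> comes from: its summands are the exponents in
    \<open>16 = 2 ^ 4\<close>, \<open>t \<le> 2 ^ t\<close> and
    \<open>(D * \<Lambda>) ^ (2 * t) \<le> 2 ^ (2 * g * t)\<close>.\<close>
  have k: "16 * ?t * (D * \<Lambda>) ^ (2 * ?t) \<le> 2 ^ ?k"
  proof -
    have "?t \<le> 2 ^ ?t" by (simp add: less_imp_le)
    moreover have "(D * \<Lambda>) ^ (2 * ?t) \<le> (2 ^ g) ^ (2 * ?t)" by (rule power_mono[OF \<Lambda>(2)]) simp
    ultimately have "16 * ?t * (D * \<Lambda>) ^ (2 * ?t) \<le> 16 * 2 ^ ?t * (2 ^ g) ^ (2 * ?t)" by (intro mult_le_mono) auto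
    also have "\<dots> = 2 ^ 4 * 2 ^ ?t * 2 ^ (2 * g * ?t)" by (simp add: power_mult mult_ac)
    also have "\<dots> = 2 ^ ?k" by (simp only: prec_def power_add)
    finally show ?thesis .
  qed
  have "?x \<in> L \<longleftrightarrow> 2 * total p y 2 + 2 ^ (2 * ?k * ?t) \<le> 2 * total p y 0"
  proof (rule acceptance_test[OF dec _ _ _ k])
    show "T (length ?x) \<le> ?t" using t by (simp add: length_input_of)
    show "\<bar>real (wn p c d) / 2 ^ ?k - weight M act c d\<bar> \<le> 1 / 2 ^ ?k" if "d < D" for c d
      using app[OF that, of c] by (simp add: wn_def weight_def)
    show "weight M act c d + 1 \<le> real \<Lambda>" for c d
      using \<Lambda>(1,3) by (simp add: weight_def)
  qed (simp_all add: tot)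
  then show ?thesis using caps(5) by (simp add: accepts_def min_absorb2)
qed

end

end

section \<open>Embedding arbitrary machines\<close>

text \<open>
  To run a given machine inside a larger program, its register \<open>i\<close> is moved to \<open>R + s * i + o\<close>, so
  that up to \<open>s\<close> machines find disjoint blank memories.  Registers \<open>R - 1\<close> and \<open>R - 2\<close> are scratch
  space for address computations.  All instructions are expanded to the same length \<open>s + 4\<close>.
\<close>

definition relocate :: "nat \<Rightarrow> nat \<Rightarrow> nat \<Rightarrow> nat \<Rightarrow> nat" where
  "relocate R s j i = R + s * i + j"

definition prelude :: "nat \<Rightarrow> nat \<Rightarrow> nat \<Rightarrow> nat \<Rightarrow> instr list" where
  "prelude R s j r = Const (R - 2) 0 # replicate s (Add (R - 2) (R - 2) r) @
     [Const (R - 1) (R + j), Add (R - 2) (R - 2) (R - 1)]"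

fun indirect :: "instr \<Rightarrow> nat" where
  "indirect (Load i k) = k" | "indirect (Store i k) = i" | "indirect _ = 0"

text \<open>Embedded machines run on empty strings, where every probe returns 0, and their output is
  discarded; \<open>Emit\<close> becomes a write to scratch space, which keeps the lengths
  equal.\<close>

fun moved :: "(nat \<Rightarrow> nat) \<Rightarrow> nat \<Rightarrow> (nat \<Rightarrow> nat) \<Rightarrow> instr \<Rightarrow> instr" where
  "moved m u l (Const i c) = Const (m i) c"
| "moved m u l (Add i j k) = Add (m i) (m j) (m k)"
| "moved m u l (Sub i j k) = Sub (m i) (m j) (m k)"
| "moved m u l (Load i j) = Load (m i) u"
| "moved m u l (Store i j) = Store u (m j)"
| "moved m u l (Jump k) = Jump (l k)"
| "moved m u l (JumpZero i k) = JumpZero (m i) (l k)"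
| "moved m u l (ReadInput i j) = Const (m i) 0"
| "moved m u l (ReadPre i j) = Const (m i) 0"
| "moved m u l (Emit i) = Const u 0"

text \<open>Jumps beyond the end of \<open>P\<close>, by which the original halts, are redirected to
  the end of the fragment.\<close>

definition embed :: "nat \<Rightarrow> nat \<Rightarrow> nat \<Rightarrow> instr list \<Rightarrow> nat \<Rightarrow> instr list" where
  "embed R s j P b = concat (map (\<lambda>i. prelude R s j (relocate R s j (indirect i)) @
     [moved (relocate R s j) (R - 2) (\<lambda>l. b + (s + 4) * min l (length P)) i]) P)"

lemma length_embed: "length (embed R s j P b) = (s + 4) * length P"
  unfolding embed_def by (simp add: length_concat comp_def prelude_def sum_list_triv algebra_simps)

lemma runs_replicate_add:
  assumes "u \<noteq> r"
  shows "runs x a (\<lambda>_. replicate s (Add u u r)) s (\<mu>, out) (\<mu>(u := \<mu> u + s * \<mu> r), out)"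
proof (induction s)
  case 0
  then show ?case by (simp add: runs_def)
next
  case (Suc s)
  have e: "(\<lambda>_. replicate (Suc s) (Add u u r)) = ((\<lambda>_. replicate s (Add u u r)) ;; (\<lambda>_. [Add u u r]))"
    by (rule ext) (simp add: seqc_def replicate_append_same)
  have "runs x a (\<lambda>_. [Add u u r]) 1 (\<mu>(u := \<mu> u + s * \<mu> r), out) (\<mu>(u := \<mu> u + Suc s * \<mu> r), out)"
    by (rule runs_instr) (use assms in \<open>simp add: fun_eq_iff algebra_simps\<close>)
  from runs_seq[OF Suc this] show ?case unfolding e by (simp only: Suc_eq_plus1)
qed

lemma runs_prelude:
  assumes "2 \<le> R" "R \<le> r"
  shows "runs x a (\<lambda>_. prelude R s j r) (s + 3) (\<mu>, out)
    (\<mu>(R - 2 := R + s * \<mu> r + j, R - 1 := R + j), out)"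
proof -
  let ?u = "R - 2" and ?v = "R - 1"
  have e: "(\<lambda>_. prelude R s j r) = ((\<lambda>_. [Const ?u 0]) ;; (\<lambda>_. replicate s (Add ?u ?u r)) ;; (\<lambda>_. [Const ?v (R + j)]) ;; (\<lambda>_. [Add ?u ?u ?v]))"
    by (rule ext) (simp add: seqc_def prelude_def)
  have n: "?u \<noteq> r" "?v \<noteq> r" "?u \<noteq> ?v" using assms by auto
  have 1: "runs x a (\<lambda>_. [Const ?u 0]) 1 (\<mu>, out) (\<mu>(?u := 0), out)" by (rule runs_instr) simp
  have 2: "runs x a (\<lambda>_. replicate s (Add ?u ?u r)) s (\<mu>(?u := 0), out) (\<mu>(?u := s * \<mu> r), out)"
    using runs_replicate_add[OF n(1), of x a s "\<mu>(?u := 0)" out] n by simp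
  have 3: "runs x a (\<lambda>_. [Const ?v (R + j)]) 1 (\<mu>(?u := s * \<mu> r), out) (\<mu>(?u := s * \<mu> r, ?v := R + j), out)"
    by (rule runs_instr) simp
  have 4: "runs x a (\<lambda>_. [Add ?u ?u ?v]) 1 (\<mu>(?u := s * \<mu> r, ?v := R + j), out)
     (\<mu>(?u := R + s * \<mu> r + j, ?v := R + j), out)"
    by (rule runs_instr) (use n in \<open>auto simp: fun_eq_iff\<close>)
  have t: "1 + (s + (1 + 1)) = s + 3" by simp
  show ?thesis using runs_seq[OF 1 runs_seq[OF 2 runs_seq[OF 3 4]]] unfolding e t .
qed

lemma code_at_concat:
  assumes "code_at P b (concat (map f xs))" "\<And>i. length (f i) = h" "k < length xs"
  shows "code_at P (b + h * k) (f (xs ! k))"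
proof -
  have "concat (map f xs) = concat (map f (take k xs)) @ f (xs ! k) @ concat (map f (drop (Suc k) xs))"
    using assms(3) by (metis concat.simps(2) concat_append id_take_nth_drop list.simps(9) map_append)
  moreover have "length (concat (map f (take k xs))) = h * k"
    using assms(2,3) by (simp add: length_concat comp_def sum_list_triv)
  ultimately show ?thesis using assms(1) code_at_append by metis
qed

lemma embed_step:
  assumes R: "2 \<le> R" and s: "j < s" and st: "\<not> halted P st"
    and rep: "\<And>i. \<mu> (relocate R s j i) = mem st i"
  shows "\<exists>\<mu>'. (\<forall>Q b. code_at Q b (embed R s j P b) \<longrightarrow>
      (ram_step Q x a ^^ (s + 4)) \<lparr>pc = b + (s + 4) * pc st, mem = \<mu>, outp = out\<rparr> =
      \<lparr>pc = b + (s + 4) * min (pc (ram_step P [] [] st)) (length P), mem = \<mu>', outp = out\<rparr>) \<and>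
    (\<forall>i. \<mu>' (relocate R s j i) = mem (ram_step P [] [] st) i) \<and>
    (\<forall>r. r \<noteq> R - 2 \<longrightarrow> r \<noteq> R - 1 \<longrightarrow> r \<notin> range (relocate R s j) \<longrightarrow> \<mu>' r = \<mu> r)"
proof -
  let ?m = "relocate R s j" and ?l = "\<lambda>b l. b + (s + 4) * min l (length P)"
  let ?f = "\<lambda>b i. prelude R s j (?m (indirect i)) @ [moved ?m (R - 2) (?l b) i]"
  have pcl: "pc st < length P" using st by (simp add: halted_def)
  define ins where "ins = P ! pc st"
  have inj: "?m i = ?m i' \<longleftrightarrow> i = i'" for i i' using s by (simp add: relocate_def)
  have ge: "R \<le> ?m i" for i by (simp add: relocate_def)
  have ne: "?m i \<noteq> R - 2" "?m i \<noteq> R - Suc 0" for i using R ge[of i] by auto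
  define \<mu>1 where "\<mu>1 = \<mu>(R - 2 := ?m (mem st (indirect ins)), R - 1 := R + j)"
  have rep1: "\<mu>1 (?m i) = mem st i" for i using ne rep by (simp add: \<mu>1_def)
  have u1: "\<mu>1 (R - 2) = ?m (mem st (indirect ins))" using R by (auto simp: \<mu>1_def)
  have fr1: "\<mu>1 r = \<mu> r" if "r \<noteq> R - 2" "r \<noteq> R - 1" for r using that by (simp add: \<mu>1_def)
  have P: "ram_step P [] [] st = exec [] [] ins st" using st by (simp add: ram_step_def ins_def)
  define \<mu>' where "\<mu>' = mem (exec x a (moved ?m (R - 2) id ins) \<lparr>pc = 0, mem = \<mu>1, outp = []\<rparr>)"
  have rep': "\<forall>i. \<mu>' (?m i) = mem (exec [] [] ins st) i"
    unfolding \<mu>'_def using rep1 u1 inj ne by (cases ins) (auto simp: bit_at_def)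
  have fr': "\<forall>r. r \<noteq> R - 2 \<longrightarrow> r \<noteq> R - 1 \<longrightarrow> r \<notin> range ?m \<longrightarrow> \<mu>' r = \<mu> r"
    unfolding \<mu>'_def using fr1 u1 by (cases ins) auto
  have "(ram_step Q x a ^^ (s + 4)) \<lparr>pc = b + (s + 4) * pc st, mem = \<mu>, outp = out\<rparr> =
      \<lparr>pc = ?l b (pc (exec [] [] ins st)), mem = \<mu>', outp = out\<rparr>"
    if code: "code_at Q b (embed R s j P b)" for Q b
  proof -
    have lp: "length (prelude R s j r) = s + 3" for r by (simp add: prelude_def)
    have "code_at Q (b + (s + 4) * pc st) (?f b ins)"
      unfolding ins_def by (rule code_at_concat[OF code[unfolded embed_def] _ pcl]) (simp add: prelude_def)
    then have c1: "code_at Q (b + (s + 4) * pc st) (prelude R s j (?m (indirect ins)))"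
      and c2: "code_at Q (b + (s + 4) * pc st + (s + 3)) [moved ?m (R - 2) (?l b) ins]"
      using code_at_append[of Q _ "prelude R s j (?m (indirect ins))"] by (metis, metis lp)
    have "runs x a (\<lambda>_. prelude R s j (?m (indirect ins))) (s + 3) (\<mu>, out) (\<mu>1, out)"
      using runs_prelude[OF R ge[of "indirect ins"], of x a s j \<mu> out] rep by (simp add: \<mu>1_def relocate_def)
    from this[unfolded runs_def, rule_format, OF c1]
    have s1: "(ram_step Q x a ^^ (s + 3)) \<lparr>pc = b + (s + 4) * pc st, mem = \<mu>, outp = out\<rparr> =
       \<lparr>pc = b + (s + 4) * pc st + (s + 3), mem = \<mu>1, outp = out\<rparr>" by (simp add: prelude_def)
    define q where "q = b + (s + 4) * pc st + (s + 3)"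
    define l where "l k = ?l b k" for k
    have sp: "Suc q = l (Suc (pc st))" using pcl by (simp add: q_def l_def min_absorb1)
    have "exec x a (moved ?m (R - 2) l ins) \<lparr>pc = q, mem = \<mu>1, outp = out\<rparr> =
       \<lparr>pc = l (pc (exec [] [] ins st)), mem = \<mu>', outp = out\<rparr>"
      unfolding \<mu>'_def using rep1 by (cases ins) (simp_all add: sp)
    then have "exec x a (moved ?m (R - 2) (?l b) ins) \<lparr>pc = b + (s + 4) * pc st + (s + 3), mem = \<mu>1, outp = out\<rparr> =
       \<lparr>pc = ?l b (pc (exec [] [] ins st)), mem = \<mu>', outp = out\<rparr>"
      unfolding q_def l_def .
    then have "(ram_step Q x a ^^ 1) \<lparr>pc = b + (s + 4) * pc st + (s + 3), mem = \<mu>1, outp = out\<rparr> =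
       \<lparr>pc = ?l b (pc (exec [] [] ins st)), mem = \<mu>', outp = out\<rparr>"
      using ram_step_at[OF c2] by simp
    have t: "s + 3 + 1 = s + 4" by simp
    show ?thesis using funpow_trans[OF s1 \<open>(ram_step Q x a ^^ 1) _ = _\<close>] unfolding t .
  qed
  then show ?thesis unfolding P using rep' fr' by blast
qed

lemma runs_embed:
  assumes R: "2 \<le> R" and s: "j < s" and h: "halted P (ram_run P [] [] k t)"
    and k: "\<mu> (relocate R s j 0) = k" and z: "\<And>i. 0 < i \<Longrightarrow> \<mu> (relocate R s j i) = 0"
  shows "\<exists>t' \<mu>'. t' \<le> (s + 4) * t \<and> runs x a (embed R s j P) t' (\<mu>, out) (\<mu>', out) \<and>
    (\<forall>i. \<mu>' (relocate R s j i) = mem (ram_run P [] [] k t) i) \<and>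
    (\<forall>r. r \<noteq> R - 2 \<longrightarrow> r \<noteq> R - 1 \<longrightarrow> r \<notin> range (relocate R s j) \<longrightarrow> \<mu>' r = \<mu> r)"
proof -
  let ?st = "\<lambda>i. ram_run P [] [] k i"
  define ini where "ini b = \<lparr>pc = b, mem = \<mu>, outp = out\<rparr>" for b
  have S: "?st (Suc i) = ram_step P [] [] (?st i)" for i by (simp add: ram_run_def)
  \<comment> \<open>After halting, the fragment has been left while \<open>i\<close> still grows;
    hence its running time is only bounded in terms of \<open>i\<close>.\<close>
  define good where "good i t' \<mu>' \<longleftrightarrow> t' \<le> (s + 4) * i \<and>
    (\<forall>Q b. code_at Q b (embed R s j P b) \<longrightarrow>
      (ram_step Q x a ^^ t') (ini b) = \<lparr>pc = b + (s + 4) * min (pc (?st i)) (length P), mem = \<mu>', outp = out\<rparr>) \<and>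
    (\<forall>c. \<mu>' (relocate R s j c) = mem (?st i) c) \<and>
    (\<forall>r. r \<noteq> R - 2 \<longrightarrow> r \<noteq> R - 1 \<longrightarrow> r \<notin> range (relocate R s j) \<longrightarrow> \<mu>' r = \<mu> r)" for i t' \<mu>'
  have "\<exists>t' \<mu>'. good i t' \<mu>'" for i
  proof (induction i)
    case 0
    have "\<mu> (relocate R s j c) = mem (?st 0) c" for c using k z[of c] by (cases "c = 0") (auto simp: ram_run_def)
    then have "good 0 0 \<mu>" by (simp add: good_def ini_def) (simp add: ram_run_def)
    then show ?case by blast
  next
    case (Suc i)
    then obtain t' \<mu>' where g: "good i t' \<mu>'" by blast
    show ?case
    proof (cases "halted P (?st i)")
      case True
      then have "?st (Suc i) = ?st i" by (simp add: S ram_step_def)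
      then have "good (Suc i) t' \<mu>'" using g unfolding good_def by auto
      then show ?thesis by blast
    next
      case False
      have rep: "\<mu>' (relocate R s j c) = mem (?st i) c" for c using g by (simp add: good_def)
      have pcl: "min (pc (?st i)) (length P) = pc (?st i)" using False by (simp add: halted_def)
      from embed_step[OF R s False rep, of x a out]
      obtain \<mu>'' where e: "\<And>Q b. code_at Q b (embed R s j P b) \<Longrightarrow>
          (ram_step Q x a ^^ (s + 4)) \<lparr>pc = b + (s + 4) * pc (?st i), mem = \<mu>', outp = out\<rparr> =
          \<lparr>pc = b + (s + 4) * min (pc (?st (Suc i))) (length P), mem = \<mu>'', outp = out\<rparr>"
        "\<forall>c. \<mu>'' (relocate R s j c) = mem (?st (Suc i)) c"
        "\<And>r. r \<noteq> R - 2 \<Longrightarrow> r \<noteq> R - 1 \<Longrightarrow> r \<notin> range (relocate R s j) \<Longrightarrow> \<mu>'' r = \<mu>' r"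
        unfolding S by blast
      have "(ram_step Q x a ^^ (t' + (s + 4))) (ini b) =
          \<lparr>pc = b + (s + 4) * min (pc (?st (Suc i))) (length P), mem = \<mu>'', outp = out\<rparr>"
        if c: "code_at Q b (embed R s j P b)" for Q b
      proof (rule funpow_trans[OF _ e(1)[OF c]])
        show "(ram_step Q x a ^^ t') (ini b) = \<lparr>pc = b + (s + 4) * pc (?st i), mem = \<mu>', outp = out\<rparr>"
          using g c pcl unfolding good_def by simp
      qed
      moreover have "t' + (s + 4) \<le> (s + 4) * Suc i" using g unfolding good_def by simp
      ultimately have "good (Suc i) (t' + (s + 4)) \<mu>''" using e(2,3) g unfolding good_def by auto
      then show ?thesis by blast
    qed
  qed
  then obtain t' \<mu>' where g: "good t t' \<mu>'" by blast
  have "min (pc (?st t)) (length P) = length P" using h by (simp add: halted_def)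
  then have "runs x a (embed R s j P) t' (\<mu>, out) (\<mu>', out)"
    using g unfolding good_def runs_def ini_def by (simp add: length_embed)
  then show ?thesis using g unfolding good_def by blast
qed

section \<open>Tabulating the amplitudes\<close>

text \<open>Fixing one program and one time bound per number makes the approximations a function of
  the number and the precision.\<close>

definition approximator :: "real \<Rightarrow> instr list \<times> (nat \<Rightarrow> nat)" where
  "approximator r = (SOME PT. polybounded (snd PT) \<and> (\<forall>k. let s = ram_run (fst PT) [] [] k (snd PT k) in
     halted (fst PT) s \<and> \<bar>r - (real (mem s 0) - real (mem s 1)) / 2 ^ k\<bar> \<le> 1 / 2 ^ k))"

definition approx :: "real \<Rightarrow> nat \<Rightarrow> nat \<times> nat" where
  "approx r k = (let s = ram_run (fst (approximator r)) [] [] k (snd (approximator r) k) in (mem s 0, mem s 1))"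

lemma approximator:
  assumes "eff_real r"
  shows "polybounded (snd (approximator r))"
    and "halted (fst (approximator r)) (ram_run (fst (approximator r)) [] [] k (snd (approximator r) k))"
    and "\<bar>r - (real (fst (approx r k)) - real (snd (approx r k))) / 2 ^ k\<bar> \<le> 1 / 2 ^ k"
proof -
  have "\<exists>PT :: instr list \<times> (nat \<Rightarrow> nat). polybounded (snd PT) \<and> (\<forall>k. let s = ram_run (fst PT) [] [] k (snd PT k) in
     halted (fst PT) s \<and> \<bar>r - (real (mem s 0) - real (mem s 1)) / 2 ^ k\<bar> \<le> 1 / 2 ^ k)"
    using assms unfolding eff_real_def by (metis fst_conv snd_conv)
  from someI_ex[OF this, folded approximator_def]
  show "polybounded (snd (approximator r))"
    "halted (fst (approximator r)) (ram_run (fst (approximator r)) [] [] k (snd (approximator r) k))"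
    "\<bar>r - (real (fst (approx r k)) - real (snd (approx r k))) / 2 ^ k\<bar> \<le> 1 / 2 ^ k"
    by (auto simp: approx_def Let_def)
qed

text \<open>Truncated subtraction in both directions yields the positive and the negative part of a
  value, stored as adjacent digits in base \<open>2 ^ u\<close>; the head of the list is least
  significant.\<close>

fun pack :: "nat \<Rightarrow> nat \<Rightarrow> (nat \<times> nat) list \<Rightarrow> nat" where
  "pack u V [] = V"
| "pack u V (v # vs) = (pack u V vs * 2 ^ u + (snd v - fst v)) * 2 ^ u + (fst v - snd v)"

type_synonym ctx = "big \<times> big \<times> nat \<times> big"

abbreviation ctx :: "nat \<Rightarrow> nat \<Rightarrow> nat \<Rightarrow> nat \<Rightarrow> ctx" where
  "ctx N n w V \<equiv> (Big N, Big n, w, Big V)"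

lemma relocate_inj: "j < s \<Longrightarrow> j' < s \<Longrightarrow> relocate R s j i = relocate R s j' i' \<longleftrightarrow> j = j' \<and> i = i'"
proof
  assume a: "j < s" "j' < s" "relocate R s j i = relocate R s j' i'"
  then have e: "s * i + j = s * i' + j'" by (simp add: relocate_def)
  have "(s * i + j) mod s = j" "(s * i' + j') mod s = j'" using a by simp_all
  then have "j = j'" using e by simp
  then show "j = j' \<and> i = i'" using e a(1) by simp
qed simp

lemma poly_bounded_nat: "poly_bounded (\<lambda>_ (w::nat). f w) \<longleftrightarrow> (\<exists>k. \<forall>w. f w \<le> (w + 2) ^ k)"
  by (simp add: poly_bounded_def)

text \<open>The memories in \<open>J\<close> must be blank on entry and the remaining ones are left
  alone, so that machines can be run one after the other. The time depends on \<open>w\<close> only,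
  as the other components are \<open>big\<close>.\<close>

definition tabulates :: "nat \<Rightarrow> nat \<Rightarrow> (nat \<Rightarrow> nat) \<Rightarrow> (nat \<Rightarrow> nat) \<Rightarrow> nat set \<Rightarrow> real list \<Rightarrow>
    (nat \<Rightarrow> instr list) \<Rightarrow> nat \<Rightarrow> bool" where
  "tabulates R s K U J rs G e \<longleftrightarrow> (\<forall>x a \<mu> out N n w V. holds \<mu> 0 (ctx N n w V) \<longrightarrow> (\<forall>i. \<forall>j\<in>J. \<mu> (relocate R s j i) = 0) \<longrightarrow>
      (\<exists>t \<mu>'. t \<le> (w + 2) ^ e \<and> runs x a G t (\<mu>, out) (\<mu>', out) \<and>
        holds \<mu>' 0 (ctx N n w (pack (U w) V (map (\<lambda>r. approx r (K w)) rs))) \<and>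
        (\<forall>i j. j \<notin> J \<longrightarrow> j < s \<longrightarrow> \<mu>' (relocate R s j i) = \<mu> (relocate R s j i))))"

lemma tabulatesD:
  assumes "tabulates R s K U J rs G e" "holds \<mu> 0 (ctx N n w V)" "\<And>i j. j \<in> J \<Longrightarrow> \<mu> (relocate R s j i) = 0"
  shows "\<exists>t \<mu>'. t \<le> (w + 2) ^ e \<and> runs x a G t (\<mu>, out) (\<mu>', out) \<and>
        holds \<mu>' 0 (ctx N n w (pack (U w) V (map (\<lambda>r. approx r (K w)) rs))) \<and>
        (\<forall>i j. j \<notin> J \<longrightarrow> j < s \<longrightarrow> \<mu>' (relocate R s j i) = \<mu> (relocate R s j i))"
  using assms(1)[unfolded tabulates_def, rule_format, OF assms(2,3)] by simp

text \<open>\<open>pack\<close> adds the head last, so the tail is tabulated first; the head then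
  uses memory \<open>length rs\<close>, which is still blank.\<close>

lemma tabulates_Cons:
  assumes "tabulates R s K U {..<length rs} rs G e" "tabulates R s K U {length rs} [r] H f" "length rs < s"
  shows "tabulates R s K U {..<length (r # rs)} (r # rs) (G ;; H) (Suc (max e f))"
  unfolding tabulates_def
proof (intro allI impI)
  fix x a \<mu> out N n w V
  assume h: "holds \<mu> 0 (ctx N n w V)" and z: "\<forall>i. \<forall>j\<in>{..<length (r # rs)}. \<mu> (relocate R s j i) = 0"
  from tabulatesD[OF assms(1) h, of x a out] z obtain t \<mu>' where 1: "t \<le> (w + 2) ^ e" "runs x a G t (\<mu>, out) (\<mu>', out)"
    "holds \<mu>' 0 (ctx N n w (pack (U w) V (map (\<lambda>r. approx r (K w)) rs)))"
    "\<And>i j. j \<notin> {..<length rs} \<Longrightarrow> j < s \<Longrightarrow> \<mu>' (relocate R s j i) = \<mu> (relocate R s j i)" by auto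
  have "\<mu>' (relocate R s j i) = 0" if "j \<in> {length rs}" for i j using 1(4)[of j] assms(3) z that by simp
  from tabulatesD[OF assms(2) 1(3) this, of x a out] obtain t' \<mu>'' where 2: "t' \<le> (w + 2) ^ f" "runs x a H t' (\<mu>', out) (\<mu>'', out)"
    "holds \<mu>'' 0 (ctx N n w (pack (U w) (pack (U w) V (map (\<lambda>r. approx r (K w)) rs)) [approx r (K w)]))"
    "\<And>i j. j \<notin> {length rs} \<Longrightarrow> j < s \<Longrightarrow> \<mu>'' (relocate R s j i) = \<mu>' (relocate R s j i)" by auto
  have "(w + 2) ^ e \<le> (w + 2) ^ max e f" "(w + 2) ^ f \<le> (w + 2) ^ max e f" by (intro power_increasing; simp)+
  moreover have "2 * (w + 2) ^ max e f \<le> (w + 2) ^ Suc (max e f)" by simp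
  ultimately have "t + t' \<le> (w + 2) ^ Suc (max e f)" using 1(1) 2(1) by linarith
  moreover have "\<mu>'' (relocate R s j i) = \<mu> (relocate R s j i)" if "j \<notin> {..<length (r # rs)}" "j < s" for i j
    using 2(4)[of j i] 1(4)[of j i] that by simp
  ultimately show "\<exists>t \<mu>'. t \<le> (w + 2) ^ Suc (max e f) \<and> runs x a (G ;; H) t (\<mu>, out) (\<mu>', out) \<and>
    holds \<mu>' 0 (ctx N n w (pack (U w) V (map (\<lambda>r. approx r (K w)) (r # rs)))) \<and>
    (\<forall>i j. j \<notin> {..<length (r # rs)} \<longrightarrow> j < s \<longrightarrow> \<mu>' (relocate R s j i) = \<mu> (relocate R s j i))"
    using runs_seq[OF 1(2) 2(2)] 2(3) by (intro exI[of _ "t + t'"] exI[of _ \<mu>'']) auto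
qed

text \<open>One \<open>R0\<close> serves all \<open>r\<close>: the fragments that compute the
  precision and pack the result do not depend on \<open>r\<close>, and only their scratch space has
  to end below the relocated memories.\<close>

lemma tabulates_single:
  assumes K: "PC (\<lambda>_. K :: nat \<Rightarrow> nat)" and U: "PC (\<lambda>_. U :: nat \<Rightarrow> nat)"
  shows "\<exists>R0. \<forall>R\<ge>R0. \<forall>j<s. \<forall>r. eff_real r \<longrightarrow> (\<exists>G e. tabulates R s K U {j} [r] G e)"
proof -
  have "PC (\<lambda>_ (c :: ctx). (c, K (fst (snd (snd c)))))" by (intro PC_intros PC_app[OF K])
  then obtain T1 where T1: "computes (\<lambda>_ (c :: ctx). (c, K (fst (snd (snd c))))) T1" "poly_bounded T1"
    unfolding PC_def by blast
  obtain G1 M1 where "implements G1 M1 (\<lambda>_ c. (c, K (fst (snd (snd c))))) (\<lambda>_ _. []) T1"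
    by (rule emitsE[OF T1(1)])
  note G1 = implementsD[OF this]
  define f5 where "f5 p = (fst (fst p), fst (snd (fst p)), fst (snd (snd (fst p))),
     Big (unbig (Big (unbig (Big (unbig (Big (unbig (snd (snd (snd (fst p)))) * 2 ^ U (fst (snd (snd (fst p)))))) +
         unbig (Big (unbig (snd (snd p)) - unbig (fst (snd p)))))) * 2 ^ U (fst (snd (snd (fst p)))))) +
       unbig (Big (unbig (fst (snd p)) - unbig (snd (snd p))))))" for p :: "ctx \<times> big \<times> big"
  have "PC (\<lambda>_. f5)" unfolding f5_def[abs_def] by (intro PC_intros PC_shift PC_app[OF U])
  then obtain T5 where T5: "computes (\<lambda>_. f5) T5" "poly_bounded T5" unfolding PC_def by blast
  obtain G5 M5 where "implements G5 M5 (\<lambda>_. f5) (\<lambda>_ _. []) T5"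
    by (rule emitsE[OF T5(1)])
  note G5 = implementsD[OF this]
  obtain k1 where k1: "\<And>e c. T1 e c \<le> (sz c + 2) ^ k1" using T1(2) unfolding poly_bounded_def by blast
  obtain k5 where k5: "\<And>e c. T5 e c \<le> (sz c + 2) ^ k5" using T5(2) unfolding poly_bounded_def by blast
  \<comment> \<open>The 8 keeps registers 0 to 5, which hold the context and the numbers passed to
    the machine and back, apart from the scratch registers \<open>R - 2\<close> and
    \<open>R - 1\<close>.\<close>
  define R0 where "R0 = M1 + M5 + 8"
  have "\<exists>G e. tabulates R s K U {j} [r] G e" if R: "R0 \<le> R" and js: "j < s" and r: "eff_real r" for R j r
  proof -
    let ?P = "fst (approximator r)" and ?T = "snd (approximator r)" and ?m = "relocate R s j"
    have R8: "8 \<le> R" "M1 \<le> R" "M5 \<le> R" using R by (simp_all add: R0_def)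
    have ge: "R \<le> relocate R s j' i" for j' i by (simp add: relocate_def)
    define G where "G = (G1 0 ;; copyc (?m 0) 4 1 ;; embed R s j ?P ;; copyc 4 (?m 0) 1 ;; copyc 5 (?m 1) 1 ;; G5 0)"
    define B where "B w = (w + 2) ^ k1 + (2 + ((s + 4) * ?T (K w) + (2 + (2 + (w + 2) ^ k5))))" for w
    obtain c where c: "\<And>k. ?T k \<le> c * k ^ c + c" using approximator(1)[OF r] unfolding polybounded_def by blast
    have "poly_bounded (\<lambda>_ w. c * K w ^ c + c)"
      by (intro poly_bounded_add poly_bounded_mult poly_bounded_power poly_bounded_const PC_size_nat K)
    then have tk: "poly_bounded (\<lambda>_ w. ?T (K w))" by (rule poly_bounded_mono) (rule c)
    have "poly_bounded (\<lambda>_ (w::nat). w)" by (rule PC_size_nat) (rule PC_id)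
    then have "poly_bounded (\<lambda>_ w. B w)" unfolding B_def
      by (intro poly_bounded_add poly_bounded_mult poly_bounded_power poly_bounded_const tk)
    then obtain e where e: "\<And>w. B w \<le> (w + 2) ^ e" unfolding poly_bounded_nat by blast
    have "\<exists>t \<mu>'. t \<le> B w \<and> runs x a G t (\<mu>, out) (\<mu>', out) \<and>
        holds \<mu>' 0 (ctx N n w (pack (U w) V (map (\<lambda>r. approx r (K w)) [r]))) \<and>
        (\<forall>i j'. j' \<notin> {j} \<longrightarrow> j' < s \<longrightarrow> \<mu>' (relocate R s j' i) = \<mu> (relocate R s j' i))"
      if h: "holds \<mu> 0 (ctx N n w V)" and z: "\<forall>i. \<forall>j\<in>{j}. \<mu> (relocate R s j i) = 0" for x a \<mu> out N n w V
    proof -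
      from G1[OF h, of x a out] obtain t1 \<mu>1 where 1: "t1 \<le> T1 (x, a) (ctx N n w V)" "runs x a (G1 0) t1 (\<mu>, out) (\<mu>1, out)"
        "holds \<mu>1 0 (ctx N n w V, K w)" "\<And>j. 0 + M1 \<le> j \<Longrightarrow> \<mu>1 j = \<mu> j" by auto
      have z1: "\<mu>1 (?m i) = 0" for i using 1(4)[of "?m i"] z R8 ge[of j i] by simp
      have k: "\<mu>1 4 = K w" and h1: "holds \<mu>1 0 (ctx N n w V)" using 1(3) by (simp_all add: holds_prod numeral_eq_Suc)
      define \<mu>2 where "\<mu>2 = (\<lambda>i. if ?m 0 \<le> i \<and> i < ?m 0 + 1 then \<mu>1 (4 + (i - ?m 0)) else \<mu>1 i)"
      have 2: "runs x a (copyc (?m 0) 4 1) (2 * 1) (\<mu>1, out) (\<mu>2, out)"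
        unfolding \<mu>2_def by (rule runs_copy) (use ge[of j 0] R8 in simp)
      have m2: "\<mu>2 (?m 0) = K w" "\<And>i. 0 < i \<Longrightarrow> \<mu>2 (?m i) = 0"
        using z1 k relocate_inj[OF js js] by (auto simp: \<mu>2_def not_less less_Suc_eq_le le_antisym)
      have R2: "2 \<le> R" using R8 by simp
      from runs_embed[where \<mu> = \<mu>2 and x = x and a = a and out = out, OF R2 js approximator(2)[OF r] m2] obtain t3 \<mu>3 where
        3: "t3 \<le> (s + 4) * ?T (K w)" "runs x a (embed R s j ?P) t3 (\<mu>2, out) (\<mu>3, out)"
        "\<And>i. \<mu>3 (?m i) = mem (ram_run ?P [] [] (K w) (?T (K w))) i"
        "\<And>i. i \<noteq> R - 2 \<Longrightarrow> i \<noteq> R - 1 \<Longrightarrow> i \<notin> range ?m \<Longrightarrow> \<mu>3 i = \<mu>2 i" by blast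
      have low3: "\<mu>3 i = \<mu>1 i" if i: "i < 6" for i
      proof -
        have ni: "i \<noteq> ?m i'" for i' using ge[of j i'] i R8 by linarith
        then have "\<mu>3 i = \<mu>2 i" using i R8 by (intro 3(4)) auto
        moreover have "\<not> (?m 0 \<le> i)" using ge[of j 0] i R8 by linarith
        ultimately show ?thesis by (simp add: \<mu>2_def)
      qed
      define \<mu>4 where "\<mu>4 = (\<lambda>i. if 4 \<le> i \<and> i < 4 + 1 then \<mu>3 (?m 0 + (i - 4)) else \<mu>3 i)"
      have 4: "runs x a (copyc 4 (?m 0) 1) (2 * 1) (\<mu>3, out) (\<mu>4, out)"
        unfolding \<mu>4_def by (rule runs_copy) (use ge[of j 0] R8 in simp)
      define \<mu>5 where "\<mu>5 = (\<lambda>i. if 5 \<le> i \<and> i < 5 + 1 then \<mu>4 (?m 1 + (i - 5)) else \<mu>4 i)"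
      have 5: "runs x a (copyc 5 (?m 1) 1) (2 * 1) (\<mu>4, out) (\<mu>5, out)"
        unfolding \<mu>5_def by (rule runs_copy) (use ge[of j 1] R8 in simp)
      have v: "\<mu>5 4 = fst (approx r (K w))" "\<mu>5 5 = snd (approx r (K w))"
        using 3(3)[of 0] 3(3)[of 1] ge[of j 1] R8 by (simp_all add: \<mu>5_def \<mu>4_def approx_def Let_def)
      have "holds \<mu>5 0 (ctx N n w V)"
        by (rule holds_frame[OF h1]) (use low3 in \<open>simp add: \<mu>5_def \<mu>4_def\<close>)
      then have h5: "holds \<mu>5 0 (ctx N n w V, Big (fst (approx r (K w))), Big (snd (approx r (K w))))"
        using v by (simp add: holds_prod numeral_eq_Suc)
      from G5[OF h5, of x a out] obtain t6 \<mu>6 where 6: "t6 \<le> T5 (x, a) (ctx N n w V, Big (fst (approx r (K w))), Big (snd (approx r (K w))))"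
        "runs x a (G5 0) t6 (\<mu>5, out) (\<mu>6, out)" "holds \<mu>6 0 (f5 (ctx N n w V, Big (fst (approx r (K w))), Big (snd (approx r (K w)))))"
        "\<And>j. 0 + M5 \<le> j \<Longrightarrow> \<mu>6 j = \<mu>5 j" by auto
      have "f5 (ctx N n w V, Big (fst (approx r (K w))), Big (snd (approx r (K w)))) = ctx N n w (pack (U w) V [approx r (K w)])"
        by (simp add: f5_def)
      then have h6: "holds \<mu>6 0 (ctx N n w (pack (U w) V [approx r (K w)]))" using 6(3) by simp
      have fr: "\<mu>6 (relocate R s j' i) = \<mu> (relocate R s j' i)" if "j' \<noteq> j" "j' < s" for i j'
      proof -
        let ?i = "relocate R s j' i"
        have R: "R \<le> ?i" by (rule ge)
        have ni: "?i \<notin> range ?m" using relocate_inj[OF that(2) js] that(1) by auto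
        have "\<mu>6 ?i = \<mu>5 ?i" using R R8 by (intro 6(4)) simp
        also have "\<dots> = \<mu>3 ?i" using R R8 by (simp add: \<mu>5_def \<mu>4_def)
        also have "\<dots> = \<mu>2 ?i" using R R8 ni by (intro 3(4)) auto
        also have "\<dots> = \<mu>1 ?i"
        proof -
          have "?i \<noteq> ?m 0" using ni by auto
          then have "\<not> (?m 0 \<le> ?i \<and> ?i < ?m 0 + 1)" by linarith
          then show ?thesis unfolding \<mu>2_def by (simp only: if_False)
        qed
        also have "\<dots> = \<mu> ?i" using R R8 by (intro 1(4)) simp
        finally show ?thesis .
      qed
      have "t1 + (2 * 1 + (t3 + (2 * 1 + (2 * 1 + t6)))) \<le> B w"
      proof -
        have "t1 \<le> (w + 2) ^ k1" using order_trans[OF 1(1) k1] by simp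
        moreover have "t6 \<le> (w + 2) ^ k5" using order_trans[OF 6(1) k5] by simp
        ultimately show ?thesis using 3(1) unfolding B_def by linarith
      qed
      moreover have "runs x a G (t1 + (2 * 1 + (t3 + (2 * 1 + (2 * 1 + t6))))) (\<mu>, out) (\<mu>6, out)"
        unfolding G_def by (rule runs_seq[OF 1(2) runs_seq[OF 2 runs_seq[OF 3(2) runs_seq[OF 4 runs_seq[OF 5 6(2)]]]]])
      ultimately show ?thesis using h6 fr by auto
    qed
    note st = this
    have "tabulates R s K U {j} [r] G e"
      unfolding tabulates_def
    proof (intro allI impI, goal_cases)
      case (1 x a \<mu> out N n w V)
      from st[OF this, of x a out] show ?case using order_trans[OF _ e[of w]] by blast
    qed
    then show ?thesis by blast
  qed
  then show ?thesis by (intro exI[of _ R0]) simp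
qed

lemma amplitude_table:
  assumes "PC (\<lambda>_. K :: nat \<Rightarrow> nat)" "PC (\<lambda>_. U :: nat \<Rightarrow> nat)"
  shows "\<exists>R0. \<forall>R\<ge>R0. \<forall>rs. length rs \<le> s \<longrightarrow> (\<forall>r\<in>set rs. eff_real r) \<longrightarrow>
    (\<exists>G e. tabulates R s K U {..<length rs} rs G e)"
proof -
  obtain R0 where R0: "\<And>R j r. R0 \<le> R \<Longrightarrow> j < s \<Longrightarrow> eff_real r \<Longrightarrow> \<exists>G e. tabulates R s K U {j} [r] G e"
    using tabulates_single[OF assms, of s] by (elim exE) metis
  have "\<exists>G e. tabulates R s K U {..<length rs} rs G e"
    if "R0 \<le> R" and "length rs \<le> s" and "\<forall>r\<in>set rs. eff_real r" for R rs
    using that(2,3)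
  proof (induction rs)
    case Nil
    have "tabulates R s K U {..<length []} [] (\<lambda>_. []) 0"
      unfolding tabulates_def
    proof (intro allI impI, goal_cases)
      case (1 x a \<mu> out N n w V)
      then show ?case using runs_nil[of x a "(\<mu>, out)"] by (intro exI[of _ 0] exI[of _ \<mu>]) simp
    qed
    then show ?case by blast
  next
    case (Cons r rs)
    then show ?case using tabulates_Cons R0[OF that(1), of "length rs" r] by fastforce
  qed
  then show ?thesis by (intro exI[of _ R0]) simp
qed

lemma pack_digits:
  assumes "\<And>v. v \<in> set vs \<Longrightarrow> fst v - snd v < 2 ^ u \<and> snd v - fst v < 2 ^ u" "i < length vs"
  shows "pack u V vs div (2 ^ u) ^ (2 * i) mod 2 ^ u = fst (vs ! i) - snd (vs ! i)"
    and "pack u V vs div (2 ^ u) ^ (2 * i + 1) mod 2 ^ u = snd (vs ! i) - fst (vs ! i)"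
proof -
  have "pack u V vs div (2 ^ u) ^ (2 * i) mod 2 ^ u = fst (vs ! i) - snd (vs ! i) \<and>
    pack u V vs div (2 ^ u) ^ (2 * i + 1) mod 2 ^ u = snd (vs ! i) - fst (vs ! i)"
    using assms
  proof (induction vs arbitrary: i)
    case (Cons v vs)
    have v: "fst v - snd v < 2 ^ u" "snd v - fst v < 2 ^ u" using Cons.prems(1)[of v] by auto
    let ?p = "pack u V vs"
    have 1: "pack u V (v # vs) div 2 ^ u = ?p * 2 ^ u + (snd v - fst v)" using v by simp
    have 2: "pack u V (v # vs) div 2 ^ u div 2 ^ u = ?p" unfolding 1 using v by simp
    show ?case
    proof (cases i)
      case 0
      have "pack u V (v # vs) mod 2 ^ u = fst v - snd v" using v by simp
      moreover have "pack u V (v # vs) div 2 ^ u mod 2 ^ u = snd v - fst v" unfolding 1 using v by simp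
      ultimately show ?thesis using 0 by (simp del: pack.simps)
    next
      case (Suc k)
      have "(2 ^ u) ^ (2 * i) = 2 ^ u * 2 ^ u * ((2::nat) ^ u) ^ (2 * k)"
        "(2 ^ u) ^ (2 * i + 1) = 2 ^ u * 2 ^ u * ((2::nat) ^ u) ^ (2 * k + 1)" by (simp_all add: Suc)
      then have d: "pack u V (v # vs) div (2 ^ u) ^ (2 * i) = ?p div (2 ^ u) ^ (2 * k)"
        "pack u V (v # vs) div (2 ^ u) ^ (2 * i + 1) = ?p div (2 ^ u) ^ (2 * k + 1)"
        by (simp_all only: div_mult2_eq 2)
      show ?thesis unfolding d using Cons.IH[of k] Cons.prems Suc by simp
    qed
  qed simp
  then show "pack u V vs div (2 ^ u) ^ (2 * i) mod 2 ^ u = fst (vs ! i) - snd (vs ! i)"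
    "pack u V vs div (2 ^ u) ^ (2 * i + 1) mod 2 ^ u = snd (vs ! i) - fst (vs ! i)" by auto
qed

section \<open>Growth rates in terms of the number of digits\<close>

lemma power_bits_le: "0 < n \<Longrightarrow> 2 ^ (bits n - 1) \<le> n"
proof (cases "LEAST i. n < 2 ^ Suc i")
  case (Suc i)
  then have "\<not> n < 2 ^ Suc i" using not_less_Least[of i "\<lambda>i. n < 2 ^ Suc i"] by simp
  then show ?thesis unfolding bits_def Suc by simp
qed (simp add: bits_def)

lemma bits_log:
  assumes "0 < n"
  shows "log 2 (real n) \<le> real (bits n)" "real (bits n) \<le> log 2 (real n) + 1"
proof -
  show "log 2 (real n) \<le> real (bits n)"
    by (rule log2_of_power_le) (use less_bits[of n] assms in auto)
  have "real (bits n - 1) \<le> log 2 (real n)" by (rule le_log2_of_power) (rule power_bits_le[OF assms])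
  then show "real (bits n) \<le> log 2 (real n) + 1" using bits_pos[of n] by (simp add: of_nat_diff)
qed

lemma polylog_bits:
  assumes "poly_bounded (\<lambda>_ (w::nat). f w)"
  shows "polylog (\<lambda>n. f (bits n))"
proof -
  obtain k where k: "\<And>w. f w \<le> (w + 2) ^ k" using assms unfolding poly_bounded_nat by blast
  have "(\<lambda>n. real (f (bits n))) \<in> O(\<lambda>n. log 2 (real n) ^ k)"
  \<comment> \<open>For \<open>n \<ge> 2\<close> the logarithm is at least 1, so
    \<open>bits n + 2\<close>, at most the logarithm plus 3, is at most 4 times the
    logarithm.\<close>
  proof (rule bigoI[where c = "4 ^ k"], rule eventually_mono[OF eventually_ge_at_top[of 2]])
    fix n :: nat assume n: "2 \<le> n"
    have l: "1 \<le> log 2 (real n)" using n by (simp add: le_log_iff)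
    have "real (f (bits n)) \<le> real ((bits n + 2) ^ k)" using k[of "bits n"] by (simp only: of_nat_le_iff)
    also have "\<dots> = (real (bits n) + 2) ^ k" by (simp add: add.commute)
    also have "\<dots> \<le> (4 * log 2 (real n)) ^ k"
    proof (rule power_mono)
      have "0 < n" using n by simp
      from bits_log(2)[OF this] l show "real (bits n) + 2 \<le> 4 * log 2 (real n)" by linarith
    qed simp
    finally show "norm (real (f (bits n))) \<le> 4 ^ k * norm (log 2 (real n) ^ k)"
      using l by (simp add: power_mult_distrib)
  qed
  then show ?thesis unfolding polylog_def by blast
qed

lemma polylog_bound:
  assumes "polylog T"
  obtains \<kappa> where "\<And>n. T n \<le> \<kappa> * bits n ^ \<kappa>"
proof -
  obtain c where "(\<lambda>n. real (T n)) \<in> O(\<lambda>n. log 2 (real n) ^ c)" using assms unfolding polylog_def by blast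
  then obtain C where C: "\<forall>\<^sub>F n in sequentially. norm (real (T n)) \<le> C * norm (log 2 (real n) ^ c)"
    by (rule landau_o.bigE)
  then obtain n0 where n0: "\<And>n. n0 \<le> n \<Longrightarrow> real (T n) \<le> C * \<bar>log 2 (real n)\<bar> ^ c"
    unfolding eventually_sequentially by (auto simp: power_abs)
  \<comment> \<open>Absorbs the Landau constant and the finitely many \<open>n\<close> on which the
    asymptotic bound is silent.\<close>
  define B where "B = nat \<lceil>\<bar>C\<bar>\<rceil> + (\<Sum>n\<le>n0. T n)"
  have "T n \<le> (B + c) * bits n ^ (B + c)" for n
  proof -
    have b: "1 \<le> bits n" using bits_pos[of n] by simp
    have "T n \<le> B * bits n ^ c"
    proof (cases "n \<le> n0")
      case True
      then have "T n \<le> (\<Sum>n\<le>n0. T n)" by (intro member_le_sum) auto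
      also have "\<dots> \<le> B * 1" by (simp add: B_def)
      also have "\<dots> \<le> B * bits n ^ c" using b by (intro mult_le_mono2) simp
      finally show ?thesis .
    next
      case False
      then have n: "0 < n" "n0 \<le> n" by auto
      have "0 \<le> log 2 (real n)" using n by simp
      have "real (T n) \<le> C * \<bar>log 2 (real n)\<bar> ^ c" by (rule n0[OF n(2)])
      also have "\<dots> \<le> \<bar>C\<bar> * real (bits n) ^ c"
        using bits_log(1)[OF n(1)] \<open>0 \<le> log 2 (real n)\<close> by (intro mult_mono power_mono) auto
      also have "\<dots> \<le> real B * real (bits n) ^ c"
      proof (intro mult_right_mono)
        have "\<bar>C\<bar> \<le> real (nat \<lceil>\<bar>C\<bar>\<rceil>)" by linarith
        moreover have "nat \<lceil>\<bar>C\<bar>\<rceil> \<le> B" by (simp add: B_def)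
        ultimately show "\<bar>C\<bar> \<le> real B" by linarith
      qed simp
      finally have "real (T n) \<le> real (B * bits n ^ c)" by simp
      then show ?thesis by (simp only: of_nat_le_iff)
    qed
    also have "\<dots> \<le> (B + c) * bits n ^ (B + c)"
      using b by (intro mult_le_mono power_increasing) auto
    finally show ?thesis .
  qed
  then show thesis using that by blast
qed

section \<open>Emitting a table\<close>

lemma PC_iff [PC_intros]: "PC p \<Longrightarrow> PC q \<Longrightarrow> PC (\<lambda>e c. p e c = (q e c :: bool))"
proof -
  assume "PC p" "PC q"
  then have "PC (\<lambda>e c. (p e c \<and> q e c) \<or> (\<not> p e c \<and> \<not> q e c))" by (intro PC_intros)
  moreover have "(P \<and> Q \<or> \<not> P \<and> \<not> Q) = (P = Q)" for P Q by auto
  ultimately show ?thesis by simp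
qed

text \<open>The counterpart of \<open>PC_rec\<close> for output: the context must survive every
  round, so each bit is computed on a copy of the loop state.\<close>

lemma emits_table:
  fixes h :: "'c::regs \<Rightarrow> nat \<Rightarrow> bool" and m :: "'c \<Rightarrow> nat"
  assumes h: "PC (\<lambda>_ p. h (fst p) (snd p))" and m: "PC (\<lambda>_. m)"
  shows "\<exists>T. emits (\<lambda>_ c. (c, 0::nat, m c)) (\<lambda>_ c. map (h c) [0..<m c]) T \<and> poly_bounded T"
proof -
  define st where "st p = (fst p, fst (snd p) - 1, snd (snd p) + 1)" for p :: "'c \<times> nat \<times> nat"
  have "PC (\<lambda>_. st)" unfolding st_def[abs_def] by (intro PC_intros)
  then obtain T1 where T1: "computes (\<lambda>_. st) T1" "poly_bounded T1" unfolding PC_def by blast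
  have "PC (\<lambda>_ p :: 'c \<times> nat \<times> nat. h (fst p) (snd (snd p)))"
    using PC_comp[OF PC_pair[OF PC_fst[OF PC_id] PC_snd[OF PC_snd[OF PC_id]]] h] by simp
  then obtain T2 where T2: "computes (\<lambda>_ p :: 'c \<times> nat \<times> nat. h (fst p) (snd (snd p))) T2" "poly_bounded T2"
    unfolding PC_def by blast
  define T where "T e p = T2 e p + 2 * width TYPE('c \<times> nat \<times> nat) + 1 + T1 e p" for e p
  have T: "emits (\<lambda>_. st) (\<lambda>_ p. [h (fst p) (snd (snd p))]) T"
    using emits_comp[OF emits_bit[OF T2(1)] T1(1), of T] by (simp add: T_def)
  have Tb: "poly_bounded T" unfolding T_def[abs_def] by (intro poly_bounded_add poly_bounded_const T1 T2)
  have "PC (\<lambda>_ (p :: 'c \<times> nat \<times> nat). fst (snd p))" by (intro PC_intros)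
  then obtain R where R: "computes (\<lambda>_ (p :: 'c \<times> nat \<times> nat). fst (snd p)) R" "poly_bounded R"
    unfolding PC_def by blast
  have it: "(st ^^ i) p = (fst p, fst (snd p) - i, snd (snd p) + i)" for i p
    by (induction i) (simp_all add: st_def)
  define U where "U e p = (\<Sum>i<fst (snd p). R e ((st ^^ i) p) + T e ((st ^^ i) p) + 2 * width TYPE('c \<times> nat \<times> nat) + 2)
         + R e ((st ^^ fst (snd p)) p) + 2 * width TYPE('c \<times> nat \<times> nat) + 1" for e p
  have W: "emits (\<lambda>_ p. (fst p, 0::nat, snd (snd p) + fst (snd p)))
      (\<lambda>_ p. map (\<lambda>i. h (fst p) (snd (snd p) + i)) [0..<fst (snd p)]) U"
    by (rule emits_mono[OF emits_while[where m = "\<lambda>_ p. fst (snd p)" and U = U, OF R(1) T]])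
      (auto simp: it U_def)
  have "PC (\<lambda>_ c. (c, m c, 0::nat))" by (intro PC_intros m)
  then obtain T0 where T0: "computes (\<lambda>_ c. (c, m c, 0::nat)) T0" "poly_bounded T0" unfolding PC_def by blast
  obtain kR where kR: "\<And>e c. R e c \<le> (sz c + 2) ^ kR" using R(2) unfolding poly_bounded_def by blast
  obtain kT where kT: "\<And>e c. T e c \<le> (sz c + 2) ^ kT" using Tb unfolding poly_bounded_def by blast
  let ?S = "\<lambda>c. sz c + m c + 2"
  define V where "V e c = T0 e c + (m c * (?S c ^ kR + ?S c ^ kT + 2 * width TYPE('c \<times> nat \<times> nat) + 2)
     + ?S c ^ kR + 2 * width TYPE('c \<times> nat \<times> nat) + 1)" for e c
  have V: "poly_bounded V" unfolding V_def[abs_def]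
    by (intro poly_bounded_add poly_bounded_const poly_bounded_mult poly_bounded_power poly_bounded_sz T0(2) PC_size_nat m)
  have UV: "T0 e c + U e (c, m c, 0) \<le> V e c" for e c
  proof -
    have R': "R e ((st ^^ i) (c, m c, 0)) \<le> ?S c ^ kR" if "i \<le> m c" for i
      by (rule order_trans[OF kR]) (rule power_mono, use that in \<open>auto simp: it\<close>)
    have T': "T e ((st ^^ i) (c, m c, 0)) \<le> ?S c ^ kT" if "i \<le> m c" for i
      by (rule order_trans[OF kT]) (rule power_mono, use that in \<open>auto simp: it\<close>)
    have "(\<Sum>i<m c. R e ((st ^^ i) (c, m c, 0)) + T e ((st ^^ i) (c, m c, 0)) + 2 * width TYPE('c \<times> nat \<times> nat) + 2)
      \<le> (\<Sum>i<m c. ?S c ^ kR + ?S c ^ kT + 2 * width TYPE('c \<times> nat \<times> nat) + 2)"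
      by (rule sum_mono) (use R' T' in \<open>auto intro!: add_mono\<close>)
    then show ?thesis using R'[of "m c"] unfolding U_def V_def fst_conv snd_conv by simp
  qed
  have "emits (\<lambda>_ c. (c, 0::nat, m c)) (\<lambda>_ c. map (h c) [0..<m c]) V"
    by (rule emits_mono[OF emits_comp[OF T0(1) W UV]]) auto
  then show ?thesis using V by blast
qed

section \<open>The decision tree as a table\<close>

context machine
begin

definition tree_query :: "prm \<Rightarrow> nat \<Rightarrow> nat \<Rightarrow> nat" where
  "tree_query p E k = next_query (pN p) (base p) (nfields (pw p)) (pn p) (csize (pw p)) (accepts p) E k"

definition depth :: "prm \<Rightarrow> nat" where "depth p = csize (pw p) * csize (pw p)"

text \<open>The number of replies in a transcript, read off from its magnitude: with the leading
  digit 1, \<open>k\<close> replies give a number from \<open>\<beta> ^ k\<close> up to below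
  \<open>2 * \<beta> ^ k\<close>.\<close>

definition level :: "prm \<Rightarrow> nat \<Rightarrow> nat" where
  "level p E = (\<Sum>j<depth p. of_bool (min (pN p) (base p ^ (j + 1)) \<le> E))"

text \<open>
  The table is addressed by transcripts with a leading digit 1.  An inner transcript \<open>E\<close> stores the
  next query, most significant bit first, at positions \<open>w * E, \<dots>, w * E + w - 1\<close>; a transcript
  of full length stores the answer at position \<open>w * E\<close>.
\<close>

definition table_bit :: "prm \<Rightarrow> nat \<Rightarrow> bool" where
  "table_bit p J = (let E = J div pw p; k = level p E in
     if k < depth p then tree_query p E k div min (pN p) (2 ^ (pw p - 1 - J mod pw p)) mod 2 = 1
     else accepts p (E - min (pN p) (base p ^ depth p)))"

lemma PC_tree_query [PC_intros]: "PC p \<Longrightarrow> PC E \<Longrightarrow> PC k \<Longrightarrow> PC (\<lambda>e c. tree_query (p e c) (E e c) (k e c))"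
  by (rule PC_lift3[where f = tree_query])
    (unfold tree_query_def next_query_def choice_def certifies_def compatible_def agrees_def claims_def, intro PC_intros)

lemma PC_depth [PC_intros]: "PC p \<Longrightarrow> PC (\<lambda>e c. depth (p e c))"
  unfolding depth_def by (intro PC_intros)

lemma PC_level [PC_intros]: "PC p \<Longrightarrow> PC E \<Longrightarrow> PC (\<lambda>e c. level (p e c) (E e c))"
  by (rule PC_lift2[where f = level]) (unfold level_def, intro PC_intros)

lemma PC_table_bit: "PC (\<lambda>_ c. table_bit (fst c) (snd c))"
  unfolding table_bit_def Let_def by (intro PC_intros)

end

section \<open>The preprocessing machine\<close>

lemma pack_less:
  assumes "\<And>v. v \<in> set vs \<Longrightarrow> fst v - snd v < 2 ^ u \<and> snd v - fst v < 2 ^ u"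
  shows "pack u 0 vs < (2 ^ u) ^ (2 * length vs)"
  using assms
proof (induction vs)
  case (Cons v vs)
  have v: "fst v - snd v < 2 ^ u" "snd v - fst v < 2 ^ u" using Cons.prems[of v] by auto
  define B :: nat where "B = 2 ^ u"
  define X where "X = B ^ (2 * length vs)"
  have IH: "pack u 0 vs + 1 \<le> X" using Cons unfolding X_def B_def by simp
  have "pack u 0 vs * B + (snd v - fst v) + 1 \<le> (pack u 0 vs + 1) * B" using v by (simp add: B_def)
  also have "\<dots> \<le> X * B" using IH by (rule mult_le_mono1)
  finally have 1: "pack u 0 vs * B + (snd v - fst v) + 1 \<le> X * B" .
  have "pack u 0 (v # vs) < (pack u 0 vs * B + (snd v - fst v) + 1) * B" using v by (simp add: B_def)
  also have "\<dots> \<le> X * B * B" using 1 by (rule mult_le_mono1)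
  also have "X * B * B = B ^ (2 * length (v # vs))" by (simp add: X_def mult_ac)
  finally show ?case unfolding B_def .
qed simp

lemma of_nat_diff_max: "real (a - b) = max 0 (real a - real b)"
  by (auto simp: max_def of_nat_diff)

lemma power_le_two_power: "(b::nat) ^ m \<le> 2 ^ (b * m)"
proof -
  have "b ^ m \<le> (2 ^ b) ^ m" by (rule power_mono) (auto simp: less_imp_le)
  then show ?thesis by (simp add: power_mult)
qed

section \<open>Choice of the cap and correctness of the table\<close>

locale reduction = machine M act nY D es eq S g \<kappa>
  for M :: "('q::finite, 's::finite) qtm" and act :: "nat \<Rightarrow> ('q, 's) action"
    and nY D es eq S g \<kappa> +
  fixes nq \<Lambda> :: nat and L :: "bool list set" and T m :: "nat \<Rightarrow> nat"
  assumes nq: "eq q < nq"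
    and \<Lambda>: "part u (delta M a b) + 1 \<le> real \<Lambda>" "2 \<le> \<Lambda>" "D * \<Lambda> \<le> 2 ^ g"
    and dec: "qtm_decides M L T m" and T: "T n \<le> steps (bits n)"
begin

definition nent :: nat where "nent = nq * S * S * nY"

text \<open>Decodes the mixed-radix index of \<open>entry\<close> without its last digit, the
  part.\<close>

definition amp :: "nat \<Rightarrow> complex" where
  "amp a = delta M (inv eq (a div nY div S div S), inv es (a div nY div S mod S), inv es (a div nY mod S)) (act (a mod nY))"

text \<open>Real and imaginary parts alternate. As \<open>pack\<close> stores two digits per value,
  amplitude \<open>a\<close> occupies the digits \<open>4 * a\<close> to \<open>4 * a + 3\<close>,
  in the order of \<open>part\<close>.\<close>

definition amps :: "real list" where
  "amps = map (\<lambda>i. if even i then Re (amp (i div 2)) else Im (amp (i div 2))) [0..<2 * nent]"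

definition ux :: "nat \<Rightarrow> nat" where "ux w = prec w + g"

text \<open>Each summand is an exponent needed for one family of numbers below the cap. The sum is
  polynomial in \<open>w\<close>, so the cap \<open>2 ^ capx w\<close> is quasipolynomial in
  \<open>n\<close>.\<close>

definition capx :: "nat \<Rightarrow> nat" where
  "capx w = nq + S * (2 * origin w) + D * steps w + 2 * prec w * steps w + ux w * (steps w + 4 * nent + 1)
     + origin w + (w + 1) * (nfields w + 1) + w + 1"

definition vals :: "nat \<Rightarrow> (nat \<times> nat) list" where
  "vals w = map (\<lambda>r. approx r (prec w)) amps"

definition params :: "nat \<Rightarrow> prm" where
  "params n = (2 ^ capx (bits n), n, bits n, pack (ux (bits n)) 0 (vals (bits n)))"

lemma PC_ux: "PC (\<lambda>_. ux)" and PC_capx: "PC (\<lambda>_. capx)"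
  unfolding ux_def[abs_def] capx_def[abs_def] by (intro PC_intros)+

lemma eff_amp: "eff_real (Re (amp a))" "eff_real (Im (amp a))"
  using wf unfolding amp_def well_formed_def eff_complex_def by blast+

lemma amps_cases:
  assumes "r \<in> set amps"
  obtains a where "r = Re (amp a) \<or> r = Im (amp a)"
  using assms by (auto simp: amps_def split: if_splits)

lemma eff_amps: "r \<in> set amps \<Longrightarrow> eff_real r"
  by (erule amps_cases) (use eff_amp in auto)

lemma amps_bound:
  assumes "r \<in> set amps"
  shows "\<bar>r\<bar> + 1 \<le> real \<Lambda>"
proof -
  obtain a where r: "r = Re (amp a) \<or> r = Im (amp a)" using assms by (rule amps_cases)
  have p: "part u (amp a) + 1 \<le> real \<Lambda>" for u unfolding amp_def by (rule \<Lambda>(1))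
  show ?thesis using r p[of 0] p[of 1] p[of 2] p[of 3] by (auto simp: part_def abs_if)
qed

lemma approx_close:
  assumes "eff_real r"
  shows "\<bar>real (fst (approx r k) - snd (approx r k)) / 2 ^ k - max 0 r\<bar> \<le> 1 / 2 ^ k"
    and "\<bar>real (snd (approx r k) - fst (approx r k)) / 2 ^ k - max 0 (- r)\<bar> \<le> 1 / 2 ^ k"
proof -
  define v where "v = (real (fst (approx r k)) - real (snd (approx r k))) / 2 ^ k"
  have c: "\<bar>r - v\<bar> \<le> 1 / 2 ^ k" unfolding v_def by (rule approximator(3)[OF assms])
  have "max 0 (x::real) / 2 ^ k = max 0 (x / 2 ^ k)" for x
    using max_divide_distrib_right[of 0 x "2 ^ k"] by simp
  then have "real (fst (approx r k) - snd (approx r k)) / 2 ^ k = max 0 v"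
    "real (snd (approx r k) - fst (approx r k)) / 2 ^ k = max 0 (- v)"
    unfolding of_nat_diff_max v_def by (simp_all add: minus_divide_left)
  then show "\<bar>real (fst (approx r k) - snd (approx r k)) / 2 ^ k - max 0 r\<bar> \<le> 1 / 2 ^ k"
    "\<bar>real (snd (approx r k) - fst (approx r k)) / 2 ^ k - max 0 (- r)\<bar> \<le> 1 / 2 ^ k"
    using c by (simp_all only: max_def) (smt (verit))+
qed

lemma vals_less:
  assumes "v \<in> set (vals w)"
  shows "fst v - snd v < 2 ^ ux w \<and> snd v - fst v < 2 ^ ux w"
proof -
  obtain r where r: "r \<in> set amps" "v = approx r (prec w)" using assms by (auto simp: vals_def)
  \<comment> \<open>\<open>D\<close> is a positive multiple of 4, which makes the bound on
    \<open>\<Lambda>\<close> strict; the scaled values must lie strictly below the base of the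
    table.\<close>
  have "\<Lambda> < 2 ^ g"
  proof -
    have "2 * \<Lambda> \<le> D * \<Lambda>" using D D_pos by (intro mult_le_mono1) simp
    then show ?thesis using \<Lambda>(2,3) by linarith
  qed
  then have lt: "real \<Lambda> * 2 ^ prec w < 2 ^ ux w"
    unfolding ux_def power_add by (simp add: mult.commute)
  have b: "x < 2 ^ ux w" if "\<bar>real x / 2 ^ prec w - max 0 y\<bar> \<le> 1 / 2 ^ prec w" "\<bar>y\<bar> + 1 \<le> real \<Lambda>" for x :: nat and y
  proof -
    have "(1::real) / 2 ^ prec w \<le> 1" by simp
    moreover have "max 0 y \<le> \<bar>y\<bar>" by simp
    ultimately have "real x / 2 ^ prec w \<le> real \<Lambda>" using abs_le_D1[OF that(1)] that(2) by linarith
    then have "real x \<le> real \<Lambda> * 2 ^ prec w" by (simp add: pos_divide_le_eq)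
    then have "real x < 2 ^ ux w" using lt by linarith
    then show ?thesis by simp
  qed
  show ?thesis unfolding r(2)
    using b[OF approx_close(1)[OF eff_amps[OF r(1)]] amps_bound[OF r(1)]]
      b[OF approx_close(2)[OF eff_amps[OF r(1)]]] amps_bound[OF r(1)] by simp
qed

lemma capx_ge: "e \<le> capx w \<Longrightarrow> x \<le> 2 ^ e \<Longrightarrow> x \<le> (2::nat) ^ capx w"
  using power_increasing[of e "capx w" "2::nat"] by linarith

lemma capacious_params: "capacious (params n)"
proof -
  let ?w = "bits n"
  have "eq q \<le> 2 ^ capx ?w" for q
  proof (rule capx_ge[of nq])
    have "nq < 2 ^ nq" by simp
    then show "eq q \<le> 2 ^ nq" using nq[of q] by linarith
  qed (simp add: capx_def)
  moreover have "S ^ (2 * origin ?w) \<le> 2 ^ capx ?w"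
    by (rule capx_ge[OF _ power_le_two_power]) (simp add: capx_def)
  moreover have "D ^ steps ?w \<le> 2 ^ capx ?w"
    by (rule capx_ge[OF _ power_le_two_power]) (simp add: capx_def)
  moreover have "2 ^ (2 * prec ?w * steps ?w) \<le> (2::nat) ^ capx ?w"
    by (rule capx_ge[OF _ order_refl]) (simp add: capx_def)
  moreover have "2 ^ ux ?w \<le> (2::nat) ^ capx ?w"
    by (rule capx_ge[OF _ order_refl]) (simp add: capx_def)
  moreover have "(2 ^ ux ?w) ^ steps ?w \<le> (2::nat) ^ capx ?w"
    unfolding power_mult[symmetric] by (rule capx_ge[OF _ order_refl]) (simp add: capx_def add_mult_distrib2)
  moreover have "2 ^ origin ?w \<le> (2::nat) ^ capx ?w"
    by (rule capx_ge[OF _ order_refl]) (simp add: capx_def)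
  ultimately show ?thesis unfolding capacious_def params_def fst_conv snd_conv ux_def[symmetric]
    using less_bits[of n] by simp
qed

lemma base_params: "base (params n) = 2 ^ (bits n + 1)" "base (params n) ^ nfields (bits n) \<le> pN (params n)"
proof -
  have "2 ^ (bits n + 1) \<le> (2::nat) ^ capx (bits n)" by (rule capx_ge[OF _ order_refl]) (simp add: capx_def)
  then show b: "base (params n) = 2 ^ (bits n + 1)" by (simp add: base_def params_def min_absorb2)
  have "2 ^ ((bits n + 1) * nfields (bits n)) \<le> (2::nat) ^ capx (bits n)"
    by (rule capx_ge[OF _ order_refl]) (simp add: capx_def add_mult_distrib2)
  then show "base (params n) ^ nfields (bits n) \<le> pN (params n)"
    unfolding b power_mult[symmetric] by (simp add: params_def)
qed

lemma lookup_params: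
  assumes "i < 2 * nent"
  shows "lookup (params n) (2 * i) = fst (vals (bits n) ! i) - snd (vals (bits n) ! i)"
    and "lookup (params n) (2 * i + 1) = snd (vals (bits n) ! i) - fst (vals (bits n) ! i)"
proof -
  let ?w = "bits n"
  have "2 ^ ux ?w \<le> (2::nat) ^ capx ?w" by (rule capx_ge[OF _ order_refl]) (simp add: capx_def)
  then have u: "unit (params n) = 2 ^ ux ?w" by (simp add: unit_def params_def ux_def min_absorb2)
  have c: "min (pN (params n)) ((2 ^ ux ?w) ^ j) = (2 ^ ux ?w) ^ j" if "j \<le> 4 * nent" for j
  proof -
    have "ux ?w * j \<le> ux ?w * (steps ?w + 4 * nent + 1)" by (rule mult_le_mono2) (use that in simp)
    then have "ux ?w * j \<le> capx ?w" unfolding capx_def by linarith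
    then have "(2 ^ ux ?w) ^ j \<le> (2::nat) ^ capx ?w" unfolding power_mult[symmetric] by (rule capx_ge[OF _ order_refl])
    then show ?thesis by (simp add: params_def min_absorb2)
  qed
  have l: "i < length (vals ?w)" using assms by (simp add: vals_def amps_def)
  have V: "pV (params n) = pack (ux ?w) 0 (vals ?w)" by (simp add: params_def)
  show "lookup (params n) (2 * i) = fst (vals ?w ! i) - snd (vals ?w ! i)"
    "lookup (params n) (2 * i + 1) = snd (vals ?w ! i) - fst (vals ?w ! i)"
    unfolding lookup_def u V using c[of "2 * i"] c[of "2 * i + 1"] assms pack_digits[OF vals_less l] by simp_all
qed

lemma lookup_close:
  assumes d: "d < D"
  shows "\<bar>real (lookup (params n) (entry c d)) / 2 ^ prec (bits n) - part (d mod 4) (delta M (scanned c) (act (d div 4)))\<bar> \<le> 1 / 2 ^ prec (bits n)"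
proof -
  let ?k = "prec (bits n)" and ?j = "d div 4"
  let ?u = "es (work c (whead c))" and ?v = "es (query c (qhead c))" and ?q = "eq (state c)"
  have j: "?j < nY" using d by (simp add: D less_mult_imp_div_less)
  define a where "a = ((?q * S + ?u) * S + ?v) * nY + ?j"
  have d1: "a div nY = (?q * S + ?u) * S + ?v" "a mod nY = ?j" using j by (simp_all add: a_def)
  have d2: "((?q * S + ?u) * S + ?v) div S = ?q * S + ?u" "((?q * S + ?u) * S + ?v) mod S = ?v" using es_less[of "query c (qhead c)"] by simp_all
  have d3: "(?q * S + ?u) div S = ?q" "(?q * S + ?u) mod S = ?u" using es_less[of "work c (whead c)"] by simp_all
  have inv: "inv eq (eq q) = q" "inv es (es s) = s" for q s
    using eq es(1) by (simp_all add: bij_betw_def inv_into_f_f)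
  have amp: "amp a = delta M (scanned c) (act ?j)"
    unfolding amp_def d1 d2 d3 inv scanned_def ..
  have lt: "x * b + y < (X::nat) * b" if "x < X" "y < b" for x y b X
  proof -
    have "x * b + y < (x + 1) * b" using that(2) by simp
    also have "\<dots> \<le> X * b" using that(1) by (intro mult_le_mono1) simp
    finally show ?thesis .
  qed
  have a: "a < nent" unfolding a_def nent_def by (intro lt nq es_less j)
  have e: "entry c d = 4 * a + d mod 4" by (simp add: entry_def a_def)
  have v: "vals (bits n) ! (2 * a) = approx (Re (amp a)) ?k" "vals (bits n) ! (2 * a + 1) = approx (Im (amp a)) ?k"
    using a by (simp_all add: vals_def amps_def)
  note eff = eff_amp[of a]
  have i: "2 * a < 2 * nent" "2 * a + 1 < 2 * nent" using a by auto
  note lk = lookup_params[OF i(1), of n] lookup_params[OF i(2), of n]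
  have "d mod 4 = 0 \<or> d mod 4 = 1 \<or> d mod 4 = 2 \<or> d mod 4 = 3" by linarith
  then show ?thesis
  proof (elim disjE)
    assume u: "d mod 4 = 0"
    have "entry c d = 2 * (2 * a)" using e u by simp
    then show ?thesis using lk(1) v(1) approx_close(1)[OF eff(1), of ?k] u by (simp only: amp[symmetric]) (simp add: part_def)
  next
    assume u: "d mod 4 = 1"
    have "entry c d = 2 * (2 * a) + 1" using e u by simp
    then show ?thesis using lk(2) v(1) approx_close(2)[OF eff(1), of ?k] u by (simp only: amp[symmetric]) (simp add: part_def)
  next
    assume u: "d mod 4 = 2"
    have "entry c d = 2 * (2 * a + 1)" using e u by simp
    then show ?thesis using lk(3) v(2) approx_close(1)[OF eff(2), of ?k] u by (simp only: amp[symmetric]) (simp add: part_def)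
  next
    assume u: "d mod 4 = 3"
    have "entry c d = 2 * (2 * a + 1) + 1" using e u by simp
    then show ?thesis using lk(4) v(2) approx_close(2)[OF eff(2), of ?k] u by (simp only: amp[symmetric]) (simp add: part_def)
  qed
qed

lemma accepts_params: "accepts (params n) y \<longleftrightarrow> input_of (params n) y \<in> L"
proof (rule accepts_iff[OF capacious_params dec _ _ \<Lambda>(1,3,2)])
  show "T (pn (params n)) \<le> steps (pw (params n))" using T by (simp add: params_def)
  fix c d assume "d < D"
  from lookup_close[OF this, of n c]
  show "\<bar>real (lookup (params n) (entry c d)) / 2 ^ prec (pw (params n)) - part (d mod 4) (delta M (scanned c) (act (d div 4)))\<bar>
      \<le> 1 / 2 ^ prec (pw (params n))" by (simp add: params_def)
qed

lemma strategy_params: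
  "strategy n (bits n) (csize (bits n)) (nfields (bits n)) (pN (params n)) (base (params n)) (accepts (params n)) L"
proof
  show "n < 2 ^ bits n" by (rule less_bits)
  show "base (params n) = 2 ^ (bits n + 1)" "base (params n) ^ nfields (bits n) \<le> pN (params n)" by (rule base_params)+
  \<comment> \<open>The summand 1 in \<open>csize\<close> takes care of the case that
    \<open>steps\<close> vanishes.\<close>
  show "0 < csize (bits n)" by (simp add: csize_def)
  show "nfields (bits n) = 2 * csize (bits n) + csize (bits n) * csize (bits n)" by (rule nfields_def)
  show "accepts (params n) e = (ones (pN (params n)) (base (params n)) (nfields (bits n)) n e \<in> L)" for e
    using accepts_params[of n e] by (simp add: input_of_def params_def)
  fix z :: "bool list" assume z: "length z = n"
  have "(80 * T n * T n)\<^sup>2 \<le> csize (bits n)"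
  proof -
    have "(80 * T n * T n)\<^sup>2 \<le> (80 * steps (bits n) * steps (bits n))\<^sup>2"
      using T[of n] by (intro power_mono mult_le_mono) auto
    then show ?thesis unfolding csize_def by linarith
  qed
  then show "\<exists>S\<subseteq>{..<n}. card S \<le> csize (bits n) \<and>
      (\<forall>y. length y = n \<longrightarrow> (\<forall>i\<in>S. y ! i = z ! i) \<longrightarrow> (y \<in> L) = (z \<in> L))"
    using small_certificates_quantum[OF dec z] order_trans by meson
qed

definition table :: "nat \<Rightarrow> bool list" where
  "table n = map (table_bit (params n)) [0..<pN (params n)]"

text \<open>After \<open>k\<close> replies the transcript is below \<open>2 * \<beta> ^ k\<close>,
  so all probed positions lie below the cap, which is the length of the table. By induction the
  machine reproduces \<open>tr\<close>, and the entry at the leaf is the answer by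
  \<open>decision\<close>.\<close>

lemma table_decides:
  assumes x: "length x = n"
  shows "bit_at (table n) (bits n * descend x (table n) (bits n) (csize (bits n) * csize (bits n))) \<longleftrightarrow> x \<in> L"
proof -
  interpret str: strategy n "bits n" "csize (bits n)" "nfields (bits n)" "pN (params n)" "base (params n)" "accepts (params n)" L
    by (rule strategy_params)
  let ?w = "bits n" and ?d = "csize (bits n) * csize (bits n)" and ?p = "params n" and ?\<beta> = "base (params n)"
  have pw: "pw ?p = ?w" "pn ?p = n" by (simp_all add: params_def)
  have dp: "depth ?p = ?d" by (simp add: depth_def pw)
  have dK: "?d \<le> nfields ?w" by (simp add: nfields_def)
  have w: "0 < ?w" by (rule bits_pos)
  have bit: "bit_at (table n) (?w * str.tr x k + b) = table_bit ?p (?w * str.tr x k + b)" if k: "k \<le> ?d" and b: "b < ?w" for k b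
  proof -
    have "?w * str.tr x k + b < ?w * (str.tr x k + 1)" using b by simp
    also have "\<dots> \<le> ?w * (2 * ?\<beta> ^ k)" using str.tr_bounds(2)[of x k] by (intro mult_le_mono2) simp
    also have "\<dots> \<le> 2 ^ ?w * (2 * ?\<beta> ^ k)" by (intro mult_le_mono1) (simp add: less_imp_le)
    also have "\<dots> = 2 ^ (?w + 1 + (?w + 1) * k)" unfolding base_params(1) power_mult[symmetric] by (simp add: power_add)
    also have "\<dots> \<le> 2 ^ capx ?w"
    proof (rule power_increasing)
      have "(?w + 1) * k \<le> (?w + 1) * (nfields ?w + 1)" by (rule mult_le_mono2) (use k dK in simp)
      then show "?w + 1 + (?w + 1) * k \<le> capx ?w" unfolding capx_def by linarith
    qed simp
    also have "\<dots> = pN ?p" by (simp add: params_def)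
    finally have "?w * str.tr x k + b < pN ?p" .
    then show ?thesis by (simp add: bit_at_def table_def)
  qed
  have level: "level ?p (str.tr x k) = k" if k: "k \<le> ?d" for k
  proof -
    have "min (pN ?p) (?\<beta> ^ (j + 1)) \<le> str.tr x k \<longleftrightarrow> j < k" if "j < ?d" for j
    proof -
      have "min (pN ?p) (?\<beta> ^ (j + 1)) = ?\<beta> ^ (j + 1)" by (rule str.pow_min) (use that dK in simp)
      moreover have "?\<beta> ^ (j + 1) \<le> str.tr x k" if "j < k"
      proof -
        have "?\<beta> ^ (j + 1) \<le> ?\<beta> ^ k" using that str.\<beta>_pos by (intro power_increasing) auto
        then show ?thesis using str.tr_bounds(1)[of k x] by linarith
      qed
      moreover have "str.tr x k < ?\<beta> ^ (j + 1)" if "\<not> j < k"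
      proof -
        have "2 * ?\<beta> ^ k \<le> ?\<beta> * ?\<beta> ^ k" using str.\<beta>_pos(2) by (intro mult_le_mono1) simp
        also have "\<dots> = ?\<beta> ^ (k + 1)" by simp
        also have "\<dots> \<le> ?\<beta> ^ (j + 1)" using that str.\<beta>_pos by (intro power_increasing) auto
        finally show ?thesis using str.tr_bounds(2)[of x k] by linarith
      qed
      ultimately show ?thesis by (metis not_le)
    qed
    then have "level ?p (str.tr x k) = (\<Sum>j<?d. of_bool (j < k))"
      unfolding level_def dp by (intro sum.cong) auto
    also have "\<dots> = card {j. j < ?d \<and> j < k}" by (simp add: sum_of_bool_eq Int_def lessThan_def)
    also have "{j. j < ?d \<and> j < k} = {..<k}" using k by auto
    finally show ?thesis by simp
  qed
  have stored: "stored_index (table n) ?w (str.tr x k) = str.asked x k" if k: "k < ?d" for k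
  proof (rule stored_index_eq[OF _ str.asked_less])
    fix b assume b: "b < ?w"
    have dv: "(?w * str.tr x k + b) div ?w = str.tr x k" "(?w * str.tr x k + b) mod ?w = b" using b by simp_all
    have "2 ^ (?w - 1 - b) \<le> pN ?p" unfolding params_def fst_conv by (rule capx_ge[OF _ order_refl]) (simp add: capx_def)
    then show "bit_at (table n) (?w * str.tr x k + b) = odd (str.asked x k div 2 ^ (?w - 1 - b))"
      unfolding bit[OF less_imp_le[OF k] b] table_bit_def Let_def pw dv dp level[OF less_imp_le[OF k]]
      using k by (simp add: pw tree_query_def str.asked_def odd_iff_mod_2_eq_one min_absorb2)
  qed
  have "rec_nat 1 (\<lambda>_ E. E * 2 ^ (?w + 1) + (2 * stored_index (table n) ?w E + of_bool (bit_at x (stored_index (table n) ?w E)))) k = str.tr x k"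
    if "k \<le> ?d" for k
    using that
  proof (induction k)
    case 0 then show ?case by (simp add: str.tr_0)
  next
    case (Suc k)
    let ?f = "\<lambda>_ E. E * 2 ^ (?w + 1) + (2 * stored_index (table n) ?w E + of_bool (bit_at x (stored_index (table n) ?w E)))"
    have "k < ?d" "rec_nat 1 ?f k = str.tr x k" using Suc by simp_all
    then have "rec_nat 1 ?f (Suc k) = str.tr x k * 2 ^ (?w + 1) + (2 * str.asked x k + of_bool (bit_at x (str.asked x k)))"
      using stored[of k] by (simp only: old.nat.simps(7))
    also have "\<dots> = str.tr x (Suc k)" by (simp only: str.tr_Suc base_params(1)[symmetric])
    finally show ?case .
  qed
  then have "descend x (table n) ?w ?d = str.tr x ?d" by (simp add: descend_def)
  moreover have "bit_at (table n) (?w * str.tr x ?d) = accepts ?p (str.tr x ?d - ?\<beta> ^ ?d)"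
    using bit[of ?d 0] w level[of ?d] str.pow_min[OF dK] by (simp add: table_bit_def Let_def pw dp)
  ultimately show ?thesis using str.decision[OF x] by simp
qed

end

context reduction
begin

text \<open>Computing the parameters and the amplitudes takes time polynomial in
  \<open>bits n\<close>; emitting the table is polynomial in the cap and dominates.\<close>

lemma preprocessing:
  "\<exists>P G. poly_bounded (\<lambda>_ (w::nat). G w) \<and> (\<forall>n. preprocesses P n (2 ^ G (bits n)) (table n))"
proof -
  have "PC (\<lambda>_ w. prec w)" by (intro PC_intros)
  from amplitude_table[OF this PC_ux, of "length amps"] obtain R0 where R0: "\<And>R rs. R0 \<le> R \<Longrightarrow> length rs \<le> length amps \<Longrightarrow> \<forall>r\<in>set rs. eff_real r \<Longrightarrow>
    \<exists>G e. tabulates R (length amps) prec ux {..<length rs} rs G e" by (elim exE) metis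
  have "PC (\<lambda>_ (p :: big \<times> nat). (Big (unbig (Big 1) * 2 ^ capx (snd p)), fst p, snd p, Big 0))"
    by (intro PC_intros PC_shift PC_app[OF PC_capx])
  then have "PC (\<lambda>_ (p :: big \<times> nat). (Big (2 ^ capx (snd p)), fst p, snd p, Big 0))" by simp
  then obtain T2 k2 where T2: "computes (\<lambda>_ (p :: big \<times> nat). (Big (2 ^ capx (snd p)), fst p, snd p, Big 0)) T2"
    "\<And>e c. T2 e c \<le> (sz c + 2) ^ k2" unfolding PC_def poly_bounded_def by blast
  obtain k1 where k1: "computes (\<lambda>_ n. (Big n, bits n)) (\<lambda>_ n. (bits n + 2) ^ k1)" using computes_bits by blast
  have A: "computes (\<lambda>_ n. ctx (2 ^ capx (bits n)) n (bits n) 0) (\<lambda>_ n. (bits n + 2) ^ k1 + (bits n + 2) ^ k2)"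
    using computes_comp[OF k1 T2(1), of "\<lambda>_ n. (bits n + 2) ^ k1 + (bits n + 2) ^ k2"] T2(2)[of _ "(Big _, bits _)"] by simp
  obtain GA MA where "implements GA MA (\<lambda>_ c. ctx (2 ^ capx (bits c)) c (bits c) 0) (\<lambda>_ _. []) (\<lambda>_ c. (bits c + 2) ^ k1 + (bits c + 2) ^ k2)"
    by (rule emitsE[OF A])
  note GA = implementsD[OF this]
  \<comment> \<open>With the private memories above all registers that the first stage may change,
    they are still blank after it.\<close>
  define R where "R = R0 + MA + 1"
  have "R0 \<le> R" "\<forall>r\<in>set amps. eff_real r" using eff_amps by (auto simp: R_def)
  then obtain GB e where "tabulates R (length amps) prec ux {..<length amps} amps GB e"
    using R0[OF _ order_refl] by blast
  note GB = tabulatesD[OF this]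
  obtain T4 where T4: "emits (\<lambda>_ c. (c, 0::nat, pN c)) (\<lambda>_ c. map (table_bit c) [0..<pN c]) T4" "poly_bounded T4"
    using emits_table[of table_bit "\<lambda>p. pN p", OF PC_table_bit PC_fst[OF PC_id]] by blast
  obtain k4 where k4: "\<And>e c. T4 e c \<le> (sz c + 2) ^ k4" using T4(2) unfolding poly_bounded_def by blast
  obtain GC MC where "implements GC MC (\<lambda>_ c. (c, 0::nat, pN c)) (\<lambda>_ c. map (table_bit c) [0..<pN c]) T4"
    by (rule emitsE[OF T4(1)])
  note GC = implementsD[OF this]
  define g' where "g' = (GA 0 ;; GB ;; GC 0)"
  \<comment> \<open>The summands are exponents of powers of 2 that bound the stages. The 3 comes
    from \<open>sz (params n) + 2 \<le> 8 * 2 ^ capx (bits n)\<close>, the final 2 from adding four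
    such powers.\<close>
  define G where "G w = (w + 2) * k1 + (w + 2) * k2 + (w + 2) * e + (capx w + 3) * k4 + 2" for w
  have "PC (\<lambda>_. G)" unfolding G_def[abs_def] by (intro PC_intros PC_app[OF PC_capx])
  then have Gb: "poly_bounded (\<lambda>_ w. G w)" by (rule PC_size_nat)
  have "preprocesses (g' 0) n (2 ^ G (bits n)) (table n)" for n
  proof -
    let ?w = "bits n" and ?N = "2 ^ capx (bits n) :: nat"
    define \<mu> :: "nat \<Rightarrow> nat" where "\<mu> = (\<lambda>_. 0)(0 := n)"
    have "holds \<mu> 0 n" by (simp add: \<mu>_def)
    from GA[OF this, of "[]" "[]" "[]"] obtain t1 \<mu>1 where 1: "t1 \<le> (?w + 2) ^ k1 + (?w + 2) ^ k2"
      "runs [] [] (GA 0) t1 (\<mu>, []) (\<mu>1, [])" "holds \<mu>1 0 (ctx ?N n ?w 0)" "\<And>j. 0 + MA \<le> j \<Longrightarrow> \<mu>1 j = \<mu> j" by auto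
    have "\<mu>1 (relocate R (length amps) j i) = 0" for i j
    proof -
      have "0 + MA \<le> relocate R (length amps) j i" "0 < relocate R (length amps) j i"
        by (simp_all add: relocate_def R_def)
      then show ?thesis using 1(4) by (simp add: \<mu>_def)
    qed
    from GB[OF 1(3) this, of "[]" "[]" "[]"] obtain t2 \<mu>2 where 2: "t2 \<le> (?w + 2) ^ e" "runs [] [] GB t2 (\<mu>1, []) (\<mu>2, [])"
      "holds \<mu>2 0 (ctx ?N n ?w (pack (ux ?w) 0 (vals ?w)))" by (auto simp: vals_def)
    have "holds \<mu>2 0 (params n)" using 2(3) by (simp add: params_def holds_prod)
    from GC[OF this, of "[]" "[]" "[]"] obtain t3 \<mu>3 where 3: "t3 \<le> T4 ([], []) (params n)"
      "runs [] [] (GC 0) t3 (\<mu>2, []) (\<mu>3, table n)" by (auto simp: table_def)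
    have len: "length (vals ?w) = 2 * nent" by (simp add: vals_def amps_def)
    have "pack (ux ?w) 0 (vals ?w) < (2 ^ ux ?w) ^ (2 * length (vals ?w))" by (rule pack_less) (rule vals_less)
    also have "\<dots> = 2 ^ (ux ?w * (4 * nent))" unfolding len by (simp flip: power_mult)
    also have "\<dots> \<le> ?N" by (rule capx_ge[OF _ order_refl]) (simp add: capx_def add_mult_distrib2)
    finally have "pack (ux ?w) 0 (vals ?w) \<le> ?N" by simp
    moreover have "n \<le> ?N" by (rule capx_ge[of ?w]) (use less_bits[of n] in \<open>simp_all add: capx_def less_imp_le\<close>)
    moreover have "?w \<le> ?N" by (rule capx_ge[of ?w]) (simp_all add: capx_def less_imp_le)
    moreover have "1 \<le> ?N" by simp
    ultimately have "sz (params n) + 2 \<le> 8 * ?N" unfolding params_def sz_simps fst_conv snd_conv by linarith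
    then have "(sz (params n) + 2) ^ k4 \<le> (2 ^ (capx ?w + 3)) ^ k4" by (intro power_mono) (simp_all add: power_add)
    then have t3: "t3 \<le> 2 ^ ((capx ?w + 3) * k4)" using order_trans[OF 3(1) k4] by (simp add: power_mult)
    have "(?w + 2) ^ k \<le> (2 ^ (?w + 2)) ^ k" for k by (rule power_mono) (simp_all only: less_imp_le[OF less_exp] zero_le)
    then have tw: "(?w + 2) ^ k \<le> 2 ^ ((?w + 2) * k)" for k by (simp only: power_mult)
    define m where "m = (?w + 2) * k1 + (?w + 2) * k2 + (?w + 2) * e + (capx ?w + 3) * k4"
    have up: "(2::nat) ^ a \<le> 2 ^ m" if "a \<le> m" for a using that by (intro power_increasing) auto
    have "(?w + 2) ^ k1 \<le> 2 ^ m" "(?w + 2) ^ k2 \<le> 2 ^ m" "(?w + 2) ^ e \<le> 2 ^ m" "t3 \<le> 2 ^ m"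
      by (rule order_trans[OF tw up], simp add: m_def)+ (rule order_trans[OF t3 up], simp add: m_def)
    then have "t1 + (t2 + t3) \<le> 4 * 2 ^ m" using 1(1) 2(1) by linarith
    also have "\<dots> = 2 ^ G ?w" unfolding G_def m_def[symmetric] by (simp add: power_add)
    finally have t: "t1 + (t2 + t3) \<le> 2 ^ G ?w" .
    have "runs [] [] g' (t1 + (t2 + t3)) (\<mu>, []) (\<mu>3, table n)"
      unfolding g'_def by (rule runs_seq[OF 1(2) runs_seq[OF 2(2) 3(2)]])
    from runs_program[OF this \<mu>_def t] show ?thesis by (simp add: preprocesses_def)
  qed
  then show ?thesis using Gb by blast
qed

lemma decided:
  "\<exists>T' p q. polylog T' \<and> polybounded p \<and> quasipoly q \<and> decided_with_preprocessing L (\<lambda>n. p (2 ^ m n) * q n) T'"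
proof -
  obtain P G where P: "poly_bounded (\<lambda>_ (w::nat). G w)" "\<And>n. preprocesses P n (2 ^ G (bits n)) (table n)"
    using preprocessing by blast
  have "PC (\<lambda>_ w. csize w * csize w)" by (intro PC_intros)
  from deciding_machine[OF this] obtain Q k where Q: "\<And>x a. ram_decides Q x a ((bits (length x) + 2) ^ k)
     (bit_at a (bits (length x) * descend x a (bits (length x)) (csize (bits (length x)) * csize (bits (length x)))))" by blast
  have "polylog (\<lambda>n. (bits n + 2) ^ k)" by (rule polylog_bits) (auto simp: poly_bounded_nat)
  moreover have "quasipoly (\<lambda>n. 2 ^ G (bits n))" unfolding quasipoly_def using polylog_bits[OF P(1)] by blast
  moreover have "polybounded (\<lambda>_. 1)" unfolding polybounded_def by (intro exI[of _ 1]) simp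
  moreover have "ram_decides Q x (table n) ((bits n + 2) ^ k) (x \<in> L)" if "length x = n" for x n
    using Q[of x "table n"] table_decides[OF that] that by simp
  then have "decided_with_preprocessing L (\<lambda>n. 1 * 2 ^ G (bits n)) (\<lambda>n. (bits n + 2) ^ k)"
    unfolding decided_with_preprocessing_def using P(2) by (intro exI[of _ P] exI[of _ Q] allI) auto
  ultimately show ?thesis by (intro exI[of _ "\<lambda>n. (bits n + 2) ^ k"] exI[of _ "\<lambda>_. 1"] exI[of _ "\<lambda>n. 2 ^ G (bits n)"]) simp
qed

end

theorem corollary2p3:
  fixes L :: "bool list set"
    and M :: "('q::finite, 's::finite) qtm"
    and T m :: "nat \<Rightarrow> nat"
  assumes "polylog T"
    and "qtm_decides M L T m"
  shows "\<exists>T' p q. polylog T' \<and> polybounded p \<and> quasipoly q \<and>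
           decided_with_preprocessing L (\<lambda>n. p (2 ^ m n) * q n) T'"
proof -
  obtain \<kappa> where \<kappa>: "\<And>n. T n \<le> \<kappa> * bits n ^ \<kappa>" using polylog_bound[OF assms(1)] by blast
  have wf: "well_formed M" using assms(2) by (simp add: qtm_decides_def)
  define nY where "nY = card (UNIV :: ('q, 's) action set)"
  obtain act :: "nat \<Rightarrow> ('q, 's) action" where act: "bij_betw act {..<nY} UNIV"
    using ex_bij_betw_nat_finite[of "UNIV :: ('q, 's) action set"] by (auto simp: nY_def atLeast0LessThan)
  define nq where "nq = card (UNIV :: 'q set)"
  obtain eq :: "'q \<Rightarrow> nat" where eq: "bij_betw eq UNIV {0..<nq}"
    using ex_bij_betw_finite_nat[of "UNIV :: 'q set"] by (auto simp: nq_def)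
  define S where "S = card (UNIV :: 's set)"
  \<comment> \<open>The blank symbol gets code 0, so that blank cells contribute nothing to the
    number of a tape.\<close>
  have "card (UNIV - {blank M}) = card {1..<S}" by (simp add: S_def card_Diff_singleton)
  then obtain h where h: "bij_betw h (UNIV - {blank M}) {1..<S}"
    using finite_same_card_bij[of "UNIV - {blank M}" "{1..<S}"] by auto
  define es where "es s = (if s = blank M then 0 else h s)" for s
  have S0: "0 < S" by (simp add: S_def card_gt_0_iff)
  have "bij_betw es ({blank M} \<union> (UNIV - {blank M})) ({0} \<union> {1..<S})"
  proof (rule bij_betw_combine)
    show "bij_betw es {blank M} {0}" by (simp add: es_def bij_betw_def)
    show "bij_betw es (UNIV - {blank M}) {1..<S}"
      using h by (subst bij_betw_cong[of _ _ h]) (auto simp: es_def)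
  qed simp
  moreover have "{blank M} \<union> (UNIV - {blank M}) = UNIV" "{0} \<union> {1..<S} = {..<S}" using S0 by auto
  ultimately have es: "bij_betw es UNIV {..<S}" by simp
  \<comment> \<open>A crude common bound for all amplitudes, available because states and symbols
    are finite in number.\<close>
  define X where "X = (\<Sum>p\<in>UNIV. cmod (delta M (fst p) (snd p)))"
  define \<Lambda> where "\<Lambda> = nat \<lceil>X\<rceil> + 2"
  have \<Lambda>: "part u (delta M a b) + 1 \<le> real \<Lambda>" for u a b
  proof -
    have "part u z \<le> cmod z" for z
      using complex_Re_le_cmod[of z] complex_Re_le_cmod[of "- z"] abs_Im_le_cmod[of z] by (auto simp: part_def)
    also have "cmod (delta M a b) \<le> X"
      unfolding X_def using member_le_sum[of "(a, b)" UNIV "\<lambda>p. cmod (delta M (fst p) (snd p))"] by simp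
    also have "X \<le> real (nat \<lceil>X\<rceil>)" by (rule real_nat_ceiling_ge)
    finally show ?thesis by (simp add: \<Lambda>_def)
  qed
  \<comment> \<open>The exponent \<open>g\<close> is taken to be \<open>D * \<Lambda>\<close>
    itself, since \<open>x \<le> 2 ^ x\<close>.\<close>
  have "reduction M act nY (nY * 4) es eq S (nY * 4 * \<Lambda>) \<kappa> nq \<Lambda> L T m"
  proof unfold_locales
    show "bij_betw act {..<nY} UNIV" by (rule act)
    show "well_formed M" by (rule wf)
    show "bij_betw es UNIV {..<S}" by (rule es)
    show "es (blank M) = 0" by (simp add: es_def)
    show "inj eq" using eq by (simp add: bij_betw_def)
    show "eq q < nq" for q using eq by (auto simp: bij_betw_def)
    show "part u (delta M a b) + 1 \<le> real \<Lambda>" for u a b by (rule \<Lambda>)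
    show "2 \<le> \<Lambda>" by (simp add: \<Lambda>_def)
    show "nY * 4 * \<Lambda> \<le> 2 ^ (nY * 4 * \<Lambda>)" by (rule less_imp_le[OF less_exp])
    show "qtm_decides M L T m" by (rule assms(2))
    have "machine M act nY (nY * 4) es eq S" using act wf es eq by unfold_locales (auto simp: es_def bij_betw_def)
    then show "T n \<le> machine.steps \<kappa> (bits n)" for n using \<kappa>[of n] by (simp add: machine.steps_def)
  qed (rule refl)
  then show ?thesis by (rule reduction.decided)
qed

end
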